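(* Let $\alpha,\beta,\gamma$ be nonzero real constants with $\kappa:=-\frac{\alpha\gamma}{2\beta}>0$, and let $B>0$. For any $r<\infty$ and any $N\in\mathbb{N}$, $$\exp\Big(-\frac{\alpha}{2}\int\mathbb{P}_N\psi\,|\mathbb{P}_N\phi|^2dx\Big)\chi_{\Omega_{N,B}}\in L^r\big(d(a_0,b_0)\otimes d\rho_N\big),$$ $$\exp\Big(-\frac{\alpha}{2}\int\psi\,|\phi|^2dx\Big)\chi_{\Omega_B}\in L^r\big(d(a_0,b_0)\otimes d\rho\big).$$
   Context: Write $\phi=\sum_{n\in\mathbb{Z}}a_ne^{inx}$ (complex-valued) and $\psi=\sum_{n\in\mathbb{Z}}b_ne^{inx}$ (real-valued, so $b_{-n}=\overline{b_n}$) for functions on $\mathbb{T}=[0,2\pi)$; $\mathbb{P}_N$ is the projection onto frequencies $|n|\le N$. Integrals over $\mathbb{T}$ are normalized by $\frac1{2\pi}$ (immaterial here); $\int\psi|\phi|^2dx$ is understood as the pairing $\sum_n\widehat{\psi}(-n)\widehat{|\phi|^2}(n)$. $\Omega_{N,B}=\{(a_n,b_n)_{|n|\le N}:\ \|(a_n)\|_{\ell^2}\le B,\ |b_0|\le B\}$ and $\Omega_B=\{(a_n,b_n)_{n\in\mathbb{Z}}:\ \|(a_n)\|_{\ell^2}\le B,\ |b_0|\le B\}$. $\rho_N$ is the probability measure on $(a_n,b_n)_{0<|n|\le N}$ with $$d\rho_N=\widetilde Z_N^{-1}e^{-\frac12\sum_{0<|n|\le N}(n^2|a_n|^2+\kappa|n||b_n|^2)}\prod_{0<|n|\le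 N}d(a_n\otimes b_n),$$ and $\rho$ is the Gaussian probability measure on $(a_n,b_n)_{n\ne0}$ given formally by the same expression with the sum and product over all $n\ne0$. That is, the variables $a_n$ ($n\neq0$) and $b_n$ ($n\ge1$) are independent centered complex Gaussians with independent real and imaginary parts of variance $\frac1{n^2}$ for $a_n$ and $\frac1{2\kappa n}$ for $b_n$, and $b_{-n}=\overline{b_n}$. $d(a_0,b_0)$ is Lebesgue measure on $\mathbb{C}\times\mathbb{R}$. *)

theory Defs
  imports "HOL-Probability.Probability"
begin

definition torus :: "real measure" where
  "torus = uniform_measure lborel {0..<2 * pi}"

definition fourier_coeff :: "(real \<Rightarrow> complex) \<Rightarrow> int \<Rightarrow> complex" where
  "fourier_coeff f n = (LINT x|torus. f x * cis (- (of_int n * x)))"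

definition trig_sum :: "nat \<Rightarrow> (int \<Rightarrow> complex) \<Rightarrow> real \<Rightarrow> complex" where
  "trig_sum N a x = (\<Sum>n\<in>{- int N..int N}. a n * cis (of_int n * x))"

text \<open>The series with coefficients \<open>a\<close> is summed in \<open>L\<^sup>2\<close> of the torus. The sum exists exactly
  when \<open>a\<close> is square-summable and is then unique up to null sets, which the integrals below
  do not see.\<close>

definition is_fourier_series :: "(int \<Rightarrow> complex) \<Rightarrow> (real \<Rightarrow> complex) \<Rightarrow> bool" where
  "is_fourier_series a f \<longleftrightarrow>
     f \<in> borel_measurable torus \<and>
     integrable torus (\<lambda>x. (cmod (f x))\<^sup>2) \<and>
     (\<lambda>N. LINT x|torus. (cmod (f x - trig_sum N a x))\<^sup>2) \<longlonglongrightarrow> 0"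

definition fourier_series :: "(int \<Rightarrow> complex) \<Rightarrow> real \<Rightarrow> complex" where
  "fourier_series a = (SOME f. is_fourier_series a f)"

text \<open>The terms of the pairing of \<open>\<psi>\<close> with \<open>|\<phi>|\<^sup>2\<close>, where \<open>\<psi>\<close> is given only by its
  coefficients \<open>b\<close> (it is in general a distribution) and \<open>\<phi>\<close> is the function with
  coefficients \<open>a\<close>.\<close>

definition pairing_term :: "(int \<Rightarrow> complex) \<Rightarrow> (int \<Rightarrow> complex) \<Rightarrow> int \<Rightarrow> complex" where
  "pairing_term b a n =
     b (- n) * fourier_coeff (\<lambda>x. complex_of_real ((cmod (fourier_series a x))\<^sup>2)) n"

definition pairing :: "(int \<Rightarrow> complex) \<Rightarrow> (int \<Rightarrow> complex) \<Rightarrow> complex" where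
  "pairing b a = (\<Sum>\<^sub>\<infinity>n. pairing_term b a n)"

definition freq_proj :: "nat \<Rightarrow> (int \<Rightarrow> complex) \<Rightarrow> int \<Rightarrow> complex" where
  "freq_proj N a n = (if \<bar>n\<bar> \<le> int N then a n else 0)"

text \<open>The independent coordinates are \<open>a\<^sub>0\<close>, the real number \<open>b\<^sub>0\<close>, the \<open>a\<^sub>n\<close> with \<open>n \<noteq> 0\<close>
  and the \<open>b\<^sub>n\<close> with \<open>n \<ge> 1\<close>; the remaining \<open>b\<^sub>n\<close> are determined by \<open>\<psi>\<close> being real-valued.\<close>

type_synonym modes = "(int \<Rightarrow> complex) \<times> (int \<Rightarrow> complex)"
type_synonym state = "(complex \<times> real) \<times> modes"

definition conj_extend :: "(int \<Rightarrow> complex) \<Rightarrow> int \<Rightarrow> complex" where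
  "conj_extend b n = (if n > 0 then b n else cnj (b (- n)))"

definition a_coeffs :: "state \<Rightarrow> int \<Rightarrow> complex" where
  "a_coeffs = (\<lambda>((a0, b0), (a, b)) n. if n = 0 then a0 else a n)"

definition b_coeffs :: "state \<Rightarrow> int \<Rightarrow> complex" where
  "b_coeffs = (\<lambda>((a0, b0), (a, b)) n. if n = 0 then complex_of_real b0 else conj_extend b n)"

definition Omega_trunc :: "nat \<Rightarrow> real \<Rightarrow> state set" where
  "Omega_trunc N B =
     {\<omega>. L2_set (\<lambda>n. cmod (a_coeffs \<omega> n)) {n. \<bar>n\<bar> \<le> int N} \<le> B \<and> cmod (b_coeffs \<omega> 0) \<le> B}"

definition Omega :: "real \<Rightarrow> state set" where
  "Omega B =
     {\<omega>. (\<lambda>n. (cmod (a_coeffs \<omega> n))\<^sup>2) summable_on UNIV \<and>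
         sqrt (\<Sum>\<^sub>\<infinity>n. (cmod (a_coeffs \<omega> n))\<^sup>2) \<le> B \<and> cmod (b_coeffs \<omega> 0) \<le> B}"

definition lebesgue_modes :: "nat \<Rightarrow> modes measure" where
  "lebesgue_modes N =
     (\<Pi>\<^sub>M n\<in>{n. 0 < \<bar>n\<bar> \<and> \<bar>n\<bar> \<le> int N}. lborel) \<Otimes>\<^sub>M (\<Pi>\<^sub>M n\<in>{1..int N}. lborel)"

definition gibbs_weight :: "real \<Rightarrow> nat \<Rightarrow> modes \<Rightarrow> real" where
  "gibbs_weight \<kappa> N = (\<lambda>(a, b). exp (- (1 / 2) *
     (\<Sum>n | 0 < \<bar>n\<bar> \<and> \<bar>n\<bar> \<le> int N.
        (of_int n)\<^sup>2 * (cmod (a n))\<^sup>2 + \<kappa> * of_int \<bar>n\<bar> * (cmod (conj_extend b n))\<^sup>2)))"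

definition rho_trunc :: "real \<Rightarrow> nat \<Rightarrow> modes measure" where
  "rho_trunc \<kappa> N = density (lebesgue_modes N)
     (\<lambda>\<omega>. ennreal (gibbs_weight \<kappa> N \<omega> / (LINT \<omega>'|lebesgue_modes N. gibbs_weight \<kappa> N \<omega>')))"

text \<open>The parameter is the variance of the real and of the imaginary part.\<close>

definition complex_gaussian :: "real \<Rightarrow> complex measure" where
  "complex_gaussian v =
     distr (density lborel (normal_density 0 (sqrt v)) \<Otimes>\<^sub>M density lborel (normal_density 0 (sqrt v)))
       borel (\<lambda>(x, y). Complex x y)"

definition rho :: "real \<Rightarrow> modes measure" where
  "rho \<kappa> =
     (\<Pi>\<^sub>M n\<in>{n. n \<noteq> 0}. complex_gaussian (1 / (of_int n)\<^sup>2)) \<Otimes>\<^sub>M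
     (\<Pi>\<^sub>M n\<in>{n. n \<ge> 1}. complex_gaussian (1 / (2 * \<kappa> * of_int n)))"

definition in_Lp :: "real \<Rightarrow> 'a measure \<Rightarrow> ('a \<Rightarrow> complex) \<Rightarrow> bool" where
  "in_Lp r M f \<longleftrightarrow> f \<in> borel_measurable M \<and> integrable M (\<lambda>x. cmod (f x) powr r)"

end

theory Submission
  imports Defs
begin

text \<open>Let \<open>c\<^sub>n = \<Sum>\<^sub>k a\<^bsub>k+n\<^esub> cnj a\<^sub>k\<close> be the Fourier coefficients of \<open>|\<phi>|\<^sup>2\<close>. For fixed \<open>a\<close> the real
  part of the pairing is \<open>b\<^sub>0 c\<^sub>0\<close>, bounded on \<open>\<Omega>\<^sub>B\<close>, plus a linear functional of the Gaussian
  variables \<open>b\<^sub>n\<close>. Integrating these out leaves \<open>exp (D \<Sum>\<^bsub>n\<ge>1\<^esub> |c\<^sub>n|\<^sup>2 / n)\<close>. On \<open>\<Omega>\<^sub>B\<close> one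
  has \<open>|c\<^sub>n| \<le> B\<^sup>2\<close>, and for every \<open>l > 0\<close> also \<open>n\<^bsup>1/4\<^esup> |c\<^sub>n| \<le> l H + B\<^sup>2 / l\<close> where
  \<open>H = \<Sum>\<^sub>k |k|\<^bsup>1/2\<^esup> |a\<^sub>k|\<^sup>2\<close>. Using each bound for one factor of \<open>|c\<^sub>n|\<^sup>2\<close>, the exponent is at most
  \<open>K + H / 4\<close> once \<open>l\<close> is small, and \<open>exp (H / 4)\<close> is integrable because \<open>H\<close> is a convergent
  weighted sum of squares of independent Gaussians. Fatou's lemma carries the bounds from partial
  sums to the full pairing.\<close>

section \<open>Fourier series of square-summable coefficients\<close>

text \<open>\<open>infsum\<close> is \<open>0\<close> on divergent families and
  \<open>fourier_series\<close> is a choice, so before any estimate the coefficients of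
  \<open>|phi|^2\<close> must be freed from the representative and the pairing shown to converge
  absolutely almost surely. The latter is a first-moment bound: \<open>|b_n|\<close> has mean of
  order \<open>n^(-1/2)\<close> and \<open>|a_j| |a_k|\<close> of order
  \<open>1 / (|j| |k|)\<close>, with a convergent double sum.

  The obstacle in the exponential is that \<open>|c_n| <= B^2\<close> alone leaves the divergent sum
  of \<open>1 / n\<close>, whereas squaring the weighted bound puts \<open>H^2\<close> into the
  exponent, and \<open>exp (c * H^2)\<close> has infinite integral under the Gaussian measure for
  every \<open>c > 0\<close>. The mixed product is linear in \<open>H\<close>, and the free
  \<open>l\<close> brings its coefficient below any threshold, whatever \<open>r\<close>,
  \<open>B\<close> and the couplings are. The power \<open>1/2\<close> in \<open>H\<close> could be
  any number strictly between 0 and 1: below 1 for \<open>H\<close> to have finite mean, above 0 for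
  decay of \<open>c_n\<close>. The coefficient \<open>1/4\<close> keeps every mode in the range
  where a Gaussian integrates the exponential of its square.

  With finitely many modes, constants may depend on \<open>N\<close>, and linear growth in
  \<open>b\<close> against quadratic decay is enough.\<close>

lemma sets_torus [simp, measurable_cong]: "sets torus = sets borel"
  by (simp add: torus_def)

lemma prob_space_torus: "prob_space torus"
  unfolding torus_def by (rule prob_space_uniform_measure) auto

interpretation torus: prob_space torus
  by (rule prob_space_torus)

lemma torus_eq_density:
  "torus = density lborel (\<lambda>x. ennreal (indicator {0..<2*pi} x / (2 * pi)))"
  unfolding torus_def uniform_measure_def
  by (rule arg_cong2[where f = density], simp, rule ext)
     (simp add: indicator_def divide_ennreal[of 1, simplified])

lemma integrable_torus_bounded:
  fixes f :: "real \<Rightarrow> 'b::{banach, second_countable_topology}"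
  assumes "f \<in> borel_measurable borel" "\<And>x. norm (f x) \<le> C"
  shows "integrable torus f"
proof (rule torus.integrable_const_bound)
  show "f \<in> borel_measurable torus"
    using assms(1) by (simp add: measurable_cong_sets[OF sets_torus refl])
qed (use assms in auto)

lemma borel_measurable_cis [measurable (raw)]:
  "f \<in> borel_measurable M \<Longrightarrow> (\<lambda>x. cis (f x)) \<in> borel_measurable M"
  unfolding cis_conv_exp by measurable

lemma integral_torus_cis:
  "(LINT x|torus. cis (of_int m * x)) = (if m = 0 then 1 else 0)"
proof (cases "m = 0")
  case True
  then show ?thesis using torus.prob_space by simp
next
  case False
  define F where "F x = - \<i> / of_int m * cis (of_int m * x)" for x :: real
  have F: "(F has_vector_derivative cis (of_int m * x)) (at x within S)" for x S
    unfolding F_def cis_conv_exp using False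
    by (auto intro!: derivative_eq_intros has_vector_derivative_real_field simp: field_simps)
  have bnd: "F (2 * pi) - F 0 = 0"
  proof -
    have "cis (of_int m * (2 * pi)) = 1"
      by (metis cis_multiple_2pi Ints_of_int mult.commute)
    then show ?thesis by (simp add: F_def)
  qed
  have cont: "continuous_on {0..2*pi} (\<lambda>x. cis (of_int m * x))"
    by (intro continuous_intros)
  have "(LINT x|torus. cis (of_int m * x))
      = (LINT x|lborel. (indicator {0..<2*pi} x / (2 * pi)) *\<^sub>R cis (of_int m * x))"
    unfolding torus_eq_density by (subst integral_density) (auto simp: indicator_def)
  \<comment> \<open>The half-open interval is closed by adding a null point, to fit the fundamental
    theorem of calculus.\<close>
  also have "\<dots> = (LINT x|lborel. (1 / (2 * pi)) *\<^sub>R (indicator {0..2*pi} x *\<^sub>R cis (of_int m * x)))"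
  proof (intro integral_cong_AE)
    show "AE x in lborel. (indicat_real {0..<2 * pi} x / (2 * pi)) *\<^sub>R cis (real_of_int m * x) =
                  (1 / (2 * pi)) *\<^sub>R indicat_real {0..2 * pi} x *\<^sub>R cis (real_of_int m * x)"
      by (rule AE_mp[OF AE_lborel_singleton[of "2*pi"]]) (auto simp: indicator_def)
  qed auto
  also have "\<dots> = (1 / (2 * pi)) *\<^sub>R (F (2 * pi) - F 0)"
    unfolding integral_scaleR_right
    by (subst integral_FTC_Icc[where F = F]) (use F cont in auto)
  finally show ?thesis using False bnd by simp
qed

lemma integrable_torus_cis: "integrable torus (\<lambda>x. cis (of_int m * x))"
  by (rule integrable_torus_bounded[where C = 1]) auto

text \<open>Arbitrary index sets are allowed so that the difference of two partial sums is again of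
  this form and has its own Parseval identity.\<close>

definition trig_poly :: "int set \<Rightarrow> (int \<Rightarrow> complex) \<Rightarrow> real \<Rightarrow> complex" where
  "trig_poly J a x = (\<Sum>n\<in>J. a n * cis (of_int n * x))"

lemma trig_sum_eq_trig_poly: "trig_sum N a = trig_poly {- int N..int N} a"
  by (simp add: fun_eq_iff trig_sum_def trig_poly_def)

lemma borel_measurable_trig_poly [measurable]: "trig_poly J a \<in> borel_measurable borel"
  unfolding trig_poly_def[abs_def] by measurable

lemma norm_trig_poly_le: "norm (trig_poly J a x) \<le> (\<Sum>n\<in>J. norm (a n))"
  unfolding trig_poly_def by (rule order_trans[OF norm_sum]) (simp add: norm_mult)

lemma trig_poly_diff:
  assumes "finite K" "J \<subseteq> K"
  shows "trig_poly K a x - trig_poly J a x = trig_poly (K - J) a x"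
  unfolding trig_poly_def using assms by (simp add: sum_diff)

lemma integrable_norm_trig_poly: "integrable torus (\<lambda>x. norm (trig_poly J a x))"
  by (rule integrable_torus_bounded[where C = "\<Sum>n\<in>J. norm (a n)"])
     (auto intro: norm_trig_poly_le)

lemma integrable_norm_trig_poly_sq: "integrable torus (\<lambda>x. (norm (trig_poly J a x))\<^sup>2)"
  by (rule integrable_torus_bounded[where C = "(\<Sum>n\<in>J. norm (a n))\<^sup>2"])
     (auto intro!: power_mono norm_trig_poly_le)

text \<open>Expanding the squared modulus gives a double sum over \<open>j\<close> and
  \<open>k\<close>, of which orthogonality of the characters keeps the terms with
  \<open>j = k + n\<close>. The condition \<open>k + n \<in> J\<close> is the trace that the
  truncation leaves in the autocorrelation sum.\<close>

lemma fourier_coeff_norm_trig_poly: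
  assumes "finite J"
  shows "fourier_coeff (\<lambda>x. complex_of_real ((norm (trig_poly J a x))\<^sup>2)) n
       = (\<Sum>k\<in>{k\<in>J. k + n \<in> J}. a (k + n) * cnj (a k))"
proof -
  have eq: "complex_of_real ((norm (trig_poly J a x))\<^sup>2) * cis (- (of_int n * x))
      = (\<Sum>k\<in>J. \<Sum>j\<in>J. (a j * cnj (a k)) * cis (of_int (j - k - n) * x))" for x
  proof -
    have "complex_of_real ((norm (trig_poly J a x))\<^sup>2) = cnj (trig_poly J a x) * trig_poly J a x"
      unfolding complex_norm_square by (rule mult.commute)
    also have "\<dots> = (\<Sum>k\<in>J. \<Sum>j\<in>J. cnj (a k) * cis (- (of_int k * x)) * (a j * cis (of_int j * x)))"
      unfolding trig_poly_def by (simp add: sum_product cis_cnj)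
    finally have "complex_of_real ((norm (trig_poly J a x))\<^sup>2)
        = (\<Sum>k\<in>J. \<Sum>j\<in>J. cnj (a k) * cis (- (of_int k * x)) * (a j * cis (of_int j * x)))" .
    moreover have "cis (of_int (j - k - n) * x)
        = cis (- (of_int k * x)) * cis (of_int j * x) * cis (- (of_int n * x))" for j k
      by (simp add: cis_mult algebra_simps)
    ultimately show ?thesis
      by (simp only: sum_distrib_left mult_ac)
  qed
  have "fourier_coeff (\<lambda>x. complex_of_real ((norm (trig_poly J a x))\<^sup>2)) n
      = (\<Sum>k\<in>J. \<Sum>j\<in>J. LINT x|torus. (a j * cnj (a k)) * cis (of_int (j - k - n) * x))"
    unfolding fourier_coeff_def eq
    by (subst Bochner_Integration.integral_sum
        | intro Bochner_Integration.integrable_sum integrable_mult_right integrable_torus_cis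
          sum.cong refl)+
  also have "\<dots> = (\<Sum>k\<in>J. \<Sum>j\<in>J. if j = k + n then a j * cnj (a k) else 0)"
    unfolding integral_mult_right_zero integral_torus_cis
    by (intro sum.cong refl) (auto simp: algebra_simps)
  also have "\<dots> = (\<Sum>k\<in>J. if k + n \<in> J then a (k + n) * cnj (a k) else 0)"
    using assms by simp
  also have "\<dots> = (\<Sum>k\<in>{k\<in>J. k + n \<in> J}. a (k + n) * cnj (a k))"
    using assms by (simp add: sum.inter_filter)
  finally show ?thesis .
qed

text \<open>Parseval, read off as the zeroth Fourier coefficient of the squared modulus.\<close>

lemma integral_norm_trig_poly_sq:
  assumes "finite J"
  shows "(LINT x|torus. (norm (trig_poly J a x))\<^sup>2) = (\<Sum>k\<in>J. (norm (a k))\<^sup>2)"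
proof -
  have "complex_of_real (LINT x|torus. (norm (trig_poly J a x))\<^sup>2) =
      fourier_coeff (\<lambda>x. complex_of_real ((norm (trig_poly J a x))\<^sup>2)) 0"
    by (simp add: fourier_coeff_def del: of_real_power)
  also have "\<dots> = complex_of_real (\<Sum>k\<in>J. (norm (a k))\<^sup>2)"
    unfolding fourier_coeff_norm_trig_poly[OF assms] by (simp add: complex_norm_square del: of_real_power)
  finally show ?thesis by (simp only: of_real_eq_iff)
qed

text \<open>These index sets come from the truncated autocorrelation with shift \<open>n\<close>.
  They exhaust the integers, so an unconditional sum is also the limit along them.\<close>

lemma filterlim_finite_subsets_int:
  "filterlim (\<lambda>N. {k \<in> {- int N..int N}. k + n \<in> {- int N..int N}}) (finite_subsets_at_top UNIV) sequentially"
  unfolding filterlim_finite_subsets_at_top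
proof safe
  fix X :: "int set" assume X: "finite X"
  \<comment> \<open>The summand \<open>\<bar>n\<bar>\<close> leaves room for the shift: for
    \<open>N >= m\<close> both \<open>k\<close> and \<open>k + n\<close> lie in the window.\<close>
  define m where "m = nat (Max (abs ` insert 0 X) + \<bar>n\<bar>)"
  have m: "\<bar>k\<bar> + \<bar>n\<bar> \<le> int m" if "k \<in> X" for k
  proof -
    have "\<bar>k\<bar> \<le> Max (abs ` insert 0 X)" using X that by (intro Max_ge) auto
    then show ?thesis unfolding m_def by linarith
  qed
  show "\<forall>\<^sub>F N in sequentially. finite {k \<in> {- int N..int N}. k + n \<in> {- int N..int N}} \<and>
    X \<subseteq> {k \<in> {- int N..int N}. k + n \<in> {- int N..int N}} \<and>
    {k \<in> {- int N..int N}. k + n \<in> {- int N..int N}} \<subseteq> UNIV"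
    using eventually_ge_at_top[of m]
  proof eventually_elim
    case (elim N)
    show ?case using m elim by (fastforce dest: m)
  qed
qed

lemma has_sum_imp_tendsto_shifted:
  fixes f :: "int \<Rightarrow> 'a::{comm_monoid_add,topological_space}"
  assumes "(f has_sum s) UNIV"
  shows "(\<lambda>N. \<Sum>k\<in>{k \<in> {- int N..int N}. k + n \<in> {- int N..int N}}. f k) \<longlonglongrightarrow> s"
  using filterlim_compose[OF assms[unfolded has_sum_def] filterlim_finite_subsets_int[of n]]
  by simp

lemma has_sum_imp_tendsto_symmetric:
  fixes f :: "int \<Rightarrow> 'a::{comm_monoid_add,topological_space}"
  assumes "(f has_sum s) UNIV"
  shows "(\<lambda>N. \<Sum>k\<in>{- int N..int N}. f k) \<longlonglongrightarrow> s"
  using has_sum_imp_tendsto_shifted[OF assms, of 0] by (simp add: atLeastAtMost_def Int_def)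

section \<open>Existence of the sum of a Fourier series in the mean-square sense\<close>

definition sq_summable :: "(int \<Rightarrow> complex) \<Rightarrow> bool" where
  "sq_summable a \<longleftrightarrow> (\<lambda>k. (norm (a k))\<^sup>2) summable_on UNIV"

text \<open>Since \<open>fourier_series\<close> is a choice, a witness has to be supplied. A
  subsequence with geometrically small increments converges almost everywhere, and Fatou's lemma
  turns the tail bounds between partial sums into mean-square convergence of the whole sequence to
  that limit.\<close>

theorem riesz_fischer:
  assumes "sq_summable a"
  shows "is_fourier_series a (fourier_series a)"
proof -
  let ?J = "\<lambda>N. {- int N..int N}"
  define S where "S N = trig_sum N a" for N
  have S_eq: "S N = trig_poly (?J N) a" for N
    unfolding S_def trig_sum_eq_trig_poly ..
  have [measurable]: "S N \<in> borel_measurable borel" for N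
    unfolding S_eq by simp
  define \<sigma> where "\<sigma> N = (\<Sum>k\<in>?J N. (norm (a k))\<^sup>2)" for N
  define L where "L = (\<Sum>\<^sub>\<infinity>k. (norm (a k))\<^sup>2)"
  have sm: "(\<lambda>k. (norm (a k))\<^sup>2) summable_on UNIV"
    using assms by (simp add: sq_summable_def)
  have "((\<lambda>k. (norm (a k))\<^sup>2) has_sum L) UNIV"
    using sm by (simp add: L_def has_sum_infsum)
  then have \<sigma>_lim: "\<sigma> \<longlonglongrightarrow> L"
    unfolding \<sigma>_def by (rule has_sum_imp_tendsto_symmetric)
  have \<sigma>_le: "\<sigma> N \<le> L" for N
    unfolding \<sigma>_def L_def by (rule finite_sum_le_infsum[OF sm]) auto
  have diff: "S M x - S N x = trig_poly (?J M - ?J N) a x" if "N \<le> M" for M N x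
    unfolding S_eq using that by (intro trig_poly_diff) auto
  have L2: "(LINT x|torus. (norm (S M x - S N x))\<^sup>2) \<le> L - \<sigma> N" if "N \<le> M" for M N
  proof -
    have "(LINT x|torus. (norm (S M x - S N x))\<^sup>2) = (\<Sum>k\<in>?J M - ?J N. (norm (a k))\<^sup>2)"
      unfolding diff[OF that] by (rule integral_norm_trig_poly_sq) auto
    also have "\<dots> = \<sigma> M - \<sigma> N"
      unfolding \<sigma>_def using that by (intro sum_diff) auto
    finally show ?thesis using \<sigma>_le[of M] by simp
  qed
  have int_sq: "integrable torus (\<lambda>x. (norm (S M x - S N x))\<^sup>2)" if "N \<le> M" for M N
    unfolding diff[OF that] by (rule integrable_norm_trig_poly_sq)
  have ex: "\<exists>m. m \<ge> l \<and> L - \<sigma> m \<le> (1/4) ^ k" for k l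
  proof -
    have "\<forall>\<^sub>F m in sequentially. \<sigma> m > L - (1/4)^k"
      using \<sigma>_lim by (rule order_tendstoD) auto
    then have "\<forall>\<^sub>F m in sequentially. m \<ge> l \<and> \<sigma> m > L - (1/4)^k"
      using eventually_ge_at_top by (rule eventually_conj[rotated])
    then show ?thesis by (force dest!: eventually_happens)
  qed
  \<comment> \<open>Along \<open>\<phi>\<close> the increments are summable in \<open>L\<^sup>1\<close>, so the partial sums converge almost everywhere.\<close>
  obtain \<phi> where \<phi>: "\<And>k. L - \<sigma> (\<phi> k) \<le> (1/4)^k" "\<And>k. Suc (\<phi> k) \<le> \<phi> (Suc k)"
  proof -
    have "\<exists>\<phi>. \<forall>k. L - \<sigma> (\<phi> k) \<le> (1/4)^k \<and> Suc (\<phi> k) \<le> \<phi> (Suc k)"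
      by (rule dependent_nat_choice) (use ex in blast)+
    then show ?thesis using that by blast
  qed
  have "strict_mono \<phi>" using \<phi>(2) by (simp add: strict_mono_Suc_iff Suc_le_eq)
  then have \<phi>_at_top: "filterlim \<phi> at_top sequentially"
    by (rule filterlim_subseq)
  define d where "d k x = norm (S (\<phi> (Suc k)) x - S (\<phi> k) x)" for k x
  have [measurable]: "d k \<in> borel_measurable borel" for k
    unfolding d_def by measurable
  have d_nonneg: "0 \<le> d k x" for k x
    by (simp add: d_def)
  have d_int: "(\<integral>\<^sup>+x. ennreal (d k x) \<partial>torus) \<le> ennreal ((1/2)^k)" for k
  proof -
    have le: "\<phi> k \<le> \<phi> (Suc k)" using \<phi>(2)[of k] by simp
    \<comment> \<open>Arithmetic-geometric mean with weight \<open>2^k\<close>: it balances the mean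
      square \<open>(1/4)^k\<close> of the increment against the constant \<open>(1/2)^k\<close>, so
      the mean itself is at most \<open>(1/2)^k\<close>.\<close>
    have ptw: "d k x \<le> (2^k * (d k x)\<^sup>2 + (1/2)^k) / 2" for x
    proof -
      have "0 \<le> (2^k * d k x - 1)\<^sup>2 / 2^k" by simp
      also have "\<dots> = 2^k * (d k x)\<^sup>2 + (1/2)^k - 2 * d k x"
        by (simp add: power2_diff power_mult_distrib field_simps power2_eq_square)
      finally show ?thesis by simp
    qed
    have i1: "integrable torus (d k)"
      unfolding d_def diff[OF le] by (rule integrable_norm_trig_poly)
    have i2: "integrable torus (\<lambda>x. (d k x)\<^sup>2)"
      unfolding d_def by (rule int_sq[OF le])
    have "(LINT x|torus. d k x) \<le> (LINT x|torus. (2^k * (d k x)\<^sup>2 + (1/2)^k) / 2)"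
      by (rule integral_mono[OF i1 _ ptw]) (use i2 in auto)
    also have "\<dots> = (2^k * (LINT x|torus. (d k x)\<^sup>2) + (1/2)^k) / 2"
      using i2 torus.prob_space by simp
    also have "\<dots> \<le> (2^k * (1/4)^k + (1/2)^k) / 2"
      using order_trans[OF L2[OF le] \<phi>(1)[of k]] unfolding d_def by simp
    also have "\<dots> = (1/2)^k"
      by (simp add: power_mult_distrib[symmetric])
    finally show ?thesis
      using i1 d_nonneg by (subst nn_integral_eq_integral) (auto intro: ennreal_leI)
  qed
  have "(\<integral>\<^sup>+x. (\<Sum>k. ennreal (d k x)) \<partial>torus) = (\<Sum>k. \<integral>\<^sup>+x. ennreal (d k x) \<partial>torus)"
    by (rule nn_integral_suminf) measurable
  also have "\<dots> \<le> (\<Sum>k. ennreal ((1/2)^k))"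
    by (intro suminf_le d_int) auto
  also have "\<dots> = ennreal (\<Sum>k. (1/2)^k)"
    by (rule suminf_ennreal2) (auto intro: summable_geometric)
  also have "\<dots> < \<infinity>" by simp
  finally have "AE x in torus. (\<Sum>k. ennreal (d k x)) \<noteq> \<infinity>"
    by (intro nn_integral_PInf_AE) auto
  then have conv: "AE x in torus. convergent (\<lambda>k. S (\<phi> k) x)"
  proof eventually_elim
    case (elim x)
    have "summable (\<lambda>k. d k x)"
      by (rule summable_suminf_not_top) (use elim in \<open>auto simp: d_def\<close>)
    then have "summable (\<lambda>k. S (\<phi> (Suc k)) x - S (\<phi> k) x)"
      unfolding d_def by (rule summable_norm_cancel)
    then have "convergent (\<lambda>n. \<Sum>k<n. S (\<phi> (Suc k)) x - S (\<phi> k) x)"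
      by (simp add: summable_iff_convergent)
    then have "convergent (\<lambda>n. S (\<phi> n) x - S (\<phi> 0) x)"
      by (simp add: sum_lessThan_telescope[of "\<lambda>k. S (\<phi> k) x"])
    then have "convergent (\<lambda>n. (S (\<phi> n) x - S (\<phi> 0) x) + S (\<phi> 0) x)"
      by (intro convergent_add convergent_const)
    then show ?case by simp
  qed
  define f where "f x = lim (\<lambda>k. S (\<phi> k) x)" for x
  have f_meas [measurable]: "f \<in> borel_measurable borel"
    unfolding f_def by (rule borel_measurable_lim_metric) measurable
  have lim: "AE x in torus. (\<lambda>k. S (\<phi> k) x) \<longlonglongrightarrow> f x"
    using conv by eventually_elim (simp add: f_def convergent_LIMSEQ_iff)
  \<comment> \<open>Fatou along the subsequence with \<open>N\<close> held fixed, so the bound holds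
    for every \<open>N\<close> and not only for indices in the subsequence.\<close>
  have nn_bound: "(\<integral>\<^sup>+x. ennreal ((norm (f x - S N x))\<^sup>2) \<partial>torus) \<le> ennreal (L - \<sigma> N)" for N
  proof -
    have "(\<integral>\<^sup>+x. ennreal ((norm (f x - S N x))\<^sup>2) \<partial>torus)
        = (\<integral>\<^sup>+x. liminf (\<lambda>k. ennreal ((norm (S (\<phi> k) x - S N x))\<^sup>2)) \<partial>torus)"
    proof (rule nn_integral_cong_AE)
      show "AE x in torus. ennreal ((norm (f x - S N x))\<^sup>2)
          = liminf (\<lambda>k. ennreal ((norm (S (\<phi> k) x - S N x))\<^sup>2))"
        using lim
      proof eventually_elim
        case (elim x)
        have "(\<lambda>k. ennreal ((norm (S (\<phi> k) x - S N x))\<^sup>2)) \<longlonglongrightarrow> ennreal ((norm (f x - S N x))\<^sup>2)"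
          by (intro tendsto_intros elim)
        from lim_imp_Liminf[OF sequentially_bot this] show ?case by (rule sym)
      qed
    qed
    also have "\<dots> \<le> liminf (\<lambda>k. \<integral>\<^sup>+x. ennreal ((norm (S (\<phi> k) x - S N x))\<^sup>2) \<partial>torus)"
      by (rule nn_integral_liminf) measurable
    also have "\<dots> \<le> ennreal (L - \<sigma> N)"
    proof (rule Liminf_le)
      have "\<forall>\<^sub>F k in sequentially. N \<le> \<phi> k"
        using \<phi>_at_top by (simp add: filterlim_at_top)
      then show "\<forall>\<^sub>F k in sequentially. (\<integral>\<^sup>+x. ennreal ((norm (S (\<phi> k) x - S N x))\<^sup>2) \<partial>torus) \<le> ennreal (L - \<sigma> N)"
        by eventually_elim (subst nn_integral_eq_integral, auto intro: int_sq ennreal_leI L2)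
    qed auto
    finally show ?thesis .
  qed
  have int_diff: "integrable torus (\<lambda>x. (norm (f x - S N x))\<^sup>2)" for N
    by (rule integrableI_bounded) (use order.strict_trans1[OF nn_bound[of N]] in auto)
  have bound: "(LINT x|torus. (norm (f x - S N x))\<^sup>2) \<le> L - \<sigma> N" for N
    using nn_bound[of N] \<sigma>_le[of N]
    by (subst (asm) nn_integral_eq_integral[OF int_diff]) auto
  have "integrable torus (\<lambda>x. (norm (f x))\<^sup>2)"
  proof (rule Bochner_Integration.integrable_bound)
    show "integrable torus (\<lambda>x. 2 * (norm (f x - S 0 x))\<^sup>2 + 2 * (norm (S 0 x))\<^sup>2)"
      unfolding S_eq using int_diff[of 0, unfolded S_eq] integrable_norm_trig_poly_sq
      by (intro Bochner_Integration.integrable_add integrable_mult_right) auto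
    show "AE x in torus. norm ((norm (f x))\<^sup>2) \<le> norm (2 * (norm (f x - S 0 x))\<^sup>2 + 2 * (norm (S 0 x))\<^sup>2)"
    proof (rule AE_I2)
      fix x
      have "norm (f x) \<le> norm (f x - S 0 x) + norm (S 0 x)"
        by (metis diff_add_cancel norm_triangle_ineq)
      then have "(norm (f x))\<^sup>2 \<le> (norm (f x - S 0 x) + norm (S 0 x))\<^sup>2"
        by (intro power_mono) auto
      also have "\<dots> \<le> 2 * (norm (f x - S 0 x))\<^sup>2 + 2 * (norm (S 0 x))\<^sup>2"
        using sum_squares_bound[of "norm (f x - S 0 x)" "norm (S 0 x)"] by (simp add: power2_sum)
      finally show "norm ((norm (f x))\<^sup>2) \<le> norm (2 * (norm (f x - S 0 x))\<^sup>2 + 2 * (norm (S 0 x))\<^sup>2)"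
        by simp
    qed
  qed measurable
  moreover have "(\<lambda>N. LINT x|torus. (norm (f x - S N x))\<^sup>2) \<longlonglongrightarrow> 0"
  proof (rule Lim_null_comparison[OF always_eventually])
    show "(\<lambda>N. L - \<sigma> N) \<longlonglongrightarrow> 0"
      using tendsto_diff[OF tendsto_const \<sigma>_lim, of L] by simp
  qed (use bound in auto)
  ultimately have "is_fourier_series a f"
    using f_meas unfolding is_fourier_series_def S_def measurable_cong_sets[OF sets_torus refl]
    by blast
  then show ?thesis
    unfolding fourier_series_def by (rule someI[of "is_fourier_series a"])
qed

section \<open>Fourier coefficients of the squared modulus\<close>

definition acorr :: "(int \<Rightarrow> complex) \<Rightarrow> int \<Rightarrow> complex" where
  "acorr a n = (\<Sum>\<^sub>\<infinity>k. a (k + n) * cnj (a k))"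

text \<open>Obtained from the square \<open>(l * x - y)^2 / l\<close>. The weight \<open>l\<close>
  stays free and is chosen per use: small, tuned to an error, or equal to a ratio of sizes.\<close>

lemma young_weighted:
  fixes x y :: real
  assumes "l > 0"
  shows "x * y \<le> (l * x\<^sup>2 + y\<^sup>2 / l) / 2"
proof -
  have "0 \<le> (l * x - y)\<^sup>2 / l" using assms by simp
  also have "\<dots> = l * x\<^sup>2 + y\<^sup>2 / l - 2 * (x * y)"
    using assms by (simp add: power2_diff power_mult_distrib field_simps power2_eq_square)
  finally show ?thesis by simp
qed

lemma sq_summable_shift:
  assumes "sq_summable a"
  shows "(\<lambda>k. (norm (a (k + n)))\<^sup>2) summable_on UNIV"
    and "(\<Sum>\<^sub>\<infinity>k. (norm (a (k + n)))\<^sup>2) = (\<Sum>\<^sub>\<infinity>k. (norm (a k))\<^sup>2)"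
proof -
  have "bij (\<lambda>k::int. k + n)"
    by (rule o_bij[of "\<lambda>k. k - n"]) auto
  then show "(\<lambda>k. (norm (a (k + n)))\<^sup>2) summable_on UNIV"
    and "(\<Sum>\<^sub>\<infinity>k. (norm (a (k + n)))\<^sup>2) = (\<Sum>\<^sub>\<infinity>k. (norm (a k))\<^sup>2)"
    using assms summable_on_reindex_bij_betw[of "\<lambda>k. k + n" UNIV UNIV "\<lambda>k. (norm (a k))\<^sup>2"]
      infsum_reindex_bij_betw[of "\<lambda>k. k + n" UNIV UNIV "\<lambda>k. (norm (a k))\<^sup>2"]
    by (simp_all add: sq_summable_def)
qed

lemma acorr_abs_summable:
  assumes "sq_summable a"
  shows "(\<lambda>k. norm (a (k + n) * cnj (a k))) summable_on UNIV"
proof (rule summable_on_comparison_test)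
  show "(\<lambda>k. (norm (a (k + n)))\<^sup>2 + (norm (a k))\<^sup>2) summable_on UNIV"
    using sq_summable_shift[OF assms, of n] assms
    by (intro summable_on_add) (simp_all add: sq_summable_def)
  show "norm (a (k + n) * cnj (a k)) \<le> (norm (a (k + n)))\<^sup>2 + (norm (a k))\<^sup>2" for k
    using young_weighted[of 1 "norm (a (k + n))" "norm (a k)"]
    by (simp add: norm_mult)
       (smt (verit) zero_le_power2)
qed simp

text \<open>Passes from mean-square closeness of functions to closeness in mean of their squared
  moduli. The parameter \<open>t\<close> splits the cross term into a small multiple of the mass of
  \<open>w\<close> and a large multiple of the small difference.\<close>

lemma abs_norm_sq_diff_le:
  fixes w z :: complex
  assumes "t > 0"
  shows "\<bar>(norm w)\<^sup>2 - (norm z)\<^sup>2\<bar> \<le> (1 + 1 / t) * (norm (w - z))\<^sup>2 + t * (norm w)\<^sup>2"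
proof -
  define p q where "p = norm w" and "q = norm (w - z)"
  have z: "\<bar>p - norm z\<bar> \<le> q"
    unfolding p_def q_def by (rule norm_triangle_ineq3)
  have nn: "p \<ge> 0" "q \<ge> 0" by (auto simp: p_def q_def)
  have "\<bar>p\<^sup>2 - (norm z)\<^sup>2\<bar> = \<bar>p - norm z\<bar> * (p + norm z)"
    using nn by (simp add: power2_eq_square square_diff_square_factored abs_mult mult.commute)
  also have "\<dots> \<le> q * (2 * p + q)"
    using z nn by (intro mult_mono) auto
  also have "\<dots> = 2 * (p * q) + q\<^sup>2" by (simp add: power2_eq_square algebra_simps)
  also have "\<dots> \<le> (t * p\<^sup>2 + q\<^sup>2 / t) + q\<^sup>2"
    using young_weighted[OF assms, of p q] by simp
  finally show ?thesis by (simp add: p_def q_def algebra_simps)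
qed

text \<open>The argument rests on \<open>is_fourier_series\<close> and so applies to any
  representative: the squared moduli of the partial sums converge in mean, hence so do their Fourier
  coefficients, and these are truncated autocorrelation sums with limit
  \<open>acorr a n\<close>.\<close>

lemma fourier_coeff_norm_fourier_series:
  assumes "sq_summable a"
  shows "fourier_coeff (\<lambda>x. complex_of_real ((norm (fourier_series a x))\<^sup>2)) n = acorr a n"
proof -
  define f where "f = fourier_series a"
  have fs: "is_fourier_series a f"
    unfolding f_def by (rule riesz_fischer[OF assms])
  have [measurable]: "f \<in> borel_measurable borel"
    using fs by (simp add: is_fourier_series_def measurable_cong_sets[OF sets_torus refl])
  have int_f: "integrable torus (\<lambda>x. (norm (f x))\<^sup>2)"
    using fs by (simp add: is_fourier_series_def)
  define S where "S N = trig_poly {- int N..int N} a" for N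
  have [measurable]: "S N \<in> borel_measurable borel" for N
    unfolding S_def by simp
  have int_S: "integrable torus (\<lambda>x. (norm (S N x))\<^sup>2)" for N
    unfolding S_def by (rule integrable_norm_trig_poly_sq)
  have int_d: "integrable torus (\<lambda>x. (norm (f x - S N x))\<^sup>2)" for N
  proof (rule Bochner_Integration.integrable_bound)
    show "integrable torus (\<lambda>x. 2 * (norm (f x))\<^sup>2 + 2 * (norm (S N x))\<^sup>2)"
      using int_f int_S by auto
    show "AE x in torus. norm ((norm (f x - S N x))\<^sup>2) \<le> norm (2 * (norm (f x))\<^sup>2 + 2 * (norm (S N x))\<^sup>2)"
    proof (rule AE_I2)
      fix x
      have "(norm (f x - S N x))\<^sup>2 \<le> (norm (f x) + norm (S N x))\<^sup>2"
        by (intro power_mono norm_triangle_ineq4) auto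
      also have "\<dots> \<le> 2 * (norm (f x))\<^sup>2 + 2 * (norm (S N x))\<^sup>2"
        using sum_squares_bound[of "norm (f x)" "norm (S N x)"] by (simp add: power2_sum)
      finally show "norm ((norm (f x - S N x))\<^sup>2) \<le> norm (2 * (norm (f x))\<^sup>2 + 2 * (norm (S N x))\<^sup>2)"
        by simp
    qed
  qed measurable
  define \<delta> where "\<delta> N = (LINT x|torus. (norm (f x - S N x))\<^sup>2)" for N
  have \<delta>_lim: "\<delta> \<longlonglongrightarrow> 0"
    using fs unfolding is_fourier_series_def \<delta>_def S_def trig_sum_eq_trig_poly by simp
  have \<delta>_nn: "\<delta> N \<ge> 0" for N
    unfolding \<delta>_def by (intro integral_nonneg_AE) auto
  \<comment> \<open>Taking \<open>t\<close> near \<open>sqrt (\<delta> N)\<close> gives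
    \<open>\<delta> N / t N <= t N\<close> while \<open>t\<close> still tends to 0. The term
    \<open>1 / real (Suc N)\<close> keeps the divisor positive when
    \<open>\<delta> N = 0\<close>.\<close>
  define t where "t N = sqrt (\<delta> N + 1 / real (Suc N))" for N
  have t_pos: "t N > 0" for N
    unfolding t_def using \<delta>_nn[of N] by (simp add: add_nonneg_pos)
  have t_lim: "t \<longlonglongrightarrow> 0"
  proof -
    have "(\<lambda>N. sqrt (\<delta> N + 1 / real (Suc N))) \<longlonglongrightarrow> sqrt (0 + 0)"
      by (intro tendsto_intros \<delta>_lim lim_1_over_n[THEN LIMSEQ_Suc])
    then show ?thesis by (simp add: t_def[abs_def])
  qed
  define F where "F = (LINT x|torus. (norm (f x))\<^sup>2)"
  let ?c = "\<lambda>g. fourier_coeff (\<lambda>x. complex_of_real ((norm (g x))\<^sup>2)) n"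
  have close: "norm (?c f - ?c (S N)) \<le> \<delta> N + t N + t N * F" for N
  proof -
    have i: "integrable torus (\<lambda>x. complex_of_real ((norm (g x))\<^sup>2) * cis (- (of_int n * x)))"
      if "integrable torus (\<lambda>x. (norm (g x))\<^sup>2)" "g \<in> borel_measurable borel" for g :: "real \<Rightarrow> complex"
      by (rule Bochner_Integration.integrable_bound[OF that(1)])
         (use that(2) in \<open>auto simp: norm_mult norm_power\<close>)
    have "?c f - ?c (S N) = (LINT x|torus. complex_of_real ((norm (f x))\<^sup>2 - (norm (S N x))\<^sup>2) * cis (- (of_int n * x)))"
      unfolding fourier_coeff_def
      by (subst Bochner_Integration.integral_diff[symmetric]) (auto intro!: i int_f int_S simp del: of_real_power simp: left_diff_distrib)
    also have "norm \<dots> \<le> (LINT x|torus. \<bar>(norm (f x))\<^sup>2 - (norm (S N x))\<^sup>2\<bar>)"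
      by (rule order_trans[OF integral_norm_bound]) (simp add: norm_mult del: of_real_diff of_real_power)
    also have "\<dots> \<le> (LINT x|torus. (1 + 1 / t N) * (norm (f x - S N x))\<^sup>2 + t N * (norm (f x))\<^sup>2)"
      by (intro integral_mono abs_norm_sq_diff_le t_pos integrable_abs
          Bochner_Integration.integrable_diff Bochner_Integration.integrable_add
          integrable_mult_right int_f int_S int_d)
    also have "\<dots> = (1 + 1 / t N) * \<delta> N + t N * F"
      using int_d int_f by (simp add: \<delta>_def F_def)
    also have "\<delta> N / t N \<le> t N"
      using t_pos[of N] \<delta>_nn[of N] by (simp add: field_simps t_def)
    then have "(1 + 1 / t N) * \<delta> N + t N * F \<le> \<delta> N + t N + t N * F"
      by (simp add: algebra_simps)
    finally show ?thesis .
  qed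
  have "(\<lambda>N. \<delta> N + t N + t N * F) \<longlonglongrightarrow> 0 + 0 + 0 * F"
    by (intro tendsto_intros \<delta>_lim t_lim)
  then have "(\<lambda>N. \<delta> N + t N + t N * F) \<longlonglongrightarrow> 0" by simp
  then have "(\<lambda>N. ?c f - ?c (S N)) \<longlonglongrightarrow> 0"
    by (rule Lim_null_comparison[OF always_eventually, rotated]) (intro allI close)
  from tendsto_diff[OF tendsto_const[of "?c f"] this]
  have lim1: "(\<lambda>N. ?c (S N)) \<longlonglongrightarrow> ?c f"
    by (simp only: diff_diff_eq2 diff_zero add_diff_cancel_left')
  have "((\<lambda>k. a (k + n) * cnj (a k)) has_sum acorr a n) UNIV"
    unfolding acorr_def
    by (rule has_sum_infsum[OF Infinite_Sum.abs_summable_summable[OF acorr_abs_summable[OF assms]]])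
  from has_sum_imp_tendsto_shifted[OF this, of n]
  have lim2: "(\<lambda>N. ?c (S N)) \<longlonglongrightarrow> acorr a n"
    unfolding S_def fourier_coeff_norm_trig_poly[OF finite_atLeastAtMost_int] .
  show ?thesis
    using LIMSEQ_unique[OF lim1 lim2] by (simp add: f_def)
qed

lemma pairing_term_eq:
  "sq_summable a \<Longrightarrow> pairing_term b a n = b (- n) * acorr a n"
  unfolding pairing_term_def by (simp only: fourier_coeff_norm_fourier_series)

section \<open>Autocorrelation bounds\<close>

text \<open>As integrals over counting measure, unconditional sums become accessible to Tonelli's
  theorem and to measurability of parameter integrals.\<close>

lemma nn_integral_count_space_eq_infsum:
  fixes f :: "'a \<Rightarrow> real"
  assumes "\<And>k. f k \<ge> 0"
  shows "f summable_on UNIV \<Longrightarrow> (\<integral>\<^sup>+k. ennreal (f k) \<partial>count_space UNIV) = ennreal (\<Sum>\<^sub>\<infinity>k. f k)"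
    and "(\<integral>\<^sup>+k. ennreal (f k) \<partial>count_space UNIV) < \<infinity> \<Longrightarrow> f summable_on UNIV"
proof -
  have eq: "f summable_on UNIV \<longleftrightarrow> integrable (count_space UNIV) f"
  proof -
    have "f summable_on UNIV \<longleftrightarrow> Infinite_Sum.abs_summable_on f UNIV"
      using assms by simp
    then show ?thesis
      by (simp only: abs_summable_equivalent abs_summable_on_def)
  qed
  show "(\<integral>\<^sup>+k. ennreal (f k) \<partial>count_space UNIV) = ennreal (\<Sum>\<^sub>\<infinity>k. f k)" if "f summable_on UNIV"
  proof -
    have "Infinite_Set_Sum.abs_summable_on f UNIV"
      using that eq by (simp add: abs_summable_on_def)
    then show ?thesis
      using assms that eq by (simp add: infsetsum_infsum[symmetric] infsetsum_def nn_integral_eq_integral)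
  qed
  show "f summable_on UNIV" if "(\<integral>\<^sup>+k. ennreal (f k) \<partial>count_space UNIV) < \<infinity>"
    unfolding eq by (rule integrableI_bounded) (use that assms in auto)
qed

text \<open>The identity survives divergence: \<open>infsum\<close> is then \<open>0\<close>, and
  \<open>enn2real\<close> sends infinity to \<open>0\<close>.\<close>

lemma infsum_eq_enn2real_nn_integral:
  fixes f :: "'a \<Rightarrow> real"
  assumes "\<And>k. f k \<ge> 0"
  shows "(\<Sum>\<^sub>\<infinity>k. f k) = enn2real (\<integral>\<^sup>+k. ennreal (f k) \<partial>count_space UNIV)"
proof (cases "f summable_on UNIV")
  case True
  then show ?thesis
    using nn_integral_count_space_eq_infsum(1)[OF assms True] assms by (simp add: infsum_nonneg)
next
  case False
  then have "(\<integral>\<^sup>+k. ennreal (f k) \<partial>count_space UNIV) = \<infinity>"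
    using nn_integral_count_space_eq_infsum(2)[of f] assms by (metis infinity_ennreal_def less_top)
  then show ?thesis using False by (simp add: infsum_not_exists)
qed

text \<open>Summable complex families are absolutely summable, and otherwise both sides default to
  \<open>0\<close>. Hence an \<open>infsum\<close> is measurable in a parameter without any case
  distinction on convergence.\<close>

lemma infsum_eq_integral_count_space:
  fixes f :: "'a \<Rightarrow> complex"
  shows "(\<Sum>\<^sub>\<infinity>k. f k) = (LINT k|count_space UNIV. f k)"
proof (cases "f summable_on UNIV")
  case True
  then have "Infinite_Set_Sum.abs_summable_on f UNIV"
    by (simp only: summable_on_iff_abs_summable_on_complex abs_summable_equivalent)
  then show ?thesis
    by (simp add: infsetsum_infsum[symmetric] infsetsum_def)
next
  case False
  then have "\<not> integrable (count_space UNIV) f"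
    by (simp only: summable_on_iff_abs_summable_on_complex abs_summable_equivalent abs_summable_on_def not_False_eq_True)
  then show ?thesis
    using False by (simp add: infsum_not_exists not_integrable_integral_eq)
qed

lemma borel_measurable_infsum:
  fixes f :: "'a \<Rightarrow> 'b::countable \<Rightarrow> complex"
  assumes [measurable]: "\<And>k. (\<lambda>x. f x k) \<in> borel_measurable M"
  shows "(\<lambda>x. \<Sum>\<^sub>\<infinity>k. f x k) \<in> borel_measurable M"
proof -
  interpret C: sigma_finite_measure "count_space (UNIV :: 'b set)"
    by (rule sigma_finite_measure_count_space)
  show ?thesis
    unfolding infsum_eq_integral_count_space
    by (rule C.borel_measurable_lebesgue_integral)
       (rule measurable_compose_countable'[where I = UNIV and g = snd], auto)
qed

lemma borel_measurable_nn_integral_count_space: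
  fixes f :: "'a \<Rightarrow> 'b::countable \<Rightarrow> ennreal"
  assumes [measurable]: "\<And>k. (\<lambda>x. f x k) \<in> borel_measurable M"
  shows "(\<lambda>x. \<integral>\<^sup>+k. f x k \<partial>count_space UNIV) \<in> borel_measurable M"
proof -
  interpret C: sigma_finite_measure "count_space (UNIV :: 'b set)"
    by (rule sigma_finite_measure_count_space)
  show ?thesis
    by (rule C.borel_measurable_nn_integral)
       (rule measurable_compose_countable'[where I = UNIV and g = snd], auto)
qed

lemma borel_measurable_cnj [measurable (raw)]:
  "f \<in> borel_measurable M \<Longrightarrow> (\<lambda>x. cnj (f x)) \<in> borel_measurable M"
  by (rule measurable_compose) (auto intro!: borel_measurable_continuous_onI continuous_intros)

lemma borel_measurable_acorr:
  assumes [measurable]: "\<And>k. (\<lambda>x. a x k) \<in> borel_measurable M"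
  shows "(\<lambda>x. acorr (a x) n) \<in> borel_measurable M"
  unfolding acorr_def by (rule borel_measurable_infsum) measurable

lemma sq_summable_iff_nn_integral:
  "sq_summable a \<longleftrightarrow> (\<integral>\<^sup>+k. ennreal ((norm (a k))\<^sup>2) \<partial>count_space UNIV) < \<infinity>"
  unfolding sq_summable_def
  using nn_integral_count_space_eq_infsum[of "\<lambda>k. (norm (a k))\<^sup>2"] by auto

text \<open>A shifted absolute value that never vanishes, so decay weights cover the zero mode
  without a case split.\<close>

definition bracket :: "int \<Rightarrow> real" where
  "bracket k = 1 + \<bar>of_int k\<bar>"

lemma bracket_ge_1: "bracket k \<ge> 1"
  by (simp add: bracket_def)

lemma bracket_pos [simp]: "bracket k > 0"
  using bracket_ge_1[of k] by linarith

lemma bracket_neq_0 [simp]: "bracket k \<noteq> 0"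
  using bracket_pos[of k] by linarith

lemma summable_bracket_powr:
  assumes "p > 1"
  shows "(\<lambda>k. bracket k powr - p) summable_on UNIV"
proof -
  have "summable (\<lambda>n. real (Suc n) powr - p)"
    by (subst summable_Suc_iff) (use assms in \<open>simp add: summable_real_powr_iff\<close>)
  then have nat: "(\<lambda>n::nat. real (Suc n) powr - p) summable_on UNIV"
    by (subst summable_on_UNIV_nonneg_real_iff) auto
  \<comment> \<open>The two half-lines overlap at 0, which is harmless for summability.\<close>
  have UN: "(UNIV :: int set) = range int \<union> range (\<lambda>n. - int n)"
    by (auto intro: int_cases2)
  have "(\<lambda>k. bracket k powr - p) summable_on range int"
    by (subst summable_on_reindex) (use nat in \<open>auto simp: inj_on_def o_def bracket_def add.commute\<close>)
  moreover have "(\<lambda>k. bracket k powr - p) summable_on range (\<lambda>n. - int n)"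
    by (subst summable_on_reindex) (use nat in \<open>auto simp: inj_on_def o_def bracket_def add.commute\<close>)
  ultimately show ?thesis
    unfolding UN by (rule summable_on_union)
qed

text \<open>Partial fractions: \<open>1 / (x * y) = 1 / (x * (x + y)) + 1 / (y * (x + y))\<close>.
  The factor \<open>x + y\<close> is split into powers \<open>3/4\<close> and \<open>1/4\<close>,
  bounded below through \<open>z <= x + y\<close> and \<open>x <= x + y\<close>. The exponents are
  chosen so that \<open>5/4 > 1\<close> remains in the summed variable and, together with a further
  \<open>1 / sqrt (bracket n)\<close>, also in \<open>n = k - m\<close>.\<close>

lemma bracket_kernel_le:
  "1 / (bracket k * bracket m) \<le> bracket (k - m) powr - (3 / 4) * (bracket k powr - (5 / 4) + bracket m powr - (5 / 4))"
proof -
  have main: "1 / (x * (x + y)) \<le> z powr - (3 / 4) * x powr - (5 / 4)"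
    if "x > 0" "y > 0" "z > 0" "z \<le> x + y" for x y z :: real
  proof -
    have "z powr (3 / 4) * x powr (5 / 4) = z powr (3 / 4) * x powr (1 / 4) * x"
      using that by (simp add: powr_add[of x "1/4" 1, simplified] mult.assoc)
    also have "\<dots> \<le> (x + y) powr (3 / 4) * (x + y) powr (1 / 4) * x"
      using that by (intro mult_mono powr_mono2 mult_nonneg_nonneg) auto
    also have "\<dots> = x * (x + y)"
      using that by (simp add: powr_add[symmetric])
    finally show ?thesis
      using that by (simp add: powr_minus divide_simps)
  qed
  have z: "bracket (k - m) \<le> bracket k + bracket m"
    by (simp add: bracket_def)
  have "1 / (bracket k * bracket m)
      = 1 / (bracket k * (bracket k + bracket m)) + 1 / (bracket m * (bracket m + bracket k))"
  proof -
    have "bracket k \<noteq> 0" "bracket m \<noteq> 0" "bracket k + bracket m \<noteq> 0" "bracket m + bracket k \<noteq> 0"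
      using bracket_pos[of k] bracket_pos[of m] by linarith+
    then have "1 / bracket k + 1 / bracket m = (bracket k + bracket m) / (bracket k * bracket m)"
      by (simp add: add_frac_eq add.commute)
    then have "1 / (bracket k * bracket m) = (1 / bracket k + 1 / bracket m) / (bracket k + bracket m)"
      using \<open>bracket k + bracket m \<noteq> 0\<close> by simp
    then show ?thesis by (simp add: add_divide_distrib add.commute[of "bracket m"])
  qed
  also have "\<dots> \<le> bracket (k - m) powr - (3 / 4) * bracket k powr - (5 / 4)
      + bracket (k - m) powr - (3 / 4) * bracket m powr - (5 / 4)"
    using z by (intro add_mono main) (auto simp: add.commute)
  finally show ?thesis by (simp add: distrib_left)
qed

text \<open>The kernel has the size of the expectation of \<open>|b_n| |a_(k+n)| |a_k|\<close>; its
  finite double sum is what makes the pairing converge absolutely. The preceding bound dominates it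
  by \<open>q n * (q (k + n) + q k)\<close>, and every shift of \<open>q\<close> has the same total
  \<open>s\<close>.\<close>

lemma nn_integral_bracket_kernel_finite:
  "(\<integral>\<^sup>+n. \<integral>\<^sup>+k. ennreal (1 / (sqrt (bracket n) * bracket (k + n) * bracket k))
      \<partial>count_space UNIV \<partial>count_space UNIV) < \<infinity>"
proof -
  let ?C = "count_space (UNIV :: int set)"
  define q where "q k = bracket k powr - (5 / 4)" for k
  define s where "s = (\<integral>\<^sup>+k. ennreal (q k) \<partial>?C)"
  have s_fin: "s < \<infinity>"
    unfolding s_def q_def
    by (subst nn_integral_count_space_eq_infsum(1)) (auto intro: summable_bracket_powr)
  have shift: "(\<integral>\<^sup>+k. ennreal (q (k + n)) \<partial>?C) = s" for n
    unfolding s_def by (rule nn_integral_bij_count_space) (rule o_bij[of "\<lambda>k. k - n"], auto)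
  have le: "ennreal (1 / (sqrt (bracket n) * bracket (k + n) * bracket k)) \<le> ennreal (q n) * (ennreal (q (k + n)) + ennreal (q k))"
    for n k
  proof -
    have "1 / (sqrt (bracket n) * bracket (k + n) * bracket k)
        = bracket n powr - (1 / 2) * (1 / (bracket (k + n) * bracket k))"
      using bracket_pos[of n] by (simp add: powr_minus powr_half_sqrt[OF less_imp_le] divide_simps)
    also have "\<dots> \<le> bracket n powr - (1 / 2) * (bracket n powr - (3 / 4) * (q (k + n) + q k))"
      using bracket_kernel_le[of "k + n" k] by (intro mult_left_mono) (auto simp: q_def)
    also have "\<dots> = q n * (q (k + n) + q k)"
      by (simp add: q_def mult.assoc[symmetric] powr_add[symmetric])
    finally have "ennreal (1 / (sqrt (bracket n) * bracket (k + n) * bracket k)) \<le> ennreal (q n * (q (k + n) + q k))"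
      by (rule ennreal_leI)
    also have "\<dots> = ennreal (q n) * (ennreal (q (k + n)) + ennreal (q k))"
      by (simp add: q_def ennreal_mult)
    finally show ?thesis .
  qed
  have "(\<integral>\<^sup>+n. \<integral>\<^sup>+k. ennreal (1 / (sqrt (bracket n) * bracket (k + n) * bracket k)) \<partial>?C \<partial>?C)
      \<le> (\<integral>\<^sup>+n. \<integral>\<^sup>+k. ennreal (q n) * (ennreal (q (k + n)) + ennreal (q k)) \<partial>?C \<partial>?C)"
    by (intro nn_integral_mono le)
  also have "\<dots> = s * (s + s)"
  proof -
    have "(\<integral>\<^sup>+k. ennreal (q n) * (ennreal (q (k + n)) + ennreal (q k)) \<partial>?C) = ennreal (q n) * (s + s)" for n
      by (simp add: nn_integral_cmult nn_integral_add shift flip: s_def)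
    then show ?thesis by (simp add: nn_integral_multc flip: s_def)
  qed
  also have "\<dots> < \<infinity>"
    using s_fin by (simp add: ennreal_mult_less_top)
  finally show ?thesis .
qed

section \<open>Symmetry, size and decay of the autocorrelation\<close>

lemma norm_acorr_le_infsum:
  assumes "sq_summable a"
  shows "norm (acorr a n) \<le> (\<Sum>\<^sub>\<infinity>k. norm (a (k + n)) * norm (a k))"
  unfolding acorr_def
  using norm_infsum_bound[OF acorr_abs_summable[OF assms, of n]] by (simp add: norm_mult)

lemma acorr_minus:
  "acorr a (- n) = cnj (acorr a n)"
proof -
  have "acorr a (- n) = (\<Sum>\<^sub>\<infinity>k. a k * cnj (a (k + n)))"
    unfolding acorr_def
    by (rule infsum_reindex_bij_witness[of _ "\<lambda>k. k + n" "\<lambda>k. k - n"]) auto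
  also have "\<dots> = cnj (acorr a n)"
    unfolding acorr_def infsum_cnj[symmetric] by (simp add: mult.commute)
  finally show ?thesis .
qed

lemma has_sum_divide:
  fixes f :: "'a \<Rightarrow> real"
  shows "(f has_sum s) A \<Longrightarrow> ((\<lambda>x. f x / c) has_sum s / c) A"
  unfolding divide_inverse by (rule has_sum_cmult_left)

lemma summable_on_divide:
  fixes f :: "'a \<Rightarrow> real"
  shows "f summable_on A \<Longrightarrow> (\<lambda>x. f x / c) summable_on A"
  unfolding divide_inverse by (rule summable_on_cmult_left)

text \<open>Arithmetic-geometric mean on each term; the shifted and unshifted halves have equal
  sums.\<close>

lemma norm_acorr_le:
  assumes "sq_summable a"
  shows "norm (acorr a n) \<le> (\<Sum>\<^sub>\<infinity>k. (norm (a k))\<^sup>2)"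
proof -
  have s: "(\<lambda>k. (norm (a k))\<^sup>2) summable_on UNIV"
    using assms by (simp add: sq_summable_def)
  have "norm (acorr a n) \<le> (\<Sum>\<^sub>\<infinity>k. norm (a (k + n)) * norm (a k))"
    by (rule norm_acorr_le_infsum[OF assms])
  also have "\<dots> \<le> (\<Sum>\<^sub>\<infinity>k. (norm (a (k + n)))\<^sup>2 / 2 + (norm (a k))\<^sup>2 / 2)"
  proof (rule infsum_mono)
    show "(\<lambda>k. norm (a (k + n)) * norm (a k)) summable_on UNIV"
      using acorr_abs_summable[OF assms, of n] by (simp add: norm_mult)
    show "(\<lambda>k. (norm (a (k + n)))\<^sup>2 / 2 + (norm (a k))\<^sup>2 / 2) summable_on UNIV"
      by (intro summable_on_add summable_on_divide s sq_summable_shift assms)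
    show "norm (a (k + n)) * norm (a k) \<le> (norm (a (k + n)))\<^sup>2 / 2 + (norm (a k))\<^sup>2 / 2" for k
      using young_weighted[of 1 "norm (a (k + n))" "norm (a k)"] by simp
  qed
  also have "\<dots> = (\<Sum>\<^sub>\<infinity>k. (norm (a k))\<^sup>2)"
    using sq_summable_shift[OF assms, of n] s
    by (intro infsumI)
       (use has_sum_add[OF has_sum_divide[OF has_sum_infsum[OF sq_summable_shift(1)[OF assms, of n]], of 2]
          has_sum_divide[OF has_sum_infsum[OF s], of 2]] in simp)
  finally show ?thesis .
qed

text \<open>The weight \<open>\<bar>n\<bar>^(1/4)\<close> is subadditive, so it can be moved from
  the frequency difference \<open>n\<close> onto one of the two factors. Young's inequality then
  trades regularity against mass, with \<open>l\<close> free.\<close>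

lemma norm_acorr_weighted_le:
  assumes a: "sq_summable a" and H: "(\<lambda>k. sqrt \<bar>of_int k\<bar> * (norm (a k))\<^sup>2) summable_on UNIV" and "l > 0"
  shows "sqrt (sqrt \<bar>of_int n\<bar>) * norm (acorr a n)
      \<le> l * (\<Sum>\<^sub>\<infinity>k. sqrt \<bar>of_int k\<bar> * (norm (a k))\<^sup>2) + (\<Sum>\<^sub>\<infinity>k. (norm (a k))\<^sup>2) / l"
proof -
  define w where "w k = sqrt \<bar>of_int k\<bar> * (norm (a k))\<^sup>2" for k :: int
  define u where "u k = (norm (a k))\<^sup>2" for k :: int
  define q where "q k = sqrt (sqrt \<bar>real_of_int k\<bar>)" for k :: int
  have u: "u summable_on UNIV" using a by (simp add: sq_summable_def u_def[abs_def])
  have w: "w summable_on UNIV" using H by (simp add: w_def[abs_def])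
  have bij: "bij (\<lambda>k::int. k + n)"
    by (rule o_bij[of "\<lambda>k. k - n"]) auto
  have sh: "(\<lambda>k. f (k + n)) summable_on UNIV" "(\<Sum>\<^sub>\<infinity>k. f (k + n)) = (\<Sum>\<^sub>\<infinity>k. f k)"
    if "f summable_on UNIV" for f :: "int \<Rightarrow> real"
    using that summable_on_reindex_bij_betw[OF bij, of f] infsum_reindex_bij_betw[OF bij, of f] by auto
  have q_sub: "q n \<le> q k + q (k + n)" for k
  proof -
    have "q n \<le> sqrt (sqrt (\<bar>real_of_int k\<bar> + \<bar>real_of_int (k + n)\<bar>))"
      unfolding q_def by (intro real_sqrt_le_mono) simp
    also have "\<dots> \<le> sqrt (sqrt \<bar>real_of_int k\<bar> + sqrt \<bar>real_of_int (k + n)\<bar>)"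
      by (intro real_sqrt_le_mono sqrt_add_le_add_sqrt) auto
    also have "\<dots> \<le> q k + q (k + n)"
      unfolding q_def by (rule sqrt_add_le_add_sqrt) auto
    finally show ?thesis .
  qed
  have q2: "(q k * norm (a k))\<^sup>2 = w k" for k
    by (simp add: q_def w_def power_mult_distrib)
  have ptw: "q n * (norm (a (k + n)) * norm (a k))
      \<le> (l * w k + u (k + n) / l) / 2 + (l * w (k + n) + u k / l) / 2" for k
  proof -
    have "q n * (norm (a (k + n)) * norm (a k)) \<le> (q k + q (k + n)) * (norm (a (k + n)) * norm (a k))"
      by (intro mult_right_mono q_sub) auto
    also have "\<dots> = (q k * norm (a k)) * norm (a (k + n)) + (q (k + n) * norm (a (k + n))) * norm (a k)"
      by (simp add: algebra_simps)
    also have "\<dots> \<le> (l * w k + u (k + n) / l) / 2 + (l * w (k + n) + u k / l) / 2"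
      unfolding q2[symmetric] u_def using assms(3) by (intro add_mono young_weighted)
    finally show ?thesis .
  qed
  have "q n * norm (acorr a n) \<le> q n * (\<Sum>\<^sub>\<infinity>k. norm (a (k + n)) * norm (a k))"
    by (intro mult_left_mono norm_acorr_le_infsum a) (simp add: q_def)
  also have "\<dots> = (\<Sum>\<^sub>\<infinity>k. q n * (norm (a (k + n)) * norm (a k)))"
    by (rule infsum_cmult_right'[symmetric])
  also have "\<dots> \<le> (\<Sum>\<^sub>\<infinity>k. (l * w k + u (k + n) / l) / 2 + (l * w (k + n) + u k / l) / 2)"
  proof (rule infsum_mono[OF _ _ ptw])
    show "(\<lambda>k. q n * (norm (a (k + n)) * norm (a k))) summable_on UNIV"
      using acorr_abs_summable[OF a, of n] by (intro summable_on_cmult_right) (simp add: norm_mult)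
    show "(\<lambda>k. (l * w k + u (k + n) / l) / 2 + (l * w (k + n) + u k / l) / 2) summable_on UNIV"
      by (intro summable_on_add summable_on_divide summable_on_cmult_right u w sh)
  qed
  also have "\<dots> = l * (\<Sum>\<^sub>\<infinity>k. w k) + (\<Sum>\<^sub>\<infinity>k. u k) / l"
  proof -
    have "((\<lambda>k. (l * w k + u (k + n) / l) / 2 + (l * w (k + n) + u k / l) / 2) has_sum
        (l * (\<Sum>\<^sub>\<infinity>k. w k) + (\<Sum>\<^sub>\<infinity>k. u k) / l) / 2 + (l * (\<Sum>\<^sub>\<infinity>k. w k) + (\<Sum>\<^sub>\<infinity>k. u k) / l) / 2) UNIV"
      using has_sum_infsum[OF u] has_sum_infsum[OF w] has_sum_infsum[OF sh(1)[OF u]] has_sum_infsum[OF sh(1)[OF w]]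
      unfolding sh(2)[OF u] sh(2)[OF w]
      by (intro has_sum_add has_sum_divide has_sum_cmult_right)
    then show ?thesis by (simp add: infsumI)
  qed
  finally show ?thesis unfolding q_def u_def w_def .
qed

section \<open>Complex Gaussian measures\<close>

lemma borel_measurable_Complex [measurable (raw)]:
  assumes [measurable]: "f \<in> borel_measurable M" "g \<in> borel_measurable M"
  shows "(\<lambda>x. Complex (f x) (g x)) \<in> borel_measurable M"
  unfolding Complex_eq by measurable

lemma prob_space_complex_gaussian: "v > 0 \<Longrightarrow> prob_space (complex_gaussian v)"
proof -
  assume v: "v > 0"
  interpret N: prob_space "density lborel (normal_density 0 (sqrt v))"
    by (rule prob_space_normal_density) (use v in simp)
  interpret P: pair_prob_space "density lborel (normal_density 0 (sqrt v))" "density lborel (normal_density 0 (sqrt v))" ..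
  show ?thesis
    unfolding complex_gaussian_def by (rule P.prob_space_distr) measurable
qed

lemma sets_complex_gaussian [simp, measurable_cong]: "sets (complex_gaussian v) = sets borel"
  by (simp add: complex_gaussian_def)

lemma space_complex_gaussian [simp]: "space (complex_gaussian v) = UNIV"
  by (simp add: complex_gaussian_def)

lemma nn_integral_complex_gaussian_mult:
  fixes g h :: "real \<Rightarrow> real"
  assumes [measurable]: "g \<in> borel_measurable borel" "h \<in> borel_measurable borel"
    and nn: "\<And>x. g x \<ge> 0" "\<And>x. h x \<ge> 0" and "v > 0"
  shows "(\<integral>\<^sup>+z. ennreal (g (Re z) * h (Im z)) \<partial>complex_gaussian v)
    = (\<integral>\<^sup>+x. ennreal (g x * normal_density 0 (sqrt v) x) \<partial>lborel)
      * (\<integral>\<^sup>+y. ennreal (h y * normal_density 0 (sqrt v) y) \<partial>lborel)"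
proof -
  let ?N = "density lborel (normal_density 0 (sqrt v))"
  interpret N: prob_space ?N
    by (rule prob_space_normal_density) (use assms in simp)
  interpret P: pair_prob_space ?N ?N ..
  have C: "(\<lambda>(x, y). Complex x y) \<in> borel_measurable (?N \<Otimes>\<^sub>M ?N)"
    by measurable
  have "(\<integral>\<^sup>+z. ennreal (g (Re z) * h (Im z)) \<partial>complex_gaussian v)
      = (\<integral>\<^sup>+p. ennreal (g (fst p)) * ennreal (h (snd p)) \<partial>(?N \<Otimes>\<^sub>M ?N))"
    unfolding complex_gaussian_def
    by (subst nn_integral_distr[OF C]) (auto simp: split_beta ennreal_mult nn)
  also have "\<dots> = (\<integral>\<^sup>+x. \<integral>\<^sup>+y. ennreal (g x) * ennreal (h y) \<partial>?N \<partial>?N)"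
    by (subst N.nn_integral_fst[symmetric]) auto
  also have "\<dots> = (\<integral>\<^sup>+x. ennreal (g x) \<partial>?N) * (\<integral>\<^sup>+y. ennreal (h y) \<partial>?N)"
    by (simp add: nn_integral_cmult nn_integral_multc)
  also have "\<dots> = (\<integral>\<^sup>+x. ennreal (g x * normal_density 0 (sqrt v) x) \<partial>lborel)
      * (\<integral>\<^sup>+y. ennreal (h y * normal_density 0 (sqrt v) y) \<partial>lborel)"
    by (simp add: nn_integral_density ennreal_mult nn mult.commute)
  finally show ?thesis .
qed

lemma nn_integral_normal_density:
  "\<sigma> > 0 \<Longrightarrow> (\<integral>\<^sup>+x. ennreal (normal_density \<mu> \<sigma> x) \<partial>lborel) = 1"
  by (subst nn_integral_eq_integral) auto

text \<open>Completing the square: the exponential factor shifts the mean to \<open>t * v\<close>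
  and leaves a constant.\<close>

lemma nn_integral_normal_exp:
  assumes "v > 0"
  shows "(\<integral>\<^sup>+x. ennreal (exp (t * x) * normal_density 0 (sqrt v) x) \<partial>lborel) = ennreal (exp (t\<^sup>2 * v / 2))"
proof -
  have "exp (t * x) * normal_density 0 (sqrt v) x = exp (t\<^sup>2 * v / 2) * normal_density (t * v) (sqrt v) x" for x
  proof -
    have "t * x + - x\<^sup>2 / (2 * v) = t\<^sup>2 * v / 2 + - (x - t * v)\<^sup>2 / (2 * v)"
      using assms by (simp add: field_simps power2_eq_square)
    then have "exp (t * x) * exp (- x\<^sup>2 / (2 * v)) = exp (t\<^sup>2 * v / 2) * exp (- (x - t * v)\<^sup>2 / (2 * v))"
      by (simp only: exp_add[symmetric])
    then show ?thesis using assms by (simp add: normal_density_def)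
  qed
  then show ?thesis
    using assms by (simp add: ennreal_mult nn_integral_cmult nn_integral_normal_density)
qed

lemma nn_integral_normal_exp_sq:
  assumes "v > 0" "2 * t * v < 1"
  shows "(\<integral>\<^sup>+x. ennreal (exp (t * x\<^sup>2) * normal_density 0 (sqrt v) x) \<partial>lborel) = ennreal (1 / sqrt (1 - 2 * t * v))"
proof -
  \<comment> \<open>The tilted density is again Gaussian, with \<open>1 / w = 1 / v - 2 * t\<close>;
    positivity of \<open>w\<close> is the condition \<open>2 * t * v < 1\<close>.\<close>
  define w where "w = v / (1 - 2 * t * v)"
  have w: "w > 0" using assms by (simp add: w_def)
  have vw: "v = w * (1 - 2 * t * v)" using assms by (simp add: w_def)
  define c where "c = 1 / sqrt (1 - 2 * t * v)"
  have "c \<ge> 0" using assms by (simp add: c_def)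
  moreover have "exp (t * x\<^sup>2) * normal_density 0 (sqrt v) x = c * normal_density 0 (sqrt w) x" for x
  proof -
    have inv: "1 / (2 * w) = 1 / (2 * v) - t"
      using assms by (simp add: w_def field_simps)
    have "- x\<^sup>2 / (2 * w) = - (x\<^sup>2 * (1 / (2 * w)))" by simp
    also have "\<dots> = t * x\<^sup>2 + - x\<^sup>2 / (2 * v)"
      unfolding inv by (simp add: right_diff_distrib)
    finally have "t * x\<^sup>2 + - x\<^sup>2 / (2 * v) = - x\<^sup>2 / (2 * w)" ..
    then have e: "exp (t * x\<^sup>2) * exp (- x\<^sup>2 / (2 * v)) = exp (- x\<^sup>2 / (2 * w))"
      by (simp only: exp_add[symmetric])
    have s: "sqrt (2 * pi * v) = sqrt (2 * pi * w) * sqrt (1 - 2 * t * v)"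
      by (subst vw) (simp add: real_sqrt_mult)
    show ?thesis
      using assms w e by (simp add: c_def normal_density_def s mult.commute[of "sqrt (1 - 2 * t * v)"])
  qed
  ultimately show ?thesis
    using w by (simp add: ennreal_mult nn_integral_cmult nn_integral_normal_density flip: c_def)
qed

lemma nn_integral_complex_gaussian_exp:
  assumes "v > 0"
  shows "(\<integral>\<^sup>+z. ennreal (exp (Re (w * z))) \<partial>complex_gaussian v) = ennreal (exp ((norm w)\<^sup>2 * v / 2))"
proof -
  have "(\<integral>\<^sup>+z. ennreal (exp (Re (w * z))) \<partial>complex_gaussian v)
      = (\<integral>\<^sup>+z. ennreal (exp (Re w * Re z) * exp ((- Im w) * Im z)) \<partial>complex_gaussian v)"
    by (simp add: mult_exp_exp)
  also have "\<dots> = ennreal (exp ((Re w)\<^sup>2 * v / 2)) * ennreal (exp ((- Im w)\<^sup>2 * v / 2))"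
    by (subst nn_integral_complex_gaussian_mult) (use assms in \<open>auto simp only: nn_integral_normal_exp, auto\<close>)
  also have "\<dots> = ennreal (exp ((norm w)\<^sup>2 * v / 2))"
    by (simp add: ennreal_mult[symmetric] mult_exp_exp cmod_power2 field_simps)
  finally show ?thesis .
qed

lemma nn_integral_complex_gaussian_exp_sq:
  assumes "v > 0" "2 * t * v < 1"
  shows "(\<integral>\<^sup>+z. ennreal (exp (t * (norm z)\<^sup>2)) \<partial>complex_gaussian v) = ennreal (1 / (1 - 2 * t * v))"
proof -
  have "(\<integral>\<^sup>+z. ennreal (exp (t * (norm z)\<^sup>2)) \<partial>complex_gaussian v)
      = (\<integral>\<^sup>+z. ennreal (exp (t * (Re z)\<^sup>2) * exp (t * (Im z)\<^sup>2)) \<partial>complex_gaussian v)"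
    by (simp add: mult_exp_exp cmod_power2 distrib_left)
  also have "\<dots> = ennreal (1 / sqrt (1 - 2 * t * v)) * ennreal (1 / sqrt (1 - 2 * t * v))"
    by (subst nn_integral_complex_gaussian_mult) (use assms in \<open>auto simp only: nn_integral_normal_exp_sq, auto\<close>)
  also have "\<dots> = ennreal (1 / (1 - 2 * t * v))"
    using assms by (simp add: ennreal_mult[symmetric])
  finally show ?thesis .
qed

text \<open>For \<open>0 <= y <= 1/2\<close> one has \<open>1 / (1 - y) <= exp (2 * y)\<close>. The
  exponential form is wanted because a product over the modes then stays bounded as soon as the
  exponents are summable.\<close>

lemma nn_integral_complex_gaussian_exp_sq_le:
  assumes "v > 0" "t \<ge> 0" "4 * t * v \<le> 1"
  shows "(\<integral>\<^sup>+z. ennreal (exp (t * (norm z)\<^sup>2)) \<partial>complex_gaussian v) \<le> ennreal (exp (4 * t * v))"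
proof -
  define y where "y = 2 * t * v"
  have y: "0 \<le> y" "y \<le> 1 / 2" using assms by (auto simp: y_def)
  have "1 \<le> (1 - y) * (1 + 2 * y)"
    using y mult_nonneg_nonneg[of y "1 - 2 * y"] by (simp add: algebra_simps)
  also have "\<dots> \<le> (1 - y) * exp (2 * y)"
    using y by (intro mult_left_mono exp_ge_add_one_self) auto
  finally have "1 / (1 - y) \<le> exp (2 * y)"
    using y by (simp add: field_simps)
  then show ?thesis
    using assms y by (subst nn_integral_complex_gaussian_exp_sq) (auto simp: y_def mult.assoc intro!: ennreal_leI)
qed

lemma le_exp_sq_quarter: "x \<le> exp (x\<^sup>2 / 4)" for x :: real
proof -
  have "x \<le> 1 + x\<^sup>2 / 4"
    using zero_le_power2[of "x / 2 - 1"] by (simp add: power2_diff power_divide)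
  also have "\<dots> \<le> exp (x\<^sup>2 / 4)" by (rule exp_ge_add_one_self)
  finally show ?thesis .
qed

text \<open>The choice \<open>t = 1 / (4 * v)\<close> gives \<open>2 * t * v = 1/2\<close>. The
  first and second moments below are read off from this one integral by bounding
  \<open>norm z\<close> and its square by multiples of the integrand; the constants are not
  sharp.\<close>

lemma nn_integral_complex_gaussian_exp_quarter:
  assumes "v > 0"
  shows "(\<integral>\<^sup>+z. ennreal (exp ((norm z)\<^sup>2 / (4 * v))) \<partial>complex_gaussian v) = 2"
  using nn_integral_complex_gaussian_exp_sq[of v "1 / (4 * v)"] assms by simp

lemma nn_integral_complex_gaussian_norm:
  assumes "v > 0"
  shows "(\<integral>\<^sup>+z. ennreal (norm z) \<partial>complex_gaussian v) \<le> ennreal (2 * sqrt v)"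
proof -
  have le: "norm z \<le> sqrt v * exp ((norm z)\<^sup>2 / (4 * v))" for z :: complex
    using le_exp_sq_quarter[of "norm z / sqrt v"] assms by (simp add: field_simps power_divide)
  have "(\<integral>\<^sup>+z. ennreal (norm z) \<partial>complex_gaussian v)
      \<le> (\<integral>\<^sup>+z. ennreal (sqrt v) * ennreal (exp ((norm z)\<^sup>2 / (4 * v))) \<partial>complex_gaussian v)"
    by (intro nn_integral_mono) (use le assms in \<open>auto simp: ennreal_mult[symmetric] intro!: ennreal_leI\<close>)
  also have "\<dots> = ennreal (sqrt v) * 2"
    using assms by (subst nn_integral_cmult) (auto simp: nn_integral_complex_gaussian_exp_quarter)
  also have "\<dots> = ennreal (2 * sqrt v)"
    using assms by (simp add: ennreal_mult'' mult.commute)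
  finally show ?thesis .
qed

lemma nn_integral_complex_gaussian_norm_sq:
  assumes "v > 0"
  shows "(\<integral>\<^sup>+z. ennreal ((norm z)\<^sup>2) \<partial>complex_gaussian v) \<le> ennreal (8 * v)"
proof -
  have le: "(norm z)\<^sup>2 \<le> 4 * v * exp ((norm z)\<^sup>2 / (4 * v))" for z :: complex
    using exp_ge_add_one_self[of "(norm z)\<^sup>2 / (4 * v)"] assms by (simp add: field_simps)
  have "(\<integral>\<^sup>+z. ennreal ((norm z)\<^sup>2) \<partial>complex_gaussian v)
      \<le> (\<integral>\<^sup>+z. ennreal (4 * v) * ennreal (exp ((norm z)\<^sup>2 / (4 * v))) \<partial>complex_gaussian v)"
    by (intro nn_integral_mono) (use le assms in \<open>auto simp: ennreal_mult[symmetric] intro!: ennreal_leI\<close>)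
  also have "\<dots> = ennreal (4 * v) * ennreal 2"
    using assms by (subst nn_integral_cmult) (auto simp: nn_integral_complex_gaussian_exp_quarter)
  also have "\<dots> = ennreal (8 * v)"
    using assms by (subst ennreal_mult[symmetric]) auto
  finally show ?thesis .
qed

text \<open>The index set \<open>I\<close> may be infinite: a function of the coordinates in a
  finite \<open>J\<close> sees only the marginal on \<open>J\<close>, where the finite product
  formula applies.\<close>

lemma (in product_prob_space) nn_integral_PiM_prod:
  assumes "finite J" "J \<subseteq> I" and f [measurable]: "\<And>j. j \<in> J \<Longrightarrow> f j \<in> borel_measurable (M j)"
  shows "(\<integral>\<^sup>+x. (\<Prod>j\<in>J. f j (x j)) \<partial>PiM I M) = (\<Prod>j\<in>J. integral\<^sup>N (M j) (f j))"
proof -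
  have m: "(\<lambda>x. \<Prod>j\<in>J. f j (x j)) \<in> borel_measurable (PiM J M)"
  proof (rule borel_measurable_prod_ennreal)
    fix j assume j: "j \<in> J"
    show "(\<lambda>x. f j (x j)) \<in> borel_measurable (PiM J M)"
      using measurable_component_singleton[OF j] f[OF j] by (rule measurable_compose)
  qed
  have "(\<integral>\<^sup>+x. (\<Prod>j\<in>J. f j (x j)) \<partial>PiM I M) = (\<integral>\<^sup>+x. (\<Prod>j\<in>J. f j (restrict x J j)) \<partial>PiM I M)"
    by (intro nn_integral_cong prod.cong) auto
  also have "\<dots> = (\<integral>\<^sup>+x. (\<Prod>j\<in>J. f j (x j)) \<partial>distr (PiM I M) (PiM J M) (\<lambda>x. restrict x J))"
    by (subst nn_integral_distr) (use m measurable_restrict_subset[OF assms(2)] in auto)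
  also have "\<dots> = (\<Prod>j\<in>J. integral\<^sup>N (M j) (f j))"
    unfolding distr_PiM_restrict_finite[OF assms(1,2)]
    by (rule product_nn_integral_prod) (use assms in auto)
  finally show ?thesis .
qed

lemma (in product_prob_space) nn_integral_PiM_component:
  assumes "j \<in> I" and "f \<in> borel_measurable (M j)"
  shows "(\<integral>\<^sup>+x. f (x j) \<partial>PiM I M) = integral\<^sup>N (M j) f"
  using nn_integral_PiM_prod[of "{j}" "\<lambda>_. f"] assms by simp

section \<open>The truncated measure\<close>

lemma (in sigma_finite_measure) nn_integral_pair_mult:
  assumes [measurable]: "f \<in> borel_measurable N" "g \<in> borel_measurable M"
  shows "(\<integral>\<^sup>+z. f (fst z) * g (snd z) \<partial>(N \<Otimes>\<^sub>M M)) = (\<integral>\<^sup>+x. f x \<partial>N) * (\<integral>\<^sup>+y. g y \<partial>M)"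
  by (subst nn_integral_fst[symmetric]) (simp_all add: nn_integral_cmult nn_integral_multc)

lemma nn_integral_gaussian_finite:
  fixes t :: real
  assumes "t > 0"
  shows "(\<integral>\<^sup>+z. ennreal (exp (- t * (norm z)\<^sup>2)) \<partial>(lborel :: 'a::euclidean_space measure)) < \<infinity>"
proof -
  have "(\<integral>\<^sup>+x. ennreal (exp (- t * x\<^sup>2)) \<partial>(lborel :: real measure)) = ennreal (sqrt (pi / t))"
  proof -
    have "exp (- t * x\<^sup>2) = sqrt (pi / t) * normal_density 0 (sqrt (1 / (2 * t))) x" for x
      using assms by (simp add: normal_density_def)
    then show ?thesis
      using assms by (simp add: ennreal_mult nn_integral_cmult nn_integral_normal_density)
  qed
  note one = this
  have "ennreal (exp (- t * (norm z)\<^sup>2)) = (\<Prod>b\<in>Basis. ennreal (exp (- t * (z \<bullet> b)\<^sup>2)))" for z :: 'a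
  proof -
    have "(norm z)\<^sup>2 = (\<Sum>b\<in>Basis. (z \<bullet> b)\<^sup>2)"
      by (subst power2_norm_eq_inner, subst euclidean_inner) (simp add: power2_eq_square)
    then show ?thesis
      by (simp add: prod_ennreal exp_sum sum_distrib_left sum_negf[symmetric])
  qed
  then have "(\<integral>\<^sup>+z. ennreal (exp (- t * (norm z)\<^sup>2)) \<partial>(lborel :: 'a measure))
      = (\<Prod>b\<in>(Basis :: 'a set). \<integral>\<^sup>+x. ennreal (exp (- t * x\<^sup>2)) \<partial>lborel)"
    by (simp only:) (rule nn_integral_lborel_prod, auto)
  also have "\<dots> = ennreal (sqrt (pi / t)) ^ DIM('a)"
    unfolding one by simp
  also have "\<dots> < \<infinity>"
    using assms by (simp add: ennreal_power)
  finally show ?thesis .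
qed

lemma sigma_finite_PiM_lborel:
  "finite I \<Longrightarrow> sigma_finite_measure (\<Pi>\<^sub>M n\<in>I. lborel :: 'a::euclidean_space measure)"
proof -
  interpret product_sigma_finite "\<lambda>_. lborel :: 'a measure"
    by standard
  show "finite I \<Longrightarrow> sigma_finite_measure (\<Pi>\<^sub>M n\<in>I. lborel :: 'a measure)"
    by (rule sigma_finite)
qed

lemma nn_integral_PiM_lborel_prod_finite:
  fixes f :: "'i \<Rightarrow> 'a::euclidean_space \<Rightarrow> ennreal"
  assumes "finite I" "\<And>i. i \<in> I \<Longrightarrow> f i \<in> borel_measurable borel" "\<And>i. i \<in> I \<Longrightarrow> (\<integral>\<^sup>+z. f i z \<partial>lborel) < \<infinity>"
  shows "(\<integral>\<^sup>+x. (\<Prod>i\<in>I. f i (x i)) \<partial>(\<Pi>\<^sub>M n\<in>I. lborel)) < \<infinity>"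
proof -
  interpret product_sigma_finite "\<lambda>_. lborel :: 'a measure"
    by standard
  have "(\<Prod>i\<in>I. g i) < \<infinity>" if "\<And>i. i \<in> I \<Longrightarrow> g i < \<infinity>" for g :: "'i \<Rightarrow> ennreal"
    using assms(1) that by induction (auto simp: ennreal_mult_less_top)
  then show ?thesis
    using assms by (subst product_nn_integral_prod) auto
qed

definition nz_modes :: "nat \<Rightarrow> int set" where
  "nz_modes N = {n. 0 < \<bar>n\<bar> \<and> \<bar>n\<bar> \<le> int N}"

lemma finite_nz_modes [simp]: "finite (nz_modes N)"
  by (rule finite_subset[of _ "{- int N..int N}"]) (auto simp: nz_modes_def)

lemma lebesgue_modes_eq:
  "lebesgue_modes N = (\<Pi>\<^sub>M n\<in>nz_modes N. lborel) \<Otimes>\<^sub>M (\<Pi>\<^sub>M n\<in>{1..int N}. lborel)"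
  by (simp add: lebesgue_modes_def nz_modes_def)

lemma sigma_finite_lebesgue_modes: "sigma_finite_measure (lebesgue_modes N)"
proof -
  interpret A: sigma_finite_measure "\<Pi>\<^sub>M n\<in>nz_modes N. lborel :: complex measure"
    by (rule sigma_finite_PiM_lborel) simp
  interpret B: sigma_finite_measure "\<Pi>\<^sub>M n\<in>{1..int N}. lborel :: complex measure"
    by (rule sigma_finite_PiM_lborel) simp
  interpret pair_sigma_finite "\<Pi>\<^sub>M n\<in>nz_modes N. lborel :: complex measure" "\<Pi>\<^sub>M n\<in>{1..int N}. lborel :: complex measure" ..
  show ?thesis unfolding lebesgue_modes_eq by (rule sigma_finite_measure_axioms)
qed

lemma measurable_lebesgue_modes_fst:
  "n \<in> nz_modes N \<Longrightarrow> (\<lambda>y. fst y n) \<in> borel_measurable (lebesgue_modes N)"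
  unfolding lebesgue_modes_eq by measurable

lemma measurable_lebesgue_modes_snd:
  "n \<in> {1..int N} \<Longrightarrow> (\<lambda>y. snd y n) \<in> borel_measurable (lebesgue_modes N)"
  unfolding lebesgue_modes_eq by measurable

lemma measurable_gibbs_weight [measurable]:
  "gibbs_weight \<kappa> N \<in> borel_measurable (lebesgue_modes N)"
proof -
  have "gibbs_weight \<kappa> N = (\<lambda>y. exp (- (1 / 2) * (\<Sum>n\<in>nz_modes N.
      (of_int n)\<^sup>2 * (cmod (fst y n))\<^sup>2 + \<kappa> * of_int \<bar>n\<bar> * (cmod (if n > 0 then snd y n else cnj (snd y (- n))))\<^sup>2)))"
    by (simp add: gibbs_weight_def nz_modes_def conj_extend_def split_beta fun_eq_iff)
  also have "\<dots> \<in> borel_measurable (lebesgue_modes N)"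
  proof -
    have [measurable]: "(\<lambda>y. if n > 0 then snd y n else cnj (snd y (- n))) \<in> borel_measurable (lebesgue_modes N)"
      if "n \<in> nz_modes N" for n
      using that measurable_lebesgue_modes_snd[of n N] measurable_lebesgue_modes_snd[of "- n" N]
      by (cases "n > 0") (auto simp: nz_modes_def)
    note measurable_lebesgue_modes_fst [measurable]
    show ?thesis by measurable
  qed
  finally show ?thesis .
qed

text \<open>A real-valued density over a sigma-finite measure gives all that Fubini asks for, so the
  normalizing constant need not be computed.\<close>

lemma sigma_finite_rho_trunc: "sigma_finite_measure (rho_trunc \<kappa> N)"
proof -
  interpret sigma_finite_measure "lebesgue_modes N"
    by (rule sigma_finite_lebesgue_modes)
  show ?thesis
    unfolding rho_trunc_def by (subst sigma_finite_iff_density_finite) auto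
qed

lemma sets_rho_trunc [measurable_cong]: "sets (rho_trunc \<kappa> N) = sets (lebesgue_modes N)"
  by (simp add: rho_trunc_def)

text \<open>The factors \<open>n^2\<close> and \<open>\<bar>n\<bar>\<close> are bounded below by 1,
  and of the sum in \<open>b\<close>, which counts every \<open>|b_n|^2\<close> twice, the positive
  half is kept. For fixed \<open>N\<close>, any Gaussian decay in each coordinate suffices.\<close>

lemma gibbs_weight_le:
  assumes "\<kappa> \<ge> 0"
  shows "gibbs_weight \<kappa> N (a, b)
    \<le> (\<Prod>n\<in>nz_modes N. exp (- (1 / 2) * (norm (a n))\<^sup>2)) * (\<Prod>n\<in>{1..int N}. exp (- (\<kappa> / 2) * (norm (b n))\<^sup>2))"
proof -
  have arith: "- (1 / 2) * (s' + t') \<le> - (1 / 2) * s + - (1 / 2) * t"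
    if "s \<le> s'" "t \<le> t'" for s s' t t' :: real
    using mult_left_mono_neg[OF add_mono[OF that], of "- (1 / 2)"] by (simp only: distrib_left)
  have "(\<Sum>n\<in>nz_modes N. (norm (a n))\<^sup>2) \<le> (\<Sum>n\<in>nz_modes N. (of_int n)\<^sup>2 * (norm (a n))\<^sup>2)"
  proof (rule sum_mono)
    fix n assume "n \<in> nz_modes N"
    then have "1 \<le> \<bar>n\<bar>" by (auto simp: nz_modes_def)
    then have "(1::real) \<le> \<bar>of_int n\<bar>" by linarith
    then have "(1::real) \<le> (of_int n)\<^sup>2" by (simp add: abs_le_square_iff[of 1, simplified])
    then show "(norm (a n))\<^sup>2 \<le> (of_int n)\<^sup>2 * (norm (a n))\<^sup>2"
      by (simp add: mult_right_mono[of 1 _ "(norm (a n))\<^sup>2", simplified])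
  qed
  moreover have "(\<Sum>n\<in>{1..int N}. \<kappa> * (norm (b n))\<^sup>2) \<le> (\<Sum>n\<in>nz_modes N. \<kappa> * of_int \<bar>n\<bar> * (norm (conj_extend b n))\<^sup>2)"
  proof -
    have "(\<Sum>n\<in>{1..int N}. \<kappa> * (norm (b n))\<^sup>2) \<le> (\<Sum>n\<in>{1..int N}. \<kappa> * of_int \<bar>n\<bar> * (norm (conj_extend b n))\<^sup>2)"
    proof (rule sum_mono)
      fix n assume "n \<in> {1..int N}"
      then have n: "n > 0" "(1::real) \<le> of_int \<bar>n\<bar>" by auto
      have "\<kappa> * 1 * (norm (b n))\<^sup>2 \<le> \<kappa> * of_int \<bar>n\<bar> * (norm (b n))\<^sup>2"
        using n assms by (intro mult_right_mono mult_left_mono) auto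
      then show "\<kappa> * (norm (b n))\<^sup>2 \<le> \<kappa> * of_int \<bar>n\<bar> * (norm (conj_extend b n))\<^sup>2"
        using n by (simp add: conj_extend_def)
    qed
    also have "\<dots> \<le> (\<Sum>n\<in>nz_modes N. \<kappa> * of_int \<bar>n\<bar> * (norm (conj_extend b n))\<^sup>2)"
      using assms by (intro sum_mono2 finite_nz_modes) (auto simp: nz_modes_def)
    finally show ?thesis .
  qed
  ultimately have "- (1 / 2) * ((\<Sum>n\<in>nz_modes N. (of_int n)\<^sup>2 * (norm (a n))\<^sup>2)
       + (\<Sum>n\<in>nz_modes N. \<kappa> * of_int \<bar>n\<bar> * (norm (conj_extend b n))\<^sup>2))
     \<le> - (1 / 2) * (\<Sum>n\<in>nz_modes N. (norm (a n))\<^sup>2) + - (1 / 2) * (\<Sum>n\<in>{1..int N}. \<kappa> * (norm (b n))\<^sup>2)"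
    by (rule arith)
  moreover have "gibbs_weight \<kappa> N (a, b) = exp (- (1 / 2) * ((\<Sum>n\<in>nz_modes N. (of_int n)\<^sup>2 * (norm (a n))\<^sup>2)
       + (\<Sum>n\<in>nz_modes N. \<kappa> * of_int \<bar>n\<bar> * (norm (conj_extend b n))\<^sup>2)))"
    by (simp only: gibbs_weight_def nz_modes_def prod.case sum.distrib)
  moreover have "(\<Prod>n\<in>nz_modes N. exp (- (1 / 2) * (norm (a n))\<^sup>2)) * (\<Prod>n\<in>{1..int N}. exp (- (\<kappa> / 2) * (norm (b n))\<^sup>2))
      = exp (- (1 / 2) * (\<Sum>n\<in>nz_modes N. (norm (a n))\<^sup>2) + - (1 / 2) * (\<Sum>n\<in>{1..int N}. \<kappa> * (norm (b n))\<^sup>2))"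
    by (simp add: exp_sum[symmetric] mult_exp_exp sum_distrib_left sum_negf)
  ultimately show ?thesis by simp
qed

lemma sq_summable_freq_proj: "sq_summable (freq_proj N a)"
  unfolding sq_summable_def
proof (rule summable_on_cong_neutral[THEN iffD1])
  show "(\<lambda>k. (norm (freq_proj N a k))\<^sup>2) summable_on {- int N..int N}"
    by (rule summable_on_finite) simp
qed (auto simp: freq_proj_def)

section \<open>The truncated pairing and its integrability\<close>

lemma pairing_eq_infsum:
  "sq_summable a \<Longrightarrow> pairing b a = (\<Sum>\<^sub>\<infinity>n. b (- n) * acorr a n)"
  unfolding pairing_def by (intro infsum_cong) (simp add: pairing_term_eq)

lemma measurable_fst_fst:
  "(\<lambda>\<omega>. fst (fst \<omega>)) \<in> borel_measurable ((lborel :: (complex \<times> real) measure) \<Otimes>\<^sub>M M)"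
  by (rule measurable_compose[OF measurable_fst])
     (auto intro!: borel_measurable_continuous_onI continuous_intros)

lemma measurable_snd_fst:
  "(\<lambda>\<omega>. snd (fst \<omega>)) \<in> borel_measurable ((lborel :: (complex \<times> real) measure) \<Otimes>\<^sub>M M)"
  by (rule measurable_compose[OF measurable_fst])
     (auto intro!: borel_measurable_continuous_onI continuous_intros)

lemma measurable_a_coeffs_trunc:
  "(\<lambda>\<omega>. freq_proj N (a_coeffs \<omega>) n) \<in> borel_measurable (lborel \<Otimes>\<^sub>M lebesgue_modes N)"
proof -
  have "(\<lambda>\<omega>. freq_proj N (a_coeffs \<omega>) n)
      = (\<lambda>\<omega>. if n \<in> nz_modes N then fst (snd \<omega>) n else if n = 0 then fst (fst \<omega>) else 0)"
    by (auto simp: fun_eq_iff freq_proj_def a_coeffs_def nz_modes_def split_beta)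
  also have "\<dots> \<in> borel_measurable (lborel \<Otimes>\<^sub>M lebesgue_modes N)"
    using measurable_compose[OF measurable_snd measurable_lebesgue_modes_fst[of n N]] measurable_fst_fst
    by (cases "n \<in> nz_modes N"; cases "n = 0") auto
  finally show ?thesis .
qed

lemma measurable_b_coeffs_trunc:
  "(\<lambda>\<omega>. freq_proj N (b_coeffs \<omega>) n) \<in> borel_measurable (lborel \<Otimes>\<^sub>M lebesgue_modes N)"
proof -
  have "(\<lambda>\<omega>. freq_proj N (b_coeffs \<omega>) n)
      = (\<lambda>\<omega>. if n \<in> {1..int N} then snd (snd \<omega>) n else if - n \<in> {1..int N} then cnj (snd (snd \<omega>) (- n))
          else if n = 0 then complex_of_real (snd (fst \<omega>)) else 0)"
    by (auto simp: fun_eq_iff freq_proj_def b_coeffs_def conj_extend_def split_beta)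
  also have "\<dots> \<in> borel_measurable (lborel \<Otimes>\<^sub>M lebesgue_modes N)"
    using measurable_compose[OF measurable_snd measurable_lebesgue_modes_snd[of n N]]
      borel_measurable_cnj[OF measurable_compose[OF measurable_snd measurable_lebesgue_modes_snd[of "- n" N]]]
      measurable_compose[OF measurable_snd_fst borel_measurable_of_real]
    by (cases "n \<in> {1..int N}"; cases "- n \<in> {1..int N}"; cases "n = 0") auto
  finally show ?thesis .
qed

lemma Omega_trunc_iff:
  assumes "B > 0"
  shows "\<omega> \<in> Omega_trunc N B \<longleftrightarrow>
    (\<Sum>n\<in>{- int N..int N}. (norm (freq_proj N (a_coeffs \<omega>) n))\<^sup>2) \<le> B\<^sup>2 \<and> \<bar>snd (fst \<omega>)\<bar> \<le> B"
proof -
  have "{n. \<bar>n\<bar> \<le> int N} = {- int N..int N}" by auto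
  moreover have "(\<Sum>n\<in>{- int N..int N}. (norm (a_coeffs \<omega> n))\<^sup>2)
      = (\<Sum>n\<in>{- int N..int N}. (norm (freq_proj N (a_coeffs \<omega>) n))\<^sup>2)"
    by (intro sum.cong) (auto simp: freq_proj_def)
  moreover have "norm (b_coeffs \<omega> 0) = \<bar>snd (fst \<omega>)\<bar>"
    by (simp add: b_coeffs_def split_beta)
  moreover have "sqrt s \<le> B \<longleftrightarrow> s \<le> B\<^sup>2" if "s \<ge> 0" for s
    using assms that by (meson abs_of_pos real_sqrt_le_iff real_sqrt_abs real_le_lsqrt real_le_rsqrt less_imp_le not_le real_less_rsqrt sqrt_le_D)
  ultimately show ?thesis
    by (simp add: Omega_trunc_def L2_set_def sum_nonneg)
qed

text \<open>There are \<open>2 * N + 1\<close> terms, each with autocorrelation at most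
  \<open>B^2\<close> and with a coefficient of \<open>b\<close> bounded by the total. What matters
  is linear growth in the norms of \<open>b\<close>; uniformity in \<open>N\<close> is not
  sought.\<close>

lemma norm_pairing_trunc_le:
  assumes "B > 0" "\<omega> \<in> Omega_trunc N B"
  shows "norm (pairing (freq_proj N (b_coeffs \<omega>)) (freq_proj N (a_coeffs \<omega>)))
    \<le> (2 * real N + 1) * B\<^sup>2 * (B + (\<Sum>m\<in>{1..int N}. norm (snd (snd \<omega>) m)))"
proof -
  let ?a = "freq_proj N (a_coeffs \<omega>)" and ?b = "freq_proj N (b_coeffs \<omega>)"
  let ?s = "B + (\<Sum>m\<in>{1..int N}. norm (snd (snd \<omega>) m))"
  have fin: "(\<Sum>\<^sub>\<infinity>n. f n) = (\<Sum>n\<in>{- int N..int N}. f n)"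
    if "\<And>n. n \<notin> {- int N..int N} \<Longrightarrow> f n = 0" for f :: "int \<Rightarrow> 'b::{topological_comm_monoid_add,t2_space}"
    using that by (subst infsum_finite[symmetric], simp) (rule infsum_cong_neutral, auto)
  have a: "(\<Sum>\<^sub>\<infinity>n. (norm (?a n))\<^sup>2) \<le> B\<^sup>2"
    using assms by (subst fin) (auto simp: freq_proj_def Omega_trunc_iff)
  have b: "norm (?b (- n)) \<le> ?s" if "n \<in> {- int N..int N}" for n
  proof -
    have mem: "norm (snd (snd \<omega>) m) \<le> (\<Sum>m\<in>{1..int N}. norm (snd (snd \<omega>) m))" if "m \<in> {1..int N}" for m
      using that by (intro member_le_sum) auto
    have nn: "0 \<le> (\<Sum>m\<in>{1..int N}. norm (snd (snd \<omega>) m))" by (intro sum_nonneg) auto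
    consider "n = 0" | "- n \<in> {1..int N}" | "n \<in> {1..int N}"
      using \<open>n \<in> {- int N..int N}\<close> by force
    then show ?thesis
      using mem[of n] mem[of "- n"] nn assms
      by cases (auto simp: freq_proj_def b_coeffs_def conj_extend_def split_beta Omega_trunc_iff)
  qed
  have "norm (pairing ?b ?a) = norm (\<Sum>n\<in>{- int N..int N}. ?b (- n) * acorr ?a n)"
    unfolding pairing_eq_infsum[OF sq_summable_freq_proj] by (subst fin) (auto simp: freq_proj_def)
  also have "\<dots> \<le> (\<Sum>n\<in>{- int N..int N}. ?s * B\<^sup>2)"
    by (rule order_trans[OF norm_sum], rule sum_mono)
       (unfold norm_mult, intro mult_mono b order_trans[OF norm_acorr_le[OF sq_summable_freq_proj] a],
        use assms in \<open>auto intro!: add_nonneg_nonneg sum_nonneg\<close>)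
  also have "\<dots> = (2 * real N + 1) * B\<^sup>2 * ?s"
    by (simp add: algebra_simps)
  finally show ?thesis .
qed

lemma norm_exp_powr: "norm (exp z) powr r = exp (r * Re z)"
  by (simp add: norm_exp_eq_Re exp_powr_real mult.commute)

lemma in_LpI:
  assumes [measurable]: "f \<in> borel_measurable M" and "(\<integral>\<^sup>+x. ennreal (norm (f x) powr r) \<partial>M) < \<infinity>"
  shows "in_Lp r M f"
  unfolding in_Lp_def using assms by (auto intro!: integrableI_bounded)

text \<open>The exponent grows linearly in \<open>b\<close> and the Gibbs weight decays
  quadratically, so the integrand is dominated by a product of integrable functions of single
  coordinates.\<close>

proposition in_Lp_trunc:
  assumes "\<kappa> > 0" "B > 0" "r > 0"
  shows "in_Lp r (lborel \<Otimes>\<^sub>M rho_trunc \<kappa> N)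
           (\<lambda>\<omega>. exp (- (complex_of_real \<alpha> / 2) *
                   pairing (freq_proj N (b_coeffs \<omega>)) (freq_proj N (a_coeffs \<omega>))) *
                 indicator (Omega_trunc N B) \<omega>)"
    (is "in_Lp r ?M ?f")
proof -
  have sets_M: "sets ?M = sets (lborel \<Otimes>\<^sub>M lebesgue_modes N)"
    by (intro sets_pair_measure_cong refl sets_rho_trunc)
  note measurable_a_coeffs_trunc [measurable] measurable_b_coeffs_trunc [measurable] measurable_snd_fst [measurable]
  have "?f \<in> borel_measurable (lborel \<Otimes>\<^sub>M lebesgue_modes N)"
  proof -
    have [measurable]: "(\<lambda>\<omega>. pairing (freq_proj N (b_coeffs \<omega>)) (freq_proj N (a_coeffs \<omega>)))
        \<in> borel_measurable (lborel \<Otimes>\<^sub>M lebesgue_modes N)"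
      unfolding pairing_eq_infsum[OF sq_summable_freq_proj]
      by (intro borel_measurable_infsum borel_measurable_times borel_measurable_acorr
          measurable_a_coeffs_trunc measurable_b_coeffs_trunc)
    have [measurable]: "Measurable.pred (lborel \<Otimes>\<^sub>M lebesgue_modes N) (\<lambda>\<omega>. \<omega> \<in> Omega_trunc N B)"
      unfolding Omega_trunc_iff[OF assms(2)] by measurable
    show ?thesis
      unfolding indicator_def by measurable
  qed
  then have f_meas [measurable]: "?f \<in> borel_measurable ?M"
    unfolding measurable_cong_sets[OF sets_M refl] .
  interpret L: sigma_finite_measure "lebesgue_modes N" by (rule sigma_finite_lebesgue_modes)
  interpret R: sigma_finite_measure "rho_trunc \<kappa> N" by (rule sigma_finite_rho_trunc)
  define Z where "Z = (LINT y|lebesgue_modes N. gibbs_weight \<kappa> N y)"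
  have Z: "Z \<ge> 0" unfolding Z_def by (intro integral_nonneg_AE) (auto simp: gibbs_weight_def)
  define C where "C = r * \<bar>\<alpha>\<bar> / 2 * ((2 * real N + 1) * B\<^sup>2)"
  have C: "C \<ge> 0" using assms by (simp add: C_def)
  define ga where "ga z = ennreal (exp (- (1 / 2) * (norm z)\<^sup>2))" for z :: complex
  define gb where "gb z = ennreal (exp (C * norm z - \<kappa> / 2 * (norm z)\<^sup>2))" for z :: complex
  have [measurable]: "ga \<in> borel_measurable borel" "gb \<in> borel_measurable borel"
    by (auto simp: ga_def[abs_def] gb_def[abs_def])
  define G where "G y = (\<Prod>n\<in>nz_modes N. ga (fst y n)) * (\<Prod>n\<in>{1..int N}. gb (snd y n))" for y :: modes
  have G_meas [measurable]: "G \<in> borel_measurable (lebesgue_modes N)"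
    unfolding G_def lebesgue_modes_eq by measurable
  have G_fin: "(\<integral>\<^sup>+y. G y \<partial>lebesgue_modes N) < \<infinity>"
  proof -
    interpret B: sigma_finite_measure "\<Pi>\<^sub>M n\<in>{1..int N}. lborel :: complex measure"
      by (rule sigma_finite_PiM_lborel) simp
    have "(\<integral>\<^sup>+z. gb z \<partial>lborel) < \<infinity>"
    proof -
      \<comment> \<open>Young's inequality gives up half of the quadratic decay to absorb the linear
        term.\<close>
      have le: "C * norm z - \<kappa> / 2 * (norm z)\<^sup>2 \<le> C\<^sup>2 / \<kappa> + - (\<kappa> / 4) * (norm z)\<^sup>2" for z :: complex
      proof -
        have "norm z * C \<le> (\<kappa> / 2 * (norm z)\<^sup>2 + C\<^sup>2 / (\<kappa> / 2)) / 2"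
          by (rule young_weighted) (use assms in simp)
        then show ?thesis by (simp add: algebra_simps)
      qed
      have "(\<integral>\<^sup>+z. gb z \<partial>lborel) \<le> (\<integral>\<^sup>+z. ennreal (exp (C\<^sup>2 / \<kappa>)) * ennreal (exp (- (\<kappa> / 4) * (norm z)\<^sup>2)) \<partial>(lborel :: complex measure))"
        unfolding gb_def ennreal_mult[symmetric, OF exp_ge_zero exp_ge_zero] mult_exp_exp
        by (intro nn_integral_mono ennreal_leI) (use le in simp)
      also have "\<dots> = ennreal (exp (C\<^sup>2 / \<kappa>)) * (\<integral>\<^sup>+z. ennreal (exp (- (\<kappa> / 4) * (norm z)\<^sup>2)) \<partial>(lborel :: complex measure))"
        by (rule nn_integral_cmult) measurable
      also have "\<dots> < \<infinity>"
        using nn_integral_gaussian_finite[where t = "\<kappa> / 4" and 'a = complex] assms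
        by (auto simp: ennreal_mult_less_top)
      finally show ?thesis .
    qed
    moreover have "(\<integral>\<^sup>+z. ga z \<partial>lborel) < \<infinity>"
      unfolding ga_def by (rule nn_integral_gaussian_finite) simp
    ultimately have "(\<integral>\<^sup>+x. (\<Prod>n\<in>nz_modes N. ga (x n)) \<partial>(\<Pi>\<^sub>M n\<in>nz_modes N. lborel)) < \<infinity>"
      and "(\<integral>\<^sup>+x. (\<Prod>n\<in>{1..int N}. gb (x n)) \<partial>(\<Pi>\<^sub>M n\<in>{1..int N}. lborel)) < \<infinity>"
      by (intro nn_integral_PiM_lborel_prod_finite; simp)+
    then have "(\<integral>\<^sup>+x. (\<Prod>n\<in>nz_modes N. ga (x n)) \<partial>(\<Pi>\<^sub>M n\<in>nz_modes N. lborel))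
        * (\<integral>\<^sup>+x. (\<Prod>n\<in>{1..int N}. gb (x n)) \<partial>(\<Pi>\<^sub>M n\<in>{1..int N}. lborel)) < \<infinity>"
      by (simp add: ennreal_mult_less_top)
    then show ?thesis
      unfolding G_def lebesgue_modes_eq by (subst B.nn_integral_pair_mult) auto
  qed
  \<comment> \<open>Lebesgue measure in \<open>(a_0, b_0)\<close> is infinite; the cutoff confines
    both variables to this bounded set.\<close>
  define box where "box = cball (0::complex) B \<times> cball (0::real) B"
  have box: "emeasure lborel box < \<infinity>"
    by (rule emeasure_bounded_finite) (simp add: box_def bounded_Times)
  have [measurable]: "box \<in> sets borel"
    unfolding box_def by (intro borel_closed closed_Times closed_cball)
  \<comment> \<open>\<open>1 / Z\<close> is a real number, also for \<open>Z = 0\<close>, so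
    \<open>K\<close> is finite in any case.\<close>
  define K where "K = ennreal (exp (C * B)) * ennreal (1 / Z)"
  have ptw: "ennreal (norm (?f (x, y)) powr r) * ennreal (gibbs_weight \<kappa> N y / Z) \<le> K * indicator box x * G y" for x y
  proof (cases "(x, y) \<in> Omega_trunc N B")
    case False
    then show ?thesis by simp
  next
    case True
    let ?P = "pairing (freq_proj N (b_coeffs (x, y))) (freq_proj N (a_coeffs (x, y)))"
    let ?S = "\<Sum>m\<in>{1..int N}. norm (snd y m)"
    have x: "x \<in> box"
    proof -
      have "(norm (freq_proj N (a_coeffs (x, y)) 0))\<^sup>2 \<le> (\<Sum>n\<in>{- int N..int N}. (norm (freq_proj N (a_coeffs (x, y)) n))\<^sup>2)"
        by (rule member_le_sum) auto
      also have "\<dots> \<le> B\<^sup>2" using True by (simp add: Omega_trunc_iff[OF assms(2)])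
      finally have "norm (fst x) \<le> B"
        using assms by (simp add: freq_proj_def a_coeffs_def split_beta power2_le_iff_abs_le)
      then show ?thesis
        using True by (cases x) (simp add: box_def Omega_trunc_iff[OF assms(2)])
    qed
    have "r * Re (- (complex_of_real \<alpha> / 2) * ?P) \<le> r * (\<bar>\<alpha>\<bar> / 2 * norm ?P)"
    proof (intro mult_left_mono)
      show "Re (- (complex_of_real \<alpha> / 2) * ?P) \<le> \<bar>\<alpha>\<bar> / 2 * norm ?P"
        by (rule order_trans[OF complex_Re_le_cmod]) (simp add: norm_mult norm_divide)
    qed (use assms in simp)
    also have "\<dots> \<le> r * (\<bar>\<alpha>\<bar> / 2 * ((2 * real N + 1) * B\<^sup>2 * (B + ?S)))"
      using norm_pairing_trunc_le[OF assms(2) True] assms by (intro mult_left_mono) auto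
    also have "\<dots> = C * B + (\<Sum>m\<in>{1..int N}. C * norm (snd y m))"
      unfolding sum_distrib_left[symmetric] by (simp add: C_def algebra_simps)
    finally have "exp (r * Re (- (complex_of_real \<alpha> / 2) * ?P)) \<le> exp (C * B + (\<Sum>m\<in>{1..int N}. C * norm (snd y m)))"
      by (simp only: exp_le_cancel_iff)
    moreover have "?f (x, y) = exp (- (complex_of_real \<alpha> / 2) * ?P)"
      using True by simp
    ultimately have e: "norm (?f (x, y)) powr r \<le> exp (C * B) * (\<Prod>m\<in>{1..int N}. exp (C * norm (snd y m)))"
      by (simp only: norm_exp_powr exp_add exp_sum finite_atLeastAtMost_int)
    have "norm (?f (x, y)) powr r * (gibbs_weight \<kappa> N y / Z)
        \<le> (exp (C * B) * (\<Prod>m\<in>{1..int N}. exp (C * norm (snd y m)))) *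
          ((\<Prod>n\<in>nz_modes N. exp (- (1 / 2) * (norm (fst y n))\<^sup>2)) * (\<Prod>n\<in>{1..int N}. exp (- (\<kappa> / 2) * (norm (snd y n))\<^sup>2)) / Z)"
      using gibbs_weight_le[of \<kappa> N "fst y" "snd y"] assms Z
      by (intro mult_mono e divide_right_mono) (auto simp: gibbs_weight_def split_beta prod_nonneg)
    also have "\<dots> = exp (C * B) * (1 / Z) * ((\<Prod>n\<in>nz_modes N. exp (- (1 / 2) * (norm (fst y n))\<^sup>2))
        * (\<Prod>n\<in>{1..int N}. exp (C * norm (snd y n) - \<kappa> / 2 * (norm (snd y n))\<^sup>2)))"
    proof -
      have "(\<Prod>n\<in>{1..int N}. exp (C * norm (snd y n) - \<kappa> / 2 * (norm (snd y n))\<^sup>2))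
          = (\<Prod>n\<in>{1..int N}. exp (C * norm (snd y n))) * (\<Prod>n\<in>{1..int N}. exp (- (\<kappa> / 2) * (norm (snd y n))\<^sup>2))"
        by (simp add: prod.distrib[symmetric] mult_exp_exp)
      then show ?thesis by simp
    qed
    finally have "ennreal (norm (?f (x, y)) powr r * (gibbs_weight \<kappa> N y / Z)) \<le> ennreal \<dots>"
      by (rule ennreal_leI)
    also have "\<dots> = K * indicator box x * G y"
    proof -
      have e4: "ennreal (p * q * (s * t)) = ennreal p * ennreal q * 1 * (ennreal s * ennreal t)"
        if "p \<ge> 0" "q \<ge> 0" "s \<ge> 0" "t \<ge> 0" for p q s t :: real
        using that by (simp add: ennreal_mult)
      have i: "indicator box x = (1 :: ennreal)" using x by simp
      show ?thesis
        unfolding K_def G_def ga_def gb_def i prod_ennreal[OF exp_ge_zero]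
        by (rule e4) (use Z in \<open>auto intro!: prod_nonneg\<close>)
    qed
    finally show ?thesis
      by (simp add: ennreal_mult'[symmetric])
  qed
  have "(\<integral>\<^sup>+\<omega>. ennreal (norm (?f \<omega>) powr r) \<partial>?M)
      = (\<integral>\<^sup>+x. \<integral>\<^sup>+y. ennreal (norm (?f (x, y)) powr r) \<partial>rho_trunc \<kappa> N \<partial>lborel)"
    by (rule R.nn_integral_fst[symmetric]) measurable
  also have "\<dots> = (\<integral>\<^sup>+x. \<integral>\<^sup>+y. ennreal (gibbs_weight \<kappa> N y / Z) * ennreal (norm (?f (x, y)) powr r) \<partial>lebesgue_modes N \<partial>lborel)"
  proof (intro nn_integral_cong)
    fix x :: "complex \<times> real"
    have "?f \<in> borel_measurable (lborel \<Otimes>\<^sub>M lebesgue_modes N)"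
      using f_meas unfolding measurable_cong_sets[OF sets_M refl] .
    from measurable_compose[OF measurable_Pair1' this, of x]
    have [measurable]: "(\<lambda>y. ?f (x, y)) \<in> borel_measurable (lebesgue_modes N)" by simp
    have "(\<lambda>y. ennreal (norm (?f (x, y)) powr r)) \<in> borel_measurable (lebesgue_modes N)"
      by measurable
    then show "(\<integral>\<^sup>+y. ennreal (norm (?f (x, y)) powr r) \<partial>rho_trunc \<kappa> N)
        = (\<integral>\<^sup>+y. ennreal (gibbs_weight \<kappa> N y / Z) * ennreal (norm (?f (x, y)) powr r) \<partial>lebesgue_modes N)"
      unfolding rho_trunc_def Z_def[symmetric] by (subst nn_integral_density) auto
  qed
  also have "\<dots> \<le> (\<integral>\<^sup>+x. \<integral>\<^sup>+y. K * indicator box x * G y \<partial>lebesgue_modes N \<partial>lborel)"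
    by (intro nn_integral_mono) (use ptw in \<open>simp add: mult.commute\<close>)
  also have "\<dots> = K * emeasure lborel box * (\<integral>\<^sup>+y. G y \<partial>lebesgue_modes N)"
    by (simp add: nn_integral_cmult nn_integral_multc)
  also have "\<dots> < \<infinity>"
    using box G_fin by (simp add: ennreal_mult_less_top K_def)
  finally show ?thesis
    by (rule in_LpI[OF f_meas])
qed

section \<open>The Gaussian measure on all modes\<close>

text \<open>Indices outside the products get variance \<open>1\<close>, since a product probability space needs a
  probability measure at every index and \<open>complex_gaussian 0\<close> is the null measure.\<close>

definition var_a :: "int \<Rightarrow> real" where
  "var_a n = (if n = 0 then 1 else 1 / (of_int n)\<^sup>2)"

definition var_b :: "real \<Rightarrow> int \<Rightarrow> real" where
  "var_b \<kappa> n = (if n \<ge> 1 then 1 / (2 * \<kappa> * of_int n) else 1)"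

definition rho_a :: "(int \<Rightarrow> complex) measure" where
  "rho_a = (\<Pi>\<^sub>M n\<in>{n. n \<noteq> 0}. complex_gaussian (var_a n))"

definition rho_b :: "real \<Rightarrow> (int \<Rightarrow> complex) measure" where
  "rho_b \<kappa> = (\<Pi>\<^sub>M n\<in>{n. n \<ge> 1}. complex_gaussian (var_b \<kappa> n))"

lemma rho_eq: "rho \<kappa> = rho_a \<Otimes>\<^sub>M rho_b \<kappa>"
  unfolding rho_def rho_a_def rho_b_def
  by (intro arg_cong2[where f = pair_measure] PiM_cong) (auto simp: var_a_def var_b_def)

lemma var_a_pos: "var_a n > 0"
  by (simp add: var_a_def)

lemma var_b_pos: "\<kappa> > 0 \<Longrightarrow> var_b \<kappa> n > 0"
  by (simp add: var_b_def)

lemma product_prob_space_a: "product_prob_space (\<lambda>n. complex_gaussian (var_a n))"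
  by (intro product_prob_spaceI prob_space_complex_gaussian var_a_pos)

lemma product_prob_space_b: "\<kappa> > 0 \<Longrightarrow> product_prob_space (\<lambda>n. complex_gaussian (var_b \<kappa> n))"
  by (intro product_prob_spaceI prob_space_complex_gaussian var_b_pos)

lemma prob_space_rho_a: "prob_space rho_a"
  unfolding rho_a_def by (intro prob_space_PiM prob_space_complex_gaussian var_a_pos)

lemma prob_space_rho_b: "\<kappa> > 0 \<Longrightarrow> prob_space (rho_b \<kappa>)"
  unfolding rho_b_def by (intro prob_space_PiM prob_space_complex_gaussian var_b_pos)

lemma measurable_rho_a: "n \<noteq> 0 \<Longrightarrow> (\<lambda>a. a n) \<in> borel_measurable rho_a"
  unfolding rho_a_def by measurable

lemma measurable_rho_b: "n \<ge> 1 \<Longrightarrow> (\<lambda>b. b n) \<in> borel_measurable (rho_b \<kappa>)"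
  unfolding rho_b_def by measurable

lemma nn_integral_rho_a_component:
  assumes "n \<noteq> 0" "f \<in> borel_measurable borel"
  shows "(\<integral>\<^sup>+a. f (a n) \<partial>rho_a) = (\<integral>\<^sup>+z. f z \<partial>complex_gaussian (1 / (of_int n)\<^sup>2))"
proof -
  interpret product_prob_space "\<lambda>n. complex_gaussian (var_a n)" "{n. n \<noteq> 0}"
    by (rule product_prob_space_a)
  show ?thesis
    unfolding rho_a_def using assms by (subst nn_integral_PiM_component) (auto simp: var_a_def)
qed

lemma nn_integral_rho_b_component:
  assumes "\<kappa> > 0" "n \<ge> 1" "f \<in> borel_measurable borel"
  shows "(\<integral>\<^sup>+b. f (b n) \<partial>rho_b \<kappa>) = (\<integral>\<^sup>+z. f z \<partial>complex_gaussian (1 / (2 * \<kappa> * of_int n)))"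
proof -
  interpret product_prob_space "\<lambda>n. complex_gaussian (var_b \<kappa> n)" "{n. n \<ge> 1}"
    by (rule product_prob_space_b) fact
  show ?thesis
    unfolding rho_b_def using assms by (subst nn_integral_PiM_component) (auto simp: var_b_def)
qed

text \<open>Independence gives a product of Gaussian moment generating functions. The variance
  \<open>1 / (2 * \<kappa> * n)\<close> is the source of the weight \<open>1 / n\<close> on the
  squared coefficients.\<close>

lemma nn_integral_rho_b_exp:
  assumes "\<kappa> > 0" "finite J" "J \<subseteq> {1..}"
  shows "(\<integral>\<^sup>+b. ennreal (exp (\<Sum>n\<in>J. Re (w n * b n))) \<partial>rho_b \<kappa>)
    = ennreal (exp (\<Sum>n\<in>J. (norm (w n))\<^sup>2 / (4 * \<kappa> * of_int n)))"
proof -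
  interpret product_prob_space "\<lambda>n. complex_gaussian (var_b \<kappa> n)" "{n. n \<ge> 1}"
    by (rule product_prob_space_b) fact
  have "(\<integral>\<^sup>+b. ennreal (exp (\<Sum>n\<in>J. Re (w n * b n))) \<partial>rho_b \<kappa>)
      = (\<integral>\<^sup>+b. (\<Prod>n\<in>J. ennreal (exp (Re (w n * b n)))) \<partial>rho_b \<kappa>)"
    using assms(2) by (simp only: exp_sum prod_ennreal exp_ge_zero)
  also have "\<dots> = (\<Prod>n\<in>J. \<integral>\<^sup>+z. ennreal (exp (Re (w n * z))) \<partial>complex_gaussian (var_b \<kappa> n))"
    unfolding rho_b_def using assms(2,3) by (intro nn_integral_PiM_prod) auto
  also have "\<dots> = (\<Prod>n\<in>J. ennreal (exp ((norm (w n))\<^sup>2 / (4 * \<kappa> * of_int n))))"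
  proof (intro prod.cong refl)
    fix n assume "n \<in> J"
    then have n: "n \<ge> 1" using assms(3) by auto
    have "(norm (w n))\<^sup>2 * var_b \<kappa> n / 2 = (norm (w n))\<^sup>2 / (4 * \<kappa> * of_int n)"
      using n by (simp add: var_b_def)
    then show "(\<integral>\<^sup>+z. ennreal (exp (Re (w n * z))) \<partial>complex_gaussian (var_b \<kappa> n))
        = ennreal (exp ((norm (w n))\<^sup>2 / (4 * \<kappa> * of_int n)))"
      by (simp only: nn_integral_complex_gaussian_exp[OF var_b_pos[OF assms(1)]])
  qed
  also have "\<dots> = ennreal (exp (\<Sum>n\<in>J. (norm (w n))\<^sup>2 / (4 * \<kappa> * of_int n)))"
    using assms(2) by (simp only: exp_sum prod_ennreal exp_ge_zero)
  finally show ?thesis .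
qed

section \<open>Exponential integrability of the Sobolev weight\<close>

lemma bracket_le: "n \<noteq> 0 \<Longrightarrow> bracket n / 2 \<le> \<bar>of_int n\<bar>"
proof -
  assume "n \<noteq> 0"
  then have "1 \<le> \<bar>n\<bar>" by linarith
  then have "(1::real) \<le> \<bar>of_int n\<bar>" by linarith
  then show ?thesis by (simp add: bracket_def)
qed

text \<open>Halving \<open>bracket n\<close> costs \<open>2 powr p\<close>, which is at most
  \<open>4\<close> on this range of \<open>p\<close>.\<close>

lemma powr_le_bracket_powr:
  assumes "n \<noteq> 0" "0 \<le> p" "p \<le> 2"
  shows "\<bar>of_int n\<bar> powr - p \<le> 4 * bracket n powr - p"
proof -
  have "\<bar>of_int n\<bar> powr - p \<le> (bracket n / 2) powr - p"
    using bracket_le[OF assms(1)] assms(2) by (intro powr_mono2') auto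
  also have "\<dots> = 2 powr p * bracket n powr - p"
    by (simp add: powr_divide powr_minus field_simps)
  also have "\<dots> \<le> 2 powr 2 * bracket n powr - p"
    using assms by (intro mult_right_mono powr_mono) auto
  finally show ?thesis by simp
qed

lemma sqrt_div_sq_le:
  assumes "n \<noteq> 0"
  shows "sqrt \<bar>of_int n\<bar> / (of_int n)\<^sup>2 \<le> 4 * bracket n powr - (3 / 2)"
proof -
  have "sqrt \<bar>real_of_int n\<bar> / (of_int n)\<^sup>2 = \<bar>of_int n\<bar> powr (1 / 2) / \<bar>of_int n\<bar> powr 2"
    using assms by (simp add: powr_half_sqrt)
  also have "\<dots> = \<bar>of_int n\<bar> powr (1 / 2 - 2)"
    by (rule powr_diff[symmetric])
  also have "\<dots> = \<bar>of_int n\<bar> powr - (3 / 2)"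
    by simp
  also have "\<dots> \<le> 4 * bracket n powr - (3 / 2)"
    using assms by (intro powr_le_bracket_powr) auto
  finally show ?thesis .
qed

text \<open>Terms of the squared homogeneous Sobolev seminorm of order 1/4. The weight vanishes at
  \<open>k = 0\<close>, so the sum does not depend on \<open>a_0\<close> and is a function on the
  space of \<open>rho_a\<close> alone.\<close>

definition sobolev :: "(int \<Rightarrow> complex) \<Rightarrow> int \<Rightarrow> real" where
  "sobolev a k = sqrt \<bar>of_int k\<bar> * (norm (a k))\<^sup>2"

lemma measurable_sobolev [measurable]: "(\<lambda>a. sobolev a k) \<in> borel_measurable rho_a"
proof (cases "k = 0")
  case False
  note [measurable] = measurable_rho_a[OF False]
  show ?thesis unfolding sobolev_def by measurable
qed (simp add: sobolev_def)

lemma sobolev_nonneg [simp]: "sobolev a k \<ge> 0"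
  by (simp add: sobolev_def)

text \<open>The expectation of the sum is bounded by a multiple of the sum of
  \<open>bracket k powr - (3 / 2)\<close>. Summability has to be secured because a divergent
  \<open>infsum\<close> is \<open>0\<close> and would be useless as an upper bound.\<close>

lemma AE_sobolev_summable: "AE a in rho_a. sobolev a summable_on UNIV"
proof -
  let ?C = "count_space (UNIV :: int set)"
  have "(\<integral>\<^sup>+a. \<integral>\<^sup>+k. ennreal (sobolev a k) \<partial>?C \<partial>rho_a) = (\<integral>\<^sup>+k. \<integral>\<^sup>+a. ennreal (sobolev a k) \<partial>rho_a \<partial>?C)"
    by (rule nn_integral_count_space_nn_integral) auto
  also have "\<dots> \<le> (\<integral>\<^sup>+k. ennreal (32 * bracket k powr - (3 / 2)) \<partial>?C)"
  proof (rule nn_integral_mono)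
    fix k :: int
    show "(\<integral>\<^sup>+a. ennreal (sobolev a k) \<partial>rho_a) \<le> ennreal (32 * bracket k powr - (3 / 2))"
    proof (cases "k = 0")
      case False
      have "(\<integral>\<^sup>+a. ennreal (sobolev a k) \<partial>rho_a) = (\<integral>\<^sup>+a. ennreal (sqrt \<bar>of_int k\<bar>) * ennreal ((norm (a k))\<^sup>2) \<partial>rho_a)"
        by (simp add: sobolev_def ennreal_mult)
      also have "\<dots> = (\<integral>\<^sup>+z. ennreal (sqrt \<bar>of_int k\<bar>) * ennreal ((norm z)\<^sup>2) \<partial>complex_gaussian (1 / (of_int k)\<^sup>2))"
        using False by (intro nn_integral_rho_a_component) auto
      also have "\<dots> = ennreal (sqrt \<bar>of_int k\<bar>) * (\<integral>\<^sup>+z. ennreal ((norm z)\<^sup>2) \<partial>complex_gaussian (1 / (of_int k)\<^sup>2))"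
        by (rule nn_integral_cmult) measurable
      also have "\<dots> \<le> ennreal (sqrt \<bar>of_int k\<bar>) * ennreal (8 * (1 / (of_int k)\<^sup>2))"
        using False by (intro mult_left_mono nn_integral_complex_gaussian_norm_sq) auto
      also have "\<dots> = ennreal (8 * (sqrt \<bar>of_int k\<bar> / (of_int k)\<^sup>2))"
        by (simp add: ennreal_mult[symmetric])
      also have "\<dots> \<le> ennreal (32 * bracket k powr - (3 / 2))"
        using sqrt_div_sq_le[OF False] by (intro ennreal_leI) simp
      finally show ?thesis .
    qed (simp add: sobolev_def)
  qed
  also have "\<dots> < \<infinity>"
    by (subst nn_integral_count_space_eq_infsum(1))
       (auto intro!: summable_on_cmult_right summable_bracket_powr)
  finally have "AE a in rho_a. (\<integral>\<^sup>+k. ennreal (sobolev a k) \<partial>?C) \<noteq> \<infinity>"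
    by (intro nn_integral_PInf_AE borel_measurable_nn_integral_count_space) auto
  then show ?thesis
    by eventually_elim (rule nn_integral_count_space_eq_infsum(2), auto simp: less_top)
qed

lemma prod_mono_ennreal:
  fixes f g :: "'a \<Rightarrow> ennreal"
  assumes "\<And>i. i \<in> A \<Longrightarrow> f i \<le> g i"
  shows "prod f A \<le> prod g A"
  using assms by (induction A rule: infinite_finite_induct) (auto intro!: mult_mono)

text \<open>The bounds for single modes multiply to the exponential of a convergent series,
  uniformly over the partial sums; Fatou then passes to the full sum.\<close>

lemma nn_integral_exp_sobolev_finite:
  "(\<integral>\<^sup>+a. ennreal (exp ((\<Sum>\<^sub>\<infinity>k. sobolev a k) / 4)) \<partial>rho_a) < \<infinity>"
proof -
  define S where "S = (\<Sum>\<^sub>\<infinity>k. bracket k powr - (3 / 2))"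
  let ?J = "\<lambda>N::nat. {- int N..int N}"
  interpret product_prob_space "\<lambda>n. complex_gaussian (var_a n)" "{n. n \<noteq> 0}"
    by (rule product_prob_space_a)
  have step: "(\<integral>\<^sup>+a. ennreal (exp ((\<Sum>k\<in>?J N. sobolev a k) / 4)) \<partial>rho_a) \<le> ennreal (exp (4 * S))" for N
  proof -
    \<comment> \<open>With variance \<open>v = 1 / k^2\<close> this \<open>t\<close> gives
      \<open>4 * t * v = \<bar>k\<bar>^(-3/2)\<close>: at most 1, as the bound for a single mode
      requires, and summable over \<open>k\<close>.\<close>
    let ?t = "\<lambda>k. sqrt \<bar>real_of_int k\<bar> / 4"
    have "(\<Sum>k\<in>?J N. sobolev a k) / 4 = (\<Sum>k\<in>?J N - {0}. ?t k * (norm (a k))\<^sup>2)" for a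
      unfolding sum_divide_distrib by (rule sum.mono_neutral_cong_right) (auto simp: sobolev_def)
    then have "(\<integral>\<^sup>+a. ennreal (exp ((\<Sum>k\<in>?J N. sobolev a k) / 4)) \<partial>rho_a)
        = (\<integral>\<^sup>+a. (\<Prod>k\<in>?J N - {0}. ennreal (exp (?t k * (norm (a k))\<^sup>2))) \<partial>rho_a)"
      by (simp only: exp_sum prod_ennreal exp_ge_zero finite_Diff finite_atLeastAtMost_int)
    also have "\<dots> = (\<Prod>k\<in>?J N - {0}. \<integral>\<^sup>+z. ennreal (exp (?t k * (norm z)\<^sup>2)) \<partial>complex_gaussian (var_a k))"
      unfolding rho_a_def by (intro nn_integral_PiM_prod) auto
    also have "\<dots> \<le> (\<Prod>k\<in>?J N - {0}. ennreal (exp (4 * bracket k powr - (3 / 2))))"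
    proof (rule prod_mono_ennreal)
      fix k assume "k \<in> ?J N - {0}"
      then have k: "k \<noteq> 0" by simp
      then have k1: "1 \<le> \<bar>real_of_int k\<bar>" by linarith
      have "4 * ?t k * var_a k = sqrt \<bar>of_int k\<bar> / (of_int k)\<^sup>2"
        using k by (simp add: var_a_def)
      moreover have "sqrt \<bar>real_of_int k\<bar> \<le> (of_int k)\<^sup>2"
      proof -
        have le: "\<bar>real_of_int k\<bar> \<le> (of_int k)\<^sup>2"
          using mult_right_mono[OF k1, of "\<bar>real_of_int k\<bar>"] by (simp add: power2_eq_square)
        then have "sqrt \<bar>real_of_int k\<bar> \<le> \<bar>of_int k\<bar>"
          by (intro real_le_lsqrt) auto
        then show ?thesis using le by linarith
      qed
      ultimately have "(\<integral>\<^sup>+z. ennreal (exp (?t k * (norm z)\<^sup>2)) \<partial>complex_gaussian (var_a k))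
          \<le> ennreal (exp (4 * ?t k * var_a k))"
        using k by (intro nn_integral_complex_gaussian_exp_sq_le var_a_pos) auto
      also have "\<dots> \<le> ennreal (exp (4 * bracket k powr - (3 / 2)))"
        unfolding \<open>4 * ?t k * var_a k = sqrt \<bar>of_int k\<bar> / (of_int k)\<^sup>2\<close>
        using sqrt_div_sq_le[OF k] by (intro ennreal_leI) simp
      finally show "(\<integral>\<^sup>+z. ennreal (exp (?t k * (norm z)\<^sup>2)) \<partial>complex_gaussian (var_a k))
          \<le> ennreal (exp (4 * bracket k powr - (3 / 2)))" .
    qed
    also have "\<dots> = ennreal (exp (\<Sum>k\<in>?J N - {0}. 4 * bracket k powr - (3 / 2)))"
      by (simp only: exp_sum prod_ennreal exp_ge_zero finite_Diff finite_atLeastAtMost_int)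
    also have "\<dots> \<le> ennreal (exp (4 * S))"
    proof -
      have "(\<Sum>k\<in>?J N - {0}. bracket k powr - (3 / 2)) \<le> S"
        unfolding S_def by (rule finite_sum_le_infsum) (auto intro!: summable_bracket_powr)
      then show ?thesis
        unfolding sum_distrib_left[symmetric] by (intro ennreal_leI) simp
    qed
    finally show ?thesis .
  qed
  have "(\<integral>\<^sup>+a. ennreal (exp ((\<Sum>\<^sub>\<infinity>k. sobolev a k) / 4)) \<partial>rho_a)
      = (\<integral>\<^sup>+a. liminf (\<lambda>N. ennreal (exp ((\<Sum>k\<in>?J N. sobolev a k) / 4))) \<partial>rho_a)"
  proof (rule nn_integral_cong_AE)
    show "AE a in rho_a. ennreal (exp ((\<Sum>\<^sub>\<infinity>k. sobolev a k) / 4))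
        = liminf (\<lambda>N. ennreal (exp ((\<Sum>k\<in>?J N. sobolev a k) / 4)))"
      using AE_sobolev_summable
    proof eventually_elim
      case (elim a)
      have "(\<lambda>N. \<Sum>k\<in>?J N. sobolev a k) \<longlonglongrightarrow> (\<Sum>\<^sub>\<infinity>k. sobolev a k)"
        by (rule has_sum_imp_tendsto_symmetric[OF has_sum_infsum[OF elim]])
      then have "(\<lambda>N. ennreal (exp ((\<Sum>k\<in>?J N. sobolev a k) / 4))) \<longlonglongrightarrow> ennreal (exp ((\<Sum>\<^sub>\<infinity>k. sobolev a k) / 4))"
        by (intro tendsto_intros) auto
      from lim_imp_Liminf[OF sequentially_bot this] show ?case by (rule sym)
    qed
  qed
  also have "\<dots> \<le> liminf (\<lambda>N. \<integral>\<^sup>+a. ennreal (exp ((\<Sum>k\<in>?J N. sobolev a k) / 4)) \<partial>rho_a)"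
    by (rule nn_integral_liminf) measurable
  also have "\<dots> \<le> ennreal (exp (4 * S))"
    by (rule Liminf_le) (auto intro: always_eventually step)
  also have "\<dots> < \<infinity>" by simp
  finally show ?thesis .
qed

text \<open>One constant serves all \<open>a\<close> and all \<open>M\<close>: uniformity in
  \<open>M\<close> is what Fatou needs, and uniformity in \<open>a\<close> lets the constant leave
  the integral over \<open>rho_a\<close>.\<close>

lemma acorr_weighted_sum_le:
  assumes "D \<ge> 0" "B > 0"
  obtains K where "\<And>a M. \<lbrakk>sq_summable a; (\<Sum>\<^sub>\<infinity>k. (norm (a k))\<^sup>2) \<le> B\<^sup>2; sobolev a summable_on UNIV\<rbrakk> \<Longrightarrow>
    D * (\<Sum>n\<in>{1..int M}. (norm (acorr a n))\<^sup>2 / of_int n) \<le> K + (\<Sum>\<^sub>\<infinity>k. sobolev a k) / 4"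
proof -
  define S where "S = (\<Sum>\<^sub>\<infinity>k. bracket k powr - (5 / 4))"
  have S: "S \<ge> 0" unfolding S_def by (intro infsum_nonneg) auto
  define Q where "Q = D * (4 * S * B\<^sup>2)"
  have Q: "Q \<ge> 0" using S assms by (simp add: Q_def)
  \<comment> \<open>\<open>Q\<close> is the total coefficient in front of
    \<open>l * h + B^2 / l\<close>. This choice forces \<open>Q * l <= 1/4\<close>, and the added 1
    keeps the denominator positive when \<open>Q = 0\<close>.\<close>
  define l where "l = 1 / (4 * Q + 1)"
  have l: "l > 0" using Q by (simp add: l_def)
  have Ql: "Q * l \<le> 1 / 4" using Q by (simp add: l_def field_simps)
  show ?thesis
  proof (rule that)
    fix a M
    assume a: "sq_summable a" and nB: "(\<Sum>\<^sub>\<infinity>k. (norm (a k))\<^sup>2) \<le> B\<^sup>2" and H: "sobolev a summable_on UNIV"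
    define h where "h = (\<Sum>\<^sub>\<infinity>k. sobolev a k)"
    have h: "h \<ge> 0" unfolding h_def by (intro infsum_nonneg) auto
    have "(\<Sum>n\<in>{1..int M}. (norm (acorr a n))\<^sup>2 / of_int n)
        \<le> (\<Sum>n\<in>{1..int M}. (4 * bracket n powr - (5 / 4)) * (B\<^sup>2 * (l * h + B\<^sup>2 / l)))"
    proof (rule sum_mono)
      fix n assume "n \<in> {1..int M}"
      then have n: "n \<ge> 1" by simp
      then have n0: "real_of_int n > 0" by simp
      have w: "sqrt (sqrt (of_int n)) * norm (acorr a n) \<le> l * h + B\<^sup>2 / l"
      proof -
        have "sqrt (sqrt \<bar>of_int n\<bar>) * norm (acorr a n) \<le> l * h + (\<Sum>\<^sub>\<infinity>k. (norm (a k))\<^sup>2) / l"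
          using norm_acorr_weighted_le[OF a _ l, of n] H by (simp add: sobolev_def[abs_def] h_def)
        also have "\<dots> \<le> l * h + B\<^sup>2 / l"
          using nB l by (intro add_left_mono divide_right_mono) auto
        finally show ?thesis using n0 by simp
      qed
      have s: "sqrt (sqrt (of_int n)) > 0" using n0 by simp
      have "norm (acorr a n) \<le> (l * h + B\<^sup>2 / l) / sqrt (sqrt (of_int n))"
        using w s by (simp add: pos_le_divide_eq mult.commute)
      moreover have "norm (acorr a n) \<le> B\<^sup>2"
        by (rule order_trans[OF norm_acorr_le[OF a] nB])
      ultimately have "(norm (acorr a n))\<^sup>2 \<le> B\<^sup>2 * ((l * h + B\<^sup>2 / l) / sqrt (sqrt (of_int n)))"
        unfolding power2_eq_square[of "norm (acorr a n)"] by (intro mult_mono) auto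
      then have "(norm (acorr a n))\<^sup>2 / of_int n \<le> B\<^sup>2 * ((l * h + B\<^sup>2 / l) / sqrt (sqrt (of_int n))) / of_int n"
        using n0 by (intro divide_right_mono) auto
      also have "\<dots> = of_int n powr - (5 / 4) * (B\<^sup>2 * (l * h + B\<^sup>2 / l))"
      proof -
        have "sqrt (sqrt (real_of_int n)) = of_int n powr (1 / 4)"
          using n0 by (simp add: powr_half_sqrt[symmetric] powr_powr)
        moreover have "real_of_int n powr - (5 / 4) = 1 / (of_int n powr (1 / 4) * of_int n)"
          using n0 powr_add[of "real_of_int n" "1 / 4" 1] by (simp add: powr_minus_divide)
        ultimately show ?thesis by simp
      qed
      also have "\<dots> \<le> (4 * bracket n powr - (5 / 4)) * (B\<^sup>2 * (l * h + B\<^sup>2 / l))"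
        using powr_le_bracket_powr[of n "5 / 4"] n l h by (intro mult_right_mono mult_nonneg_nonneg) auto
      finally show "(norm (acorr a n))\<^sup>2 / of_int n \<le> (4 * bracket n powr - (5 / 4)) * (B\<^sup>2 * (l * h + B\<^sup>2 / l))" .
    qed
    also have "\<dots> = 4 * (\<Sum>n\<in>{1..int M}. bracket n powr - (5 / 4)) * (B\<^sup>2 * (l * h + B\<^sup>2 / l))"
      by (simp add: sum_distrib_left sum_distrib_right)
    also have "\<dots> \<le> 4 * S * (B\<^sup>2 * (l * h + B\<^sup>2 / l))"
    proof -
      have "(\<Sum>n\<in>{1..int M}. bracket n powr - (5 / 4)) \<le> S"
        unfolding S_def by (rule finite_sum_le_infsum) (auto intro!: summable_bracket_powr)
      then show ?thesis using l h by (intro mult_right_mono mult_left_mono) auto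
    qed
    finally have "D * (\<Sum>n\<in>{1..int M}. (norm (acorr a n))\<^sup>2 / of_int n) \<le> D * (4 * S * (B\<^sup>2 * (l * h + B\<^sup>2 / l)))"
      using assms by (intro mult_left_mono) auto
    also have "\<dots> = Q * (B\<^sup>2 / l) + Q * l * h"
      by (simp add: Q_def algebra_simps)
    also have "\<dots> \<le> Q * (B\<^sup>2 / l) + h / 4"
      using mult_right_mono[OF Ql h] by simp
    finally show "D * (\<Sum>n\<in>{1..int M}. (norm (acorr a n))\<^sup>2 / of_int n) \<le> Q * (B\<^sup>2 / l) + (\<Sum>\<^sub>\<infinity>k. sobolev a k) / 4"
      by (simp add: h_def)
  qed
qed

section \<open>Integrability over all modes\<close>

lemma ennreal_add_mult:
  "\<lbrakk>p \<ge> 0; q \<ge> 0; s \<ge> 0; t \<ge> 0\<rbrakk> \<Longrightarrow> ennreal (p * s + q * t) = ennreal p * ennreal s + ennreal q * ennreal t"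
  by (simp add: ennreal_mult ennreal_plus)

lemma measurable_a_coeffs: "(\<lambda>\<omega>. a_coeffs \<omega> n) \<in> borel_measurable (lborel \<Otimes>\<^sub>M rho \<kappa>)"
proof -
  have "(\<lambda>\<omega>. a_coeffs \<omega> n) = (if n = 0 then \<lambda>\<omega>. fst (fst \<omega>) else (\<lambda>\<omega>. fst (snd \<omega>) n))"
    by (auto simp: a_coeffs_def fun_eq_iff split_beta)
  also have "\<dots> \<in> borel_measurable (lborel \<Otimes>\<^sub>M rho \<kappa>)"
    unfolding rho_eq using measurable_fst_fst[of "rho_a \<Otimes>\<^sub>M rho_b \<kappa>"]
      measurable_compose[OF measurable_compose[OF measurable_snd measurable_fst] measurable_rho_a[of n]]
    by auto
  finally show ?thesis .
qed

lemma measurable_b_coeffs: "(\<lambda>\<omega>. b_coeffs \<omega> n) \<in> borel_measurable (lborel \<Otimes>\<^sub>M rho \<kappa>)"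
proof -
  have "(\<lambda>\<omega>. b_coeffs \<omega> n) = (if n = 0 then \<lambda>\<omega>. complex_of_real (snd (fst \<omega>))
      else if n \<ge> 1 then (\<lambda>\<omega>. snd (snd \<omega>) n) else (\<lambda>\<omega>. cnj (snd (snd \<omega>) (- n))))"
    by (auto simp: b_coeffs_def conj_extend_def fun_eq_iff split_beta)
  also have "\<dots> \<in> borel_measurable (lborel \<Otimes>\<^sub>M rho \<kappa>)"
    unfolding rho_eq using measurable_compose[OF measurable_snd_fst[of "rho_a \<Otimes>\<^sub>M rho_b \<kappa>"] borel_measurable_of_real]
      measurable_compose[OF measurable_compose[OF measurable_snd measurable_snd] measurable_rho_b[of n]]
      borel_measurable_cnj[OF measurable_compose[OF measurable_compose[OF measurable_snd measurable_snd] measurable_rho_b[of "- n"]]]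
    by auto
  finally show ?thesis .
qed

lemma Omega_iff:
  assumes "B > 0"
  shows "\<omega> \<in> Omega B \<longleftrightarrow> sq_summable (a_coeffs \<omega>) \<and> (\<Sum>\<^sub>\<infinity>n. (norm (a_coeffs \<omega> n))\<^sup>2) \<le> B\<^sup>2 \<and> \<bar>snd (fst \<omega>)\<bar> \<le> B"
proof -
  have "norm (b_coeffs \<omega> 0) = \<bar>snd (fst \<omega>)\<bar>"
    by (simp add: b_coeffs_def split_beta)
  moreover have "sqrt s \<le> B \<longleftrightarrow> s \<le> B\<^sup>2" if "s \<ge> 0" for s
    using assms that by (meson less_imp_le real_le_lsqrt sqrt_le_D)
  moreover have "(\<Sum>\<^sub>\<infinity>n. (norm (a_coeffs \<omega> n))\<^sup>2) \<ge> 0"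
    by (intro infsum_nonneg) auto
  ultimately show ?thesis
    by (simp add: Omega_def sq_summable_def)
qed

text \<open>A sequence that is not square-summable has an infinite integral and fails the inequality
  by itself. The summability clause is thereby absorbed, and measurability of the cutoff becomes
  immediate.\<close>

lemma Omega_iff_nn_integral:
  assumes "B > 0"
  shows "\<omega> \<in> Omega B \<longleftrightarrow>
    (\<integral>\<^sup>+n. ennreal ((norm (a_coeffs \<omega> n))\<^sup>2) \<partial>count_space UNIV) \<le> ennreal (B\<^sup>2) \<and> \<bar>snd (fst \<omega>)\<bar> \<le> B"
proof (cases "sq_summable (a_coeffs \<omega>)")
  case True
  then have "(\<integral>\<^sup>+n. ennreal ((norm (a_coeffs \<omega> n))\<^sup>2) \<partial>count_space UNIV) = ennreal (\<Sum>\<^sub>\<infinity>n. (norm (a_coeffs \<omega> n))\<^sup>2)"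
    by (intro nn_integral_count_space_eq_infsum(1)) (auto simp: sq_summable_def)
  then show ?thesis
    using True by (simp add: Omega_iff[OF assms])
next
  case False
  then show ?thesis
    by (auto simp: Omega_iff[OF assms] sq_summable_iff_nn_integral top_unique not_less)
qed

lemma measurable_Omega:
  assumes "B > 0"
  shows "Measurable.pred (lborel \<Otimes>\<^sub>M rho \<kappa>) (\<lambda>\<omega>. \<omega> \<in> Omega B)"
proof -
  note [measurable] = measurable_snd_fst measurable_a_coeffs
  have [measurable]: "(\<lambda>\<omega>. \<integral>\<^sup>+n. ennreal ((norm (a_coeffs \<omega> n))\<^sup>2) \<partial>count_space UNIV) \<in> borel_measurable (lborel \<Otimes>\<^sub>M rho \<kappa>)"
    by (rule borel_measurable_nn_integral_count_space) measurable
  show ?thesis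
    unfolding Omega_iff_nn_integral[OF assms] by measurable
qed

text \<open>\<open>32 = 8 * 4\<close> joins the second-moment constant to the cost of replacing
  \<open>\<bar>n\<bar>\<close> by \<open>bracket n\<close>; adding \<open>(norm a0)^2\<close> lets
  the same formula cover the deterministic zero mode.\<close>

lemma nn_integral_a_coeffs_sq:
  "(\<integral>\<^sup>+a. ennreal ((norm (a_coeffs ((a0, b0), (a, b)) n))\<^sup>2) \<partial>rho_a) \<le> ennreal (((norm a0)\<^sup>2 + 32) / (bracket n)\<^sup>2)"
proof (cases "n = 0")
  case True
  interpret prob_space rho_a by (rule prob_space_rho_a)
  show ?thesis using True by (simp add: a_coeffs_def bracket_def emeasure_space_1 ennreal_leI)
next
  case False
  have "(\<integral>\<^sup>+a. ennreal ((norm (a_coeffs ((a0, b0), (a, b)) n))\<^sup>2) \<partial>rho_a) \<le> ennreal (8 * (1 / (of_int n)\<^sup>2))"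
    using False nn_integral_rho_a_component[OF False, of "\<lambda>z. ennreal ((norm z)\<^sup>2)"]
      nn_integral_complex_gaussian_norm_sq[of "1 / (of_int n)\<^sup>2"]
    by (simp add: a_coeffs_def)
  also have "\<dots> \<le> ennreal (((norm a0)\<^sup>2 + 32) / (bracket n)\<^sup>2)"
  proof (rule ennreal_leI)
    have "(bracket n / 2)\<^sup>2 \<le> \<bar>of_int n\<bar>\<^sup>2"
      using bracket_le[OF False] by (intro power_mono) (auto simp: less_imp_le)
    then have "8 * (1 / (of_int n)\<^sup>2) \<le> 8 * (1 / (bracket n / 2)\<^sup>2)"
      using False by (intro mult_left_mono divide_left_mono mult_pos_pos) auto
    also have "\<dots> = 32 / (bracket n)\<^sup>2"
      by (simp add: power_divide)
    also have "\<dots> \<le> ((norm a0)\<^sup>2 + 32) / (bracket n)\<^sup>2"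
      by (intro divide_right_mono) auto
    finally show "8 * (1 / (of_int n)\<^sup>2) \<le> ((norm a0)\<^sup>2 + 32) / (bracket n)\<^sup>2" .
  qed
  finally show ?thesis .
qed

lemma measurable_a_coeffs_section: "(\<lambda>a. a_coeffs ((a0, b0), (a, b)) n) \<in> borel_measurable rho_a"
  using measurable_rho_a[of n] by (cases "n = 0") (simp_all add: a_coeffs_def)

lemma measurable_b_coeffs_section: "(\<lambda>b. b_coeffs ((a0, b0), (a, b)) n) \<in> borel_measurable (rho_b \<kappa>)"
  using measurable_rho_b[of n] borel_measurable_cnj[OF measurable_rho_b[of "- n"]]
  by (cases "n = 0"; cases "n > 0") (simp_all add: b_coeffs_def conj_extend_def)

text \<open>Young's inequality, weighted by the ratio of the two sizes, takes the place of
  independence, so \<open>j = k\<close> and the zero mode need no separate treatment.\<close>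

lemma nn_integral_a_coeffs_mult:
  "(\<integral>\<^sup>+a. ennreal (norm (a_coeffs ((a0, b0), (a, b)) j) * norm (a_coeffs ((a0, b0), (a, b)) k)) \<partial>rho_a)
    \<le> ennreal (((norm a0)\<^sup>2 + 32) / (bracket j * bracket k))"
proof -
  define l where "l = bracket j / bracket k"
  define c where "c = (norm a0)\<^sup>2 + 32"
  have c: "c \<ge> 0" by (simp add: c_def)
  have l: "l > 0" by (simp add: l_def)
  let ?A = "\<lambda>a. a_coeffs ((a0, b0), (a, b))"
  note [measurable] = measurable_a_coeffs_section
  have "(\<integral>\<^sup>+a. ennreal (norm (?A a j) * norm (?A a k)) \<partial>rho_a)
      \<le> (\<integral>\<^sup>+a. ennreal (l / 2) * ennreal ((norm (?A a j))\<^sup>2) + ennreal (1 / (2 * l)) * ennreal ((norm (?A a k))\<^sup>2) \<partial>rho_a)"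
  proof (rule nn_integral_mono)
    fix a
    have "ennreal (norm (?A a j) * norm (?A a k)) \<le> ennreal (l / 2 * (norm (?A a j))\<^sup>2 + 1 / (2 * l) * (norm (?A a k))\<^sup>2)"
      using young_weighted[OF l, of "norm (?A a j)" "norm (?A a k)"] by (intro ennreal_leI) (simp add: add_divide_distrib)
    also have "\<dots> = ennreal (l / 2) * ennreal ((norm (?A a j))\<^sup>2) + ennreal (1 / (2 * l)) * ennreal ((norm (?A a k))\<^sup>2)"
      using l by (intro ennreal_add_mult) auto
    finally show "ennreal (norm (?A a j) * norm (?A a k)) \<le> \<dots>" .
  qed
  also have "\<dots> = ennreal (l / 2) * (\<integral>\<^sup>+a. ennreal ((norm (?A a j))\<^sup>2) \<partial>rho_a) + ennreal (1 / (2 * l)) * (\<integral>\<^sup>+a. ennreal ((norm (?A a k))\<^sup>2) \<partial>rho_a)"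
    by (simp add: nn_integral_add nn_integral_cmult)
  also have "\<dots> \<le> ennreal (l / 2) * ennreal (c / (bracket j)\<^sup>2) + ennreal (1 / (2 * l)) * ennreal (c / (bracket k)\<^sup>2)"
    unfolding c_def by (intro add_mono mult_left_mono nn_integral_a_coeffs_sq) auto
  also have "\<dots> = ennreal (l / 2 * (c / (bracket j)\<^sup>2) + 1 / (2 * l) * (c / (bracket k)\<^sup>2))"
    using l c by (intro ennreal_add_mult[symmetric]) auto
  also have "l / 2 * (c / (bracket j)\<^sup>2) + 1 / (2 * l) * (c / (bracket k)\<^sup>2) = c / (bracket j * bracket k)"
    using bracket_pos[of j] bracket_pos[of k] by (simp add: l_def power2_eq_square divide_simps)
  finally show ?thesis by (simp add: c_def)
qed

text \<open>Conjugation preserves the modulus, so for \<open>n \<noteq> 0\<close> the coordinate at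
  \<open>\<bar>n\<bar>\<close> decides.\<close>

lemma nn_integral_b_coeffs:
  assumes "\<kappa> > 0"
  shows "(\<integral>\<^sup>+b. ennreal (norm (b_coeffs ((a0, b0), (a, b)) n)) \<partial>rho_b \<kappa>)
    \<le> ennreal ((\<bar>b0\<bar> + 2 / sqrt \<kappa>) / sqrt (bracket n))"
proof (cases "n = 0")
  case True
  interpret prob_space "rho_b \<kappa>" by (rule prob_space_rho_b) fact
  show ?thesis using True assms by (simp add: b_coeffs_def bracket_def emeasure_space_1 ennreal_leI)
next
  case False
  then have n: "\<bar>n\<bar> \<ge> 1" by linarith
  have n0: "\<bar>real_of_int n\<bar> > 0" using False by simp
  have "(\<integral>\<^sup>+b. ennreal (norm (b_coeffs ((a0, b0), (a, b)) n)) \<partial>rho_b \<kappa>)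
      = (\<integral>\<^sup>+b. ennreal (norm (b \<bar>n\<bar>)) \<partial>rho_b \<kappa>)"
    using False by (intro nn_integral_cong) (auto simp: b_coeffs_def conj_extend_def abs_if)
  also have "\<dots> \<le> ennreal (2 * sqrt (1 / (2 * \<kappa> * of_int \<bar>n\<bar>)))"
    using assms n nn_integral_complex_gaussian_norm[of "1 / (2 * \<kappa> * of_int \<bar>n\<bar>)"]
    by (subst nn_integral_rho_b_component) auto
  also have "\<dots> \<le> ennreal ((\<bar>b0\<bar> + 2 / sqrt \<kappa>) / sqrt (bracket n))"
  proof (rule ennreal_leI)
    have "1 / (2 * \<kappa> * of_int \<bar>n\<bar>) \<le> 1 / (\<kappa> * bracket n)"
      using bracket_le[OF False] assms n0 by (intro divide_left_mono mult_pos_pos) auto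
    then have "2 * sqrt (1 / (2 * \<kappa> * of_int \<bar>n\<bar>)) \<le> 2 * sqrt (1 / (\<kappa> * bracket n))"
      by (intro mult_left_mono real_sqrt_le_mono) auto
    also have "\<dots> = 2 / sqrt \<kappa> / sqrt (bracket n)"
      by (simp add: real_sqrt_divide real_sqrt_mult)
    also have "\<dots> \<le> (\<bar>b0\<bar> + 2 / sqrt \<kappa>) / sqrt (bracket n)"
      by (intro divide_right_mono) (auto simp: less_imp_le)
    finally show "2 * sqrt (1 / (2 * \<kappa> * of_int \<bar>n\<bar>)) \<le> (\<bar>b0\<bar> + 2 / sqrt \<kappa>) / sqrt (bracket n)" .
  qed
  finally show ?thesis .
qed

text \<open>For each frozen \<open>(a_0, b_0)\<close> the expectation under \<open>rho\<close> is
  finite by Tonelli and the kernel sum. Freezing is essential: the bound depends on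
  \<open>(a_0, b_0)\<close>, over which Lebesgue measure is infinite. Almost sure finiteness on each
  section then lifts to the product measure.\<close>

lemma AE_pairing_majorant_finite:
  assumes "\<kappa> > 0"
  shows "AE \<omega> in lborel \<Otimes>\<^sub>M rho \<kappa>. (\<integral>\<^sup>+n. \<integral>\<^sup>+k. ennreal (norm (b_coeffs \<omega> (- n)) * (norm (a_coeffs \<omega> (k + n)) * norm (a_coeffs \<omega> k)))
     \<partial>count_space UNIV \<partial>count_space UNIV) < \<infinity>"
proof -
  let ?C = "count_space (UNIV :: int set)"
  let ?T = "\<lambda>\<omega>. \<integral>\<^sup>+n. \<integral>\<^sup>+k. ennreal (norm (b_coeffs \<omega> (- n)) * (norm (a_coeffs \<omega> (k + n)) * norm (a_coeffs \<omega> k))) \<partial>?C \<partial>?C"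
  interpret A: prob_space rho_a by (rule prob_space_rho_a)
  interpret B: prob_space "rho_b \<kappa>" by (rule prob_space_rho_b) fact
  interpret AB: pair_prob_space rho_a "rho_b \<kappa>" ..
  interpret R: prob_space "rho \<kappa>" unfolding rho_eq by (rule AB.prob_space_axioms)
  interpret P: pair_sigma_finite "lborel :: (complex \<times> real) measure" "rho \<kappa>" ..
  note [measurable] = measurable_a_coeffs[of _ \<kappa>] measurable_b_coeffs[of _ \<kappa>]
  have T_meas [measurable]: "?T \<in> borel_measurable (lborel \<Otimes>\<^sub>M rho \<kappa>)"
    by (intro borel_measurable_nn_integral_count_space) measurable
  have fin: "(\<integral>\<^sup>+y. ?T (x, y) \<partial>rho \<kappa>) < \<infinity>" for x
  proof -
    obtain a0 b0 where x: "x = (a0, b0)" by (cases x)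
    define ca where "ca = (norm a0)\<^sup>2 + 32"
    define cb where "cb = \<bar>b0\<bar> + 2 / sqrt \<kappa>"
    have c: "ca \<ge> 0" "cb \<ge> 0" using assms by (auto simp: ca_def cb_def)
    have sect: "(\<lambda>y. f (x, y)) \<in> borel_measurable (rho \<kappa>)" if "f \<in> borel_measurable (lborel \<Otimes>\<^sub>M rho \<kappa>)" for f :: "state \<Rightarrow> complex"
      by (rule measurable_compose[OF measurable_Pair1' that]) simp
    note [measurable] = sect[OF measurable_a_coeffs] sect[OF measurable_b_coeffs]
    have bound: "(\<integral>\<^sup>+y. ennreal (norm (b_coeffs (x, y) (- n)) * (norm (a_coeffs (x, y) (k + n)) * norm (a_coeffs (x, y) k))) \<partial>rho \<kappa>)
        \<le> ennreal (ca * cb) * ennreal (1 / (sqrt (bracket n) * bracket (k + n) * bracket k))" for n k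
    proof -
      note [measurable] = measurable_a_coeffs_section measurable_b_coeffs_section
      \<comment> \<open>\<open>undefined\<close> fills the component that is not read:
        \<open>a_coeffs\<close> ignores \<open>b\<close> and \<open>b_coeffs\<close> ignores
        \<open>a\<close>, so the integral splits into two factors.\<close>
      have "(\<integral>\<^sup>+y. ennreal (norm (b_coeffs (x, y) (- n)) * (norm (a_coeffs (x, y) (k + n)) * norm (a_coeffs (x, y) k))) \<partial>rho \<kappa>)
          = (\<integral>\<^sup>+y. ennreal (norm (a_coeffs ((a0, b0), (fst y, undefined)) (k + n)) * norm (a_coeffs ((a0, b0), (fst y, undefined)) k))
               * ennreal (norm (b_coeffs ((a0, b0), (undefined, snd y)) (- n))) \<partial>(rho_a \<Otimes>\<^sub>M rho_b \<kappa>))"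
        unfolding rho_eq x
        by (intro nn_integral_cong) (auto simp: a_coeffs_def b_coeffs_def ennreal_mult[symmetric] mult_ac)
      also have "\<dots> = (\<integral>\<^sup>+a. ennreal (norm (a_coeffs ((a0, b0), (a, undefined)) (k + n)) * norm (a_coeffs ((a0, b0), (a, undefined)) k)) \<partial>rho_a)
          * (\<integral>\<^sup>+b. ennreal (norm (b_coeffs ((a0, b0), (undefined, b)) (- n))) \<partial>rho_b \<kappa>)"
        by (rule B.nn_integral_pair_mult) measurable
      also have "\<dots> \<le> ennreal (ca / (bracket (k + n) * bracket k)) * ennreal (cb / sqrt (bracket (- n)))"
        unfolding ca_def cb_def
        by (intro mult_mono nn_integral_a_coeffs_mult nn_integral_b_coeffs assms) auto
      also have "\<dots> = ennreal (ca / (bracket (k + n) * bracket k) * (cb / sqrt (bracket (- n))))"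
        using c by (intro ennreal_mult[symmetric]) (auto intro!: divide_nonneg_nonneg simp: less_imp_le)
      also have "ca / (bracket (k + n) * bracket k) * (cb / sqrt (bracket (- n)))
          = (ca * cb) * (1 / (sqrt (bracket n) * bracket (k + n) * bracket k))"
        by (simp add: bracket_def mult_ac)
      also have "ennreal \<dots> = ennreal (ca * cb) * ennreal (1 / (sqrt (bracket n) * bracket (k + n) * bracket k))"
        using c by (intro ennreal_mult) (auto intro!: divide_nonneg_nonneg simp: less_imp_le)
      finally show ?thesis .
    qed
    have "(\<integral>\<^sup>+y. ?T (x, y) \<partial>rho \<kappa>) = (\<integral>\<^sup>+n. \<integral>\<^sup>+k. \<integral>\<^sup>+y. ennreal (norm (b_coeffs (x, y) (- n)) * (norm (a_coeffs (x, y) (k + n)) * norm (a_coeffs (x, y) k))) \<partial>rho \<kappa> \<partial>?C \<partial>?C)"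
      by (subst nn_integral_count_space_nn_integral, simp, rule borel_measurable_nn_integral_count_space, measurable)
         (intro nn_integral_cong nn_integral_count_space_nn_integral, auto)
    also have "\<dots> \<le> (\<integral>\<^sup>+n. \<integral>\<^sup>+k. ennreal (ca * cb) * ennreal (1 / (sqrt (bracket n) * bracket (k + n) * bracket k)) \<partial>?C \<partial>?C)"
      by (intro nn_integral_mono bound)
    also have "\<dots> = ennreal (ca * cb) * (\<integral>\<^sup>+n. \<integral>\<^sup>+k. ennreal (1 / (sqrt (bracket n) * bracket (k + n) * bracket k)) \<partial>?C \<partial>?C)"
      by (simp add: nn_integral_cmult)
    also have "\<dots> < \<infinity>"
      using nn_integral_bracket_kernel_finite by (auto simp: ennreal_mult_less_top)
    finally show ?thesis .
  qed
  show ?thesis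
  proof (rule P.AE_pair_measure)
    show "{\<omega> \<in> space (lborel \<Otimes>\<^sub>M rho \<kappa>). ?T \<omega> < \<infinity>} \<in> sets (lborel \<Otimes>\<^sub>M rho \<kappa>)"
      by measurable
    show "AE x in lborel. AE y in rho \<kappa>. ?T (x, y) < \<infinity>"
    proof (rule AE_I2)
      fix x :: "complex \<times> real"
      have "(\<lambda>y. ?T (x, y)) \<in> borel_measurable (rho \<kappa>)"
        by (rule measurable_compose[OF measurable_Pair1' T_meas]) simp
      then have "AE y in rho \<kappa>. ?T (x, y) \<noteq> \<infinity>"
        by (rule nn_integral_PInf_AE) (use fin[of x] in auto)
      then show "AE y in rho \<kappa>. ?T (x, y) < \<infinity>"
        by eventually_elim (simp add: less_top)
    qed
  qed
qed

text \<open>Ensures that the \<open>infsum\<close> in \<open>pairing\<close> is a genuine sum rather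
  than its default \<open>0\<close>; the inner sum of the majorant dominates the
  autocorrelation.\<close>

lemma AE_pairing_term_summable:
  assumes "\<kappa> > 0"
  shows "AE \<omega> in lborel \<Otimes>\<^sub>M rho \<kappa>. sq_summable (a_coeffs \<omega>) \<longrightarrow>
    pairing_term (b_coeffs \<omega>) (a_coeffs \<omega>) summable_on UNIV"
  using AE_pairing_majorant_finite[OF assms]
proof eventually_elim
  case (elim \<omega>)
  let ?a = "a_coeffs \<omega>" and ?b = "b_coeffs \<omega>"
  show ?case
  proof
    assume a: "sq_summable ?a"
    have "(\<integral>\<^sup>+n. ennreal (norm (pairing_term ?b ?a n)) \<partial>count_space UNIV)
        \<le> (\<integral>\<^sup>+n. \<integral>\<^sup>+k. ennreal (norm (?b (- n)) * (norm (?a (k + n)) * norm (?a k))) \<partial>count_space UNIV \<partial>count_space UNIV)"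
    proof (rule nn_integral_mono)
      fix n :: int
      have s: "(\<lambda>k. norm (?a (k + n)) * norm (?a k)) summable_on UNIV"
        using acorr_abs_summable[OF a, of n] by (simp add: norm_mult)
      have "norm (pairing_term ?b ?a n) \<le> norm (?b (- n)) * (\<Sum>\<^sub>\<infinity>k. norm (?a (k + n)) * norm (?a k))"
        unfolding pairing_term_eq[OF a] norm_mult by (intro mult_left_mono norm_acorr_le_infsum a) simp
      also have "\<dots> = (\<Sum>\<^sub>\<infinity>k. norm (?b (- n)) * (norm (?a (k + n)) * norm (?a k)))"
        by (rule infsum_cmult_right'[symmetric])
      finally have "ennreal (norm (pairing_term ?b ?a n)) \<le> ennreal \<dots>"
        by (rule ennreal_leI)
      also have "\<dots> = (\<integral>\<^sup>+k. ennreal (norm (?b (- n)) * (norm (?a (k + n)) * norm (?a k))) \<partial>count_space UNIV)"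
        using s by (intro nn_integral_count_space_eq_infsum(1)[symmetric] summable_on_cmult_right) auto
      finally show "ennreal (norm (pairing_term ?b ?a n)) \<le> \<dots>" .
    qed
    also have "\<dots> < \<infinity>" by (rule elim)
    finally have "(\<lambda>n. norm (pairing_term ?b ?a n)) summable_on UNIV"
      by (intro nn_integral_count_space_eq_infsum(2)) auto
    then show "pairing_term ?b ?a summable_on UNIV"
      by (rule Infinite_Sum.abs_summable_summable)
  qed
qed

section \<open>Exponential bound for the full pairing\<close>

lemma sum_symmetric_int:
  "(\<Sum>n\<in>{- int M..int M}. f n) = f 0 + (\<Sum>n\<in>{1..int M}. f n + f (- n))" for f :: "int \<Rightarrow> 'a::comm_monoid_add"
proof -
  have "{- int M..int M} = insert 0 ({1..int M} \<union> uminus ` {1..int M})"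
    by (force simp: image_iff intro: bexI[of _ "- x" for x])
  moreover have "(\<Sum>n\<in>{1..int M} \<union> uminus ` {1..int M}. f n) = (\<Sum>n\<in>{1..int M}. f n) + (\<Sum>n\<in>uminus ` {1..int M}. f n)"
    by (rule sum.union_disjoint) auto
  moreover have "(\<Sum>n\<in>uminus ` {1..int M}. f n) = (\<Sum>n\<in>{1..int M}. f (- n))"
    by (subst sum.reindex) (auto simp: inj_on_def)
  ultimately show ?thesis
    by (simp add: sum.distrib)
qed

text \<open>The terms at \<open>n\<close> and \<open>-n\<close> are conjugate. Folding them leaves
  the independent coordinates \<open>b_n\<close> with \<open>n >= 1\<close>, each with a factor
  2.\<close>

lemma Re_pairing_partial_sum:
  assumes "sq_summable (a_coeffs ((a0, b0), (a, b)))"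
  shows "Re (\<Sum>n\<in>{- int M..int M}. pairing_term (b_coeffs ((a0, b0), (a, b))) (a_coeffs ((a0, b0), (a, b))) n)
    = b0 * Re (acorr (a_coeffs ((a0, b0), (a, b))) 0)
      + 2 * (\<Sum>n\<in>{1..int M}. Re (cnj (acorr (a_coeffs ((a0, b0), (a, b))) n) * b n))"
proof -
  let ?c = "acorr (a_coeffs ((a0, b0), (a, b)))" and ?p = "pairing_term (b_coeffs ((a0, b0), (a, b))) (a_coeffs ((a0, b0), (a, b)))"
  have "Re (?p n + ?p (- n)) = 2 * Re (cnj (?c n) * b n)" if "n \<in> {1..int M}" for n
    using that by (simp add: pairing_term_eq[OF assms] b_coeffs_def conj_extend_def acorr_minus)
  moreover have "Re (?p 0) = b0 * Re (?c 0)"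
    by (simp add: pairing_term_eq[OF assms] b_coeffs_def)
  ultimately show ?thesis
    unfolding sum_symmetric_int by (simp add: sum_distrib_left)
qed

text \<open>The integration runs over \<open>b\<close> innermost, then \<open>a\<close>, then
  \<open>(a_0, b_0)\<close>: the cutoff does not involve the nonzero modes of \<open>b\<close>, so
  it is constant in the exact Gaussian integral.\<close>

proposition in_Lp_full:
  assumes "\<kappa> > 0" "B > 0" "r > 0"
  shows "in_Lp r (lborel \<Otimes>\<^sub>M rho \<kappa>)
           (\<lambda>\<omega>. exp (- (complex_of_real \<alpha> / 2) * pairing (b_coeffs \<omega>) (a_coeffs \<omega>)) *
                 indicator (Omega B) \<omega>)"
    (is "in_Lp r ?M ?f")
proof (rule in_LpI)
  note [measurable] = measurable_a_coeffs[of _ \<kappa>] measurable_b_coeffs[of _ \<kappa>] measurable_Omega[OF assms(2), of \<kappa>]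
  have acorr_meas [measurable]: "(\<lambda>\<omega>. acorr (a_coeffs \<omega>) n) \<in> borel_measurable ?M" for n
    by (rule borel_measurable_acorr) measurable
  \<comment> \<open>On \<open>Omega B\<close> the chosen representative can be replaced by the
    autocorrelation, and elsewhere the indicator removes the exponential. The right-hand side is
    free of the choice operator and therefore accessible to measurability rules.\<close>
  have "?f = (\<lambda>\<omega>. if \<omega> \<in> Omega B then exp (- (complex_of_real \<alpha> / 2) * (\<Sum>\<^sub>\<infinity>n. b_coeffs \<omega> (- n) * acorr (a_coeffs \<omega>) n)) else 0)"
    by (rule ext) (auto simp: pairing_eq_infsum Omega_iff[OF assms(2)])
  also have "\<dots> \<in> borel_measurable ?M"
  proof -
    have [measurable]: "(\<lambda>\<omega>. \<Sum>\<^sub>\<infinity>n. b_coeffs \<omega> (- n) * acorr (a_coeffs \<omega>) n) \<in> borel_measurable ?M"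
      by (rule borel_measurable_infsum) measurable
    show ?thesis by measurable
  qed
  finally show f_meas: "?f \<in> borel_measurable ?M" .

  interpret A: prob_space rho_a by (rule prob_space_rho_a)
  interpret B: prob_space "rho_b \<kappa>" by (rule prob_space_rho_b) fact
  interpret AB: pair_prob_space rho_a "rho_b \<kappa>" ..
  interpret R: prob_space "rho \<kappa>" unfolding rho_eq by (rule AB.prob_space_axioms)
  \<comment> \<open>Constant produced by the Gaussian integral:
    \<open>(norm w)^2 / (4 * \<kappa> * n)\<close> with \<open>w\<close> of modulus
    \<open>r * \<bar>\<alpha>\<bar> * norm c_n\<close>.\<close>
  define D where "D = r\<^sup>2 * \<alpha>\<^sup>2 / (4 * \<kappa>)"
  have "D \<ge> 0" using assms by (simp add: D_def)
  then obtain K where K: "\<And>a M. \<lbrakk>sq_summable a; (\<Sum>\<^sub>\<infinity>k. (norm (a k))\<^sup>2) \<le> B\<^sup>2; sobolev a summable_on UNIV\<rbrakk> \<Longrightarrow>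
      D * (\<Sum>n\<in>{1..int M}. (norm (acorr a n))\<^sup>2 / of_int n) \<le> K + (\<Sum>\<^sub>\<infinity>k. sobolev a k) / 4"
    using acorr_weighted_sum_le[OF _ assms(2)] by blast
  \<comment> \<open>Zero mode of the pairing: \<open>|b_0| |c_0| <= B * B^2\<close> on the
    cutoff.\<close>
  define K0 where "K0 = exp (r * \<bar>\<alpha>\<bar> / 2 * B ^ 3)"
  \<comment> \<open>The factor 2 from folding \<open>n\<close> with \<open>-n\<close> cancels the
    \<open>1/2\<close> in the exponent.\<close>
  define w where "w \<omega> n = - complex_of_real (r * \<alpha>) * cnj (acorr (a_coeffs \<omega>) n)" for \<omega> n
  define G where "G M \<omega> = ennreal K0 * indicator (Omega B) \<omega> * ennreal (exp (\<Sum>n\<in>{1..int M}. Re (w \<omega> n * b_coeffs \<omega> n)))"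
    for M :: nat and \<omega> :: state
  have w_meas [measurable]: "(\<lambda>\<omega>. w \<omega> n) \<in> borel_measurable ?M" for n
    unfolding w_def by measurable
  have G_meas [measurable]: "G M \<in> borel_measurable ?M" for M
    unfolding G_def indicator_def by measurable

  \<comment> \<open>The integrand is the limit of the exponentials of the symmetric partial sums,
    each at most \<open>G M\<close>; taking liminf on both sides avoids any question about
    convergence of \<open>G M\<close> itself.\<close>
  have dominated: "AE \<omega> in ?M. ennreal (norm (?f \<omega>) powr r) \<le> liminf (\<lambda>M. G M \<omega>)"
    using AE_pairing_term_summable[OF assms(1)]
  proof eventually_elim
    case (elim \<omega>)
    show ?case
    proof (cases "\<omega> \<in> Omega B")
      case False
      then show ?thesis by simp
    next
      case True
      obtain a0 b0 a b where \<omega>: "\<omega> = ((a0, b0), (a, b))" by (cases \<omega>) auto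
      let ?p = "pairing_term (b_coeffs \<omega>) (a_coeffs \<omega>)"
      have a: "sq_summable (a_coeffs \<omega>)" and nB: "(\<Sum>\<^sub>\<infinity>n. (norm (a_coeffs \<omega> n))\<^sup>2) \<le> B\<^sup>2" and b0: "\<bar>b0\<bar> \<le> B"
        using True by (auto simp: Omega_iff[OF assms(2)] \<omega>)
      have "(\<lambda>M. \<Sum>n\<in>{- int M..int M}. ?p n) \<longlonglongrightarrow> pairing (b_coeffs \<omega>) (a_coeffs \<omega>)"
        unfolding pairing_def using elim a by (intro has_sum_imp_tendsto_symmetric has_sum_infsum) auto
      then have "(\<lambda>M. ennreal (exp (r * Re (- (complex_of_real \<alpha> / 2) * (\<Sum>n\<in>{- int M..int M}. ?p n)))))
          \<longlonglongrightarrow> ennreal (exp (r * Re (- (complex_of_real \<alpha> / 2) * pairing (b_coeffs \<omega>) (a_coeffs \<omega>))))"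
        by (intro tendsto_ennrealI tendsto_exp tendsto_mult tendsto_const tendsto_Re)
      from lim_imp_Liminf[OF sequentially_bot this]
      have "ennreal (norm (?f \<omega>) powr r) = liminf (\<lambda>M. ennreal (exp (r * Re (- (complex_of_real \<alpha> / 2) * (\<Sum>n\<in>{- int M..int M}. ?p n)))))"
        using True by (simp only: norm_exp_powr indicator_simps mult_1_right)
      also have "\<dots> \<le> liminf (\<lambda>M. G M \<omega>)"
      proof (rule Liminf_mono, rule always_eventually, rule allI)
        fix M :: nat
        have "r * Re (- (complex_of_real \<alpha> / 2) * (\<Sum>n\<in>{- int M..int M}. ?p n))
            = - (r * \<alpha> / 2) * Re (\<Sum>n\<in>{- int M..int M}. ?p n)"
          by (simp del: Re_sum)
        also have "\<dots> = - (r * \<alpha> / 2) * (b0 * Re (acorr (a_coeffs \<omega>) 0)) + (\<Sum>n\<in>{1..int M}. Re (w \<omega> n * b_coeffs \<omega> n))"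
        proof -
          have "Re (w \<omega> n * b_coeffs \<omega> n) = - (r * \<alpha>) * Re (cnj (acorr (a_coeffs \<omega>) n) * b n)" if "n \<in> {1..int M}" for n
            using that by (simp add: w_def \<omega> b_coeffs_def conj_extend_def algebra_simps)
          then have "(\<Sum>n\<in>{1..int M}. Re (w \<omega> n * b_coeffs \<omega> n)) = - (r * \<alpha>) * (\<Sum>n\<in>{1..int M}. Re (cnj (acorr (a_coeffs \<omega>) n) * b n))"
            unfolding sum_distrib_left by (intro sum.cong refl)
          then show ?thesis
            using Re_pairing_partial_sum[OF a[unfolded \<omega>], of M] unfolding \<omega>[symmetric] by (simp add: algebra_simps del: Re_sum)
        qed
        also have "- (r * \<alpha> / 2) * (b0 * Re (acorr (a_coeffs \<omega>) 0)) \<le> r * \<bar>\<alpha>\<bar> / 2 * B ^ 3"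
        proof -
          have "- (r * \<alpha> / 2) * (b0 * Re (acorr (a_coeffs \<omega>) 0)) \<le> \<bar>- (r * \<alpha> / 2) * (b0 * Re (acorr (a_coeffs \<omega>) 0))\<bar>"
            by (rule abs_ge_self)
          also have "\<dots> = r * \<bar>\<alpha>\<bar> / 2 * (\<bar>b0\<bar> * \<bar>Re (acorr (a_coeffs \<omega>) 0)\<bar>)"
            using assms by (simp add: abs_mult)
          also have "\<dots> \<le> r * \<bar>\<alpha>\<bar> / 2 * (B * B\<^sup>2)"
            using assms b0 order_trans[OF abs_Re_le_cmod order_trans[OF norm_acorr_le[OF a] nB]]
            by (intro mult_left_mono mult_mono) auto
          finally show ?thesis by (simp add: power3_eq_cube power2_eq_square)
        qed
        finally have "exp (r * Re (- (complex_of_real \<alpha> / 2) * (\<Sum>n\<in>{- int M..int M}. ?p n)))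
            \<le> K0 * exp (\<Sum>n\<in>{1..int M}. Re (w \<omega> n * b_coeffs \<omega> n))"
          unfolding K0_def by (simp only: exp_add[symmetric] exp_le_cancel_iff add_le_cancel_right)
        then have "ennreal (exp (r * Re (- (complex_of_real \<alpha> / 2) * (\<Sum>n\<in>{- int M..int M}. ?p n))))
            \<le> ennreal (K0 * exp (\<Sum>n\<in>{1..int M}. Re (w \<omega> n * b_coeffs \<omega> n)))"
          by (rule ennreal_leI)
        also have "\<dots> = G M \<omega>"
          using True by (simp add: G_def ennreal_mult K0_def)
        finally show "ennreal (exp (r * Re (- (complex_of_real \<alpha> / 2) * (\<Sum>n\<in>{- int M..int M}. ?p n)))) \<le> G M \<omega>" .
      qed
      finally show ?thesis .
    qed
  qed

  define box where "box = cball (0::complex) B \<times> cball (0::real) B"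
  have box: "emeasure lborel box < \<infinity>"
    by (rule emeasure_bounded_finite) (simp add: box_def bounded_Times)
  have box_sets [measurable]: "box \<in> sets borel"
    unfolding box_def by (intro borel_closed closed_Times closed_cball)
  define E where "E = (\<integral>\<^sup>+a. ennreal (exp ((\<Sum>\<^sub>\<infinity>k. sobolev a k) / 4)) \<partial>rho_a)"
  define U where "U = ennreal K0 * ennreal (exp K) * E * emeasure lborel box"
  have U: "U < \<infinity>"
    using box nn_integral_exp_sobolev_finite by (simp add: U_def E_def ennreal_mult_less_top)

  have inner: "(\<integral>\<^sup>+b. G M (x, (a, b)) \<partial>rho_b \<kappa>) \<le> ennreal K0 * ennreal (exp K) * ennreal (exp ((\<Sum>\<^sub>\<infinity>k. sobolev a k) / 4)) * indicator box x"
    if H: "sobolev a summable_on UNIV" for M x a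
  proof -
    obtain a0 b0 where x: "x = (a0, b0)" by (cases x)
    let ?A = "a_coeffs (x, (a, undefined))"
    \<comment> \<open>Neither the coefficients of \<open>phi\<close> nor the cutoff reads the
      \<open>b\<close> modes, so \<open>w\<close> and \<open>Omega B\<close> are frozen in the
      innermost integral.\<close>
    have Aeq: "a_coeffs (x, (a, b)) = ?A" for b
      by (simp add: a_coeffs_def x fun_eq_iff)
    have beq: "b_coeffs (x, (a, b)) n = b n" if "n \<in> {1..int M}" for b n
      using that by (simp add: b_coeffs_def conj_extend_def x)
    have weq: "w (x, (a, b)) = w (x, (a, undefined))" for b
      by (simp add: w_def Aeq[of b] fun_eq_iff)
    have Om: "(x, (a, b)) \<in> Omega B \<longleftrightarrow> (x, (a, undefined)) \<in> Omega B" for b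
      by (simp add: Omega_iff[OF assms(2)] Aeq[of b])
    show ?thesis
    proof (cases "(x, (a, undefined)) \<in> Omega B")
      case False
      then have "(x, (a, b)) \<notin> Omega B" for b using Om[of b] by simp
      then show ?thesis by (simp add: G_def)
    next
      case True
      then have A: "sq_summable ?A" "(\<Sum>\<^sub>\<infinity>k. (norm (?A k))\<^sup>2) \<le> B\<^sup>2" and b0: "\<bar>b0\<bar> \<le> B"
        by (auto simp: Omega_iff[OF assms(2)] x)
      \<comment> \<open>The two sequences can differ in \<open>a_0\<close>, where the weight is
        zero.\<close>
      have sob: "sobolev ?A = sobolev a"
        by (auto simp: sobolev_def a_coeffs_def x fun_eq_iff)
      have "x \<in> box"
      proof -
        have "(norm (?A 0))\<^sup>2 \<le> (\<Sum>\<^sub>\<infinity>k. (norm (?A k))\<^sup>2)"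
          using finite_sum_le_infsum[of "\<lambda>k. (norm (?A k))\<^sup>2" UNIV "{0}"] A by (simp add: sq_summable_def)
        then have "(norm a0)\<^sup>2 \<le> B\<^sup>2"
          using order_trans[OF _ A(2), of "(norm (?A 0))\<^sup>2"] by (simp add: a_coeffs_def x)
        then have "norm a0 \<le> B"
          by (rule power2_le_imp_le) (use assms(2) in simp)
        then show ?thesis using b0 by (simp add: box_def x)
      qed
      have "(\<integral>\<^sup>+b. G M (x, (a, b)) \<partial>rho_b \<kappa>)
          = (\<integral>\<^sup>+b. ennreal K0 * ennreal (exp (\<Sum>n\<in>{1..int M}. Re (w (x, (a, undefined)) n * b n))) \<partial>rho_b \<kappa>)"
      proof (rule nn_integral_cong)
        fix b
        have "(\<Sum>n\<in>{1..int M}. Re (w (x, (a, b)) n * b_coeffs (x, (a, b)) n))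
            = (\<Sum>n\<in>{1..int M}. Re (w (x, (a, undefined)) n * b n))"
          by (intro sum.cong refl) (simp only: weq[of b] beq)
        moreover have "(x, (a, b)) \<in> Omega B" using True Om[of b] by simp
        ultimately show "G M (x, (a, b)) = ennreal K0 * ennreal (exp (\<Sum>n\<in>{1..int M}. Re (w (x, (a, undefined)) n * b n)))"
          by (simp add: G_def)
      qed
      also have "\<dots> = ennreal K0 * (\<integral>\<^sup>+b. ennreal (exp (\<Sum>n\<in>{1..int M}. Re (w (x, (a, undefined)) n * b n))) \<partial>rho_b \<kappa>)"
      proof (rule nn_integral_cmult)
        have "(\<lambda>b. b n) \<in> borel_measurable (rho_b \<kappa>)" if "n \<in> {1..int M}" for n
          using that by (intro measurable_rho_b) auto
        note [measurable] = this
        show "(\<lambda>b. ennreal (exp (\<Sum>n\<in>{1..int M}. Re (w (x, (a, undefined)) n * b n)))) \<in> borel_measurable (rho_b \<kappa>)"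
          by measurable
      qed
      also have "\<dots> = ennreal K0 * ennreal (exp (\<Sum>n\<in>{1..int M}. (norm (w (x, (a, undefined)) n))\<^sup>2 / (4 * \<kappa> * of_int n)))"
        by (subst nn_integral_rho_b_exp) (use assms in auto)
      also have "(\<Sum>n\<in>{1..int M}. (norm (w (x, (a, undefined)) n))\<^sup>2 / (4 * \<kappa> * of_int n))
          = D * (\<Sum>n\<in>{1..int M}. (norm (acorr ?A n))\<^sup>2 / of_int n)"
        unfolding sum_distrib_left
        by (intro sum.cong) (auto simp: w_def D_def norm_mult power_mult_distrib)
      also have "ennreal K0 * ennreal (exp \<dots>) \<le> ennreal K0 * ennreal (exp (K + (\<Sum>\<^sub>\<infinity>k. sobolev a k) / 4))"
        using K[OF A, of M] H unfolding sob by (intro mult_left_mono ennreal_leI) auto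
      also have "\<dots> = ennreal K0 * ennreal (exp K) * ennreal (exp ((\<Sum>\<^sub>\<infinity>k. sobolev a k) / 4)) * indicator box x"
        using \<open>x \<in> box\<close> by (simp add: exp_add ennreal_mult mult.assoc)
      finally show ?thesis .
    qed
  qed

  have step: "(\<integral>\<^sup>+\<omega>. G M \<omega> \<partial>?M) \<le> U" for M
  proof -
    have sect: "(\<lambda>y. G M (x, y)) \<in> borel_measurable (rho_a \<Otimes>\<^sub>M rho_b \<kappa>)" for x
      unfolding rho_eq[symmetric] by (rule measurable_compose[OF measurable_Pair1' G_meas]) simp
    have sob_meas [measurable]: "(\<lambda>a. \<Sum>\<^sub>\<infinity>k. sobolev a k) \<in> borel_measurable rho_a"
    proof -
      have "(\<Sum>\<^sub>\<infinity>k. sobolev a k) = enn2real (\<integral>\<^sup>+k. ennreal (sobolev a k) \<partial>count_space UNIV)" for a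
        by (rule infsum_eq_enn2real_nn_integral) simp
      then show ?thesis
        by (simp only:) (intro borel_measurable_enn2real borel_measurable_nn_integral_count_space, measurable)
    qed
    have "(\<integral>\<^sup>+\<omega>. G M \<omega> \<partial>?M) = (\<integral>\<^sup>+x. \<integral>\<^sup>+y. G M (x, y) \<partial>rho \<kappa> \<partial>lborel)"
      by (rule R.nn_integral_fst[symmetric]) measurable
    also have "\<dots> = (\<integral>\<^sup>+x. \<integral>\<^sup>+a. \<integral>\<^sup>+b. G M (x, (a, b)) \<partial>rho_b \<kappa> \<partial>rho_a \<partial>lborel)"
      unfolding rho_eq by (intro nn_integral_cong B.nn_integral_fst[symmetric] sect)
    also have "\<dots> \<le> (\<integral>\<^sup>+x. \<integral>\<^sup>+a. ennreal K0 * ennreal (exp K) * ennreal (exp ((\<Sum>\<^sub>\<infinity>k. sobolev a k) / 4)) * indicator box x \<partial>rho_a \<partial>lborel)"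
      using AE_sobolev_summable
      by (intro nn_integral_mono nn_integral_mono_AE) (auto elim!: eventually_mono intro: inner)
    also have "\<dots> = (\<integral>\<^sup>+x. ennreal K0 * ennreal (exp K) * E * indicator box x \<partial>lborel)"
      unfolding E_def by (simp add: nn_integral_multc nn_integral_cmult)
    also have "\<dots> = U"
      unfolding U_def by (rule nn_integral_cmult_indicator) simp
    finally show ?thesis .
  qed
  have "(\<integral>\<^sup>+\<omega>. ennreal (norm (?f \<omega>) powr r) \<partial>?M) \<le> (\<integral>\<^sup>+\<omega>. liminf (\<lambda>M. G M \<omega>) \<partial>?M)"
    using dominated by (rule nn_integral_mono_AE)
  also have "\<dots> \<le> liminf (\<lambda>M. \<integral>\<^sup>+\<omega>. G M \<omega> \<partial>?M)"
    by (rule nn_integral_liminf) measurable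
  also have "\<dots> \<le> U"
    by (rule Liminf_le) (auto intro: always_eventually step)
  also have "\<dots> < \<infinity>" by (rule U)
  finally show "(\<integral>\<^sup>+\<omega>. ennreal (norm (?f \<omega>) powr r) \<partial>?M) < \<infinity>" .
qed

text \<open>The middle conjunct certifies that the untruncated pairing is a convergent sum almost
  everywhere on the cutoff; otherwise the last conjunct could speak of the default value
  \<open>0\<close>. The truncated pairing has finitely many nonzero terms and needs no such
  clause.\<close>

theorem lemma4p5:
  fixes \<alpha> \<beta> \<gamma> \<kappa> B r :: real and N :: nat
  assumes "\<alpha> \<noteq> 0" and "\<beta> \<noteq> 0" and "\<gamma> \<noteq> 0"
    and "\<kappa> = - (\<alpha> * \<gamma> / (2 * \<beta>))" and "\<kappa> > 0"
    and "B > 0" and "r > 0"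
  shows "in_Lp r (lborel \<Otimes>\<^sub>M rho_trunc \<kappa> N)
           (\<lambda>\<omega>. exp (- (complex_of_real \<alpha> / 2) *
                   pairing (freq_proj N (b_coeffs \<omega>)) (freq_proj N (a_coeffs \<omega>))) *
                 indicator (Omega_trunc N B) \<omega>) \<and>
         (AE \<omega> in lborel \<Otimes>\<^sub>M rho \<kappa>.
            \<omega> \<in> Omega B \<longrightarrow> pairing_term (b_coeffs \<omega>) (a_coeffs \<omega>) summable_on UNIV) \<and>
         in_Lp r (lborel \<Otimes>\<^sub>M rho \<kappa>)
           (\<lambda>\<omega>. exp (- (complex_of_real \<alpha> / 2) * pairing (b_coeffs \<omega>) (a_coeffs \<omega>)) *
                 indicator (Omega B) \<omega>)"
proof (intro conjI)
  show "AE \<omega> in lborel \<Otimes>\<^sub>M rho \<kappa>.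
      \<omega> \<in> Omega B \<longrightarrow> pairing_term (b_coeffs \<omega>) (a_coeffs \<omega>) summable_on UNIV"
    using AE_pairing_term_summable[OF assms(5)]
    by eventually_elim (simp add: Omega_iff[OF assms(6)])
qed (rule in_Lp_trunc in_Lp_full; fact)+

end
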